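(* Let $(V,c_V)$ be a countable algebraic tree, and for each $x\in V$ let $A\mapsto\psi_A(x)$ be a probability measure on the countable set $\mathcal{C}_x:=\{\mathcal{S}^{(V,c_V)}_x(y):y\in V\}$ (i.e. $\psi_A(x)\ge0$ and $\sum_{A\in\mathcal{C}_x}\psi_A(x)=1$). Define $\psi_y(x):=\psi_{\mathcal{S}_x(y)}(x)$ for $x,y\in V$. Assume that for all $x,y\in V$ with $x\neq y$, $$\psi_x(y)+\psi_y(x)\ge1.$$ Then there is a unique (up to equivalence) algebraic measure tree $(T,c,\mu)$ such that (i) $V\subseteq T$ (with $c$ extending $c_V$) and $\mathrm{br}(T,c)=\mathrm{br}(V,c_V)$; (ii) $\mu\big(\mathcal{S}^{(T,c)}_x(y)\big)=\psi_y(x)$ for all $x,y\in V$; (iii) $\mathrm{at}(\mu)\subseteq V$, where $\mathrm{at}(\mu)$ denotes the set of atoms of $\mu$.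
   Context: An algebraic tree $(T,c)$ is a set $T\neq\emptyset$ with a map $c\colon T^3\to T$ such that for all points: $c$ is symmetric; $c(x,y,y)=y$; $c(x,y,c(x,y,z))=c(x,y,z)$; $c(x_1,x_2,x_3)\in\{c(x_1,x_2,x_4),c(x_1,x_3,x_4),c(x_2,x_3,x_4)\}$. Intervals: $[x,y]:=\{z: c(x,y,z)=z\}$, $[x,y):=[x,y]\setminus\{y\}$. For $x\ne y$ let $\mathcal{S}_x(y)=\mathcal{S}^{(T,c)}_x(y):=\{z\in T\setminus\{x\}: c(x,y,z)\neq x\}$, and put $\mathcal{S}_x(x):=\{x\}$. $\mathrm{br}(T,c)$ is the set of $u\in T$ with $c(x,v,w)=u$ for some $x,v,w\in T\setminus\{u\}$. The component topology on $T$ is generated by the sets $\mathcal{S}_x(y)$, $x\neq y$; $\mathcal{B}(T,c)$ is its Borel $\sigma$-algebra. $(T,c)$ is order separable if there is a countable $D\subseteq T$ with $D\cap[x,y)\ne\emptyset$ for all $x\ne y$. A subtree is a non-empty $A\subseteq T$ with $c(A^3)\subseteq A$; a tree isomorphism is a bijection commuting with the branch point maps. An algebraic measure tree $(T,c,\mu)$ is an order separable algebraic tree with a probability measure $\mu$ on $\mathcal{B}(T,c)$. Two of them, $(T_i,c_i,\mu_i)$, are equivalent if there are subtrees $A_i\subseteq T_i$ with $\mu_i(A_i)=1$ and a measure preserving tree isomorphism $A_1\to A_2$.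
   Formalization: Uniqueness up to equivalence is false for non-measurable carriers (thick subsets of [0,1]); it is proved for realizations whose μ is tight (compact sets carry almost all mass). Any other realization is only shown to embed, up to a null set, measure-preservingly into the one tight T constructed. *)

theory Defs
  imports "HOL-Probability.Probability"
begin


text \<open>
  A tree is a carrier \<open>T\<close> together with a total function \<open>c\<close>, of which only the values on \<open>T\<close> matter.
\<close>

definition algebraic_tree :: "'a set \<Rightarrow> ('a \<Rightarrow> 'a \<Rightarrow> 'a \<Rightarrow> 'a) \<Rightarrow> bool" where
  "algebraic_tree T c \<longleftrightarrow>
     T \<noteq> {} \<and>
     (\<forall>x\<in>T. \<forall>y\<in>T. \<forall>z\<in>T. c x y z \<in> T) \<and>
     (\<forall>x\<in>T. \<forall>y\<in>T. \<forall>z\<in>T. c x y z = c y x z \<and> c x y z = c x z y) \<and>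
     (\<forall>x\<in>T. \<forall>y\<in>T. c x y y = y) \<and>
     (\<forall>x\<in>T. \<forall>y\<in>T. \<forall>z\<in>T. c x y (c x y z) = c x y z) \<and>
     (\<forall>x1\<in>T. \<forall>x2\<in>T. \<forall>x3\<in>T. \<forall>x4\<in>T.
        c x1 x2 x3 \<in> {c x1 x2 x4, c x1 x3 x4, c x2 x3 x4})"

definition tree_interval :: "'a set \<Rightarrow> ('a \<Rightarrow> 'a \<Rightarrow> 'a \<Rightarrow> 'a) \<Rightarrow> 'a \<Rightarrow> 'a \<Rightarrow> 'a set" where
  "tree_interval T c x y = {z \<in> T. c x y z = z}"

definition tree_component :: "'a set \<Rightarrow> ('a \<Rightarrow> 'a \<Rightarrow> 'a \<Rightarrow> 'a) \<Rightarrow> 'a \<Rightarrow> 'a \<Rightarrow> 'a set" where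
  "tree_component T c x y = (if x = y then {x} else {z \<in> T - {x}. c x y z \<noteq> x})"

definition branch_points :: "'a set \<Rightarrow> ('a \<Rightarrow> 'a \<Rightarrow> 'a \<Rightarrow> 'a) \<Rightarrow> 'a set" where
  "branch_points T c =
     {u \<in> T. \<exists>x\<in>T - {u}. \<exists>v\<in>T - {u}. \<exists>w\<in>T - {u}. c x v w = u}"

text \<open>
  The carrier is added to the generating family only because \<^const>\<open>topology_generated_by\<close>
  takes the union of that family as the underlying space; the family is empty if \<open>T\<close> is a singleton.
\<close>

definition component_topology :: "'a set \<Rightarrow> ('a \<Rightarrow> 'a \<Rightarrow> 'a \<Rightarrow> 'a) \<Rightarrow> 'a topology" where
  "component_topology T c =
     topology_generated_by
       (insert T {tree_component T c x y | x y. x \<in> T \<and> y \<in> T \<and> x \<noteq> y})"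

definition component_borel :: "'a set \<Rightarrow> ('a \<Rightarrow> 'a \<Rightarrow> 'a \<Rightarrow> 'a) \<Rightarrow> 'a set set" where
  "component_borel T c = sigma_sets T {U. openin (component_topology T c) U}"

definition order_separable :: "'a set \<Rightarrow> ('a \<Rightarrow> 'a \<Rightarrow> 'a \<Rightarrow> 'a) \<Rightarrow> bool" where
  "order_separable T c \<longleftrightarrow>
     (\<exists>D\<subseteq>T. countable D \<and>
        (\<forall>x\<in>T. \<forall>y\<in>T. x \<noteq> y \<longrightarrow> D \<inter> (tree_interval T c x y - {y}) \<noteq> {}))"

definition subtree :: "'a set \<Rightarrow> ('a \<Rightarrow> 'a \<Rightarrow> 'a \<Rightarrow> 'a) \<Rightarrow> 'a set \<Rightarrow> bool" where
  "subtree T c A \<longleftrightarrow>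
     A \<noteq> {} \<and> A \<subseteq> T \<and> (\<forall>x\<in>A. \<forall>y\<in>A. \<forall>z\<in>A. c x y z \<in> A)"

definition tree_hom ::
  "'a set \<Rightarrow> ('a \<Rightarrow> 'a \<Rightarrow> 'a \<Rightarrow> 'a) \<Rightarrow> 'b set \<Rightarrow> ('b \<Rightarrow> 'b \<Rightarrow> 'b \<Rightarrow> 'b) \<Rightarrow> ('a \<Rightarrow> 'b) \<Rightarrow> bool" where
  "tree_hom A c B d f \<longleftrightarrow>
     f ` A \<subseteq> B \<and> (\<forall>x\<in>A. \<forall>y\<in>A. \<forall>z\<in>A. f (c x y z) = d (f x) (f y) (f z))"

definition tree_embedding ::
  "'a set \<Rightarrow> ('a \<Rightarrow> 'a \<Rightarrow> 'a \<Rightarrow> 'a) \<Rightarrow> 'b set \<Rightarrow> ('b \<Rightarrow> 'b \<Rightarrow> 'b \<Rightarrow> 'b) \<Rightarrow> ('a \<Rightarrow> 'b) \<Rightarrow> bool" where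
  "tree_embedding A c B d f \<longleftrightarrow> tree_hom A c B d f \<and> inj_on f A"

definition tree_isomorphism ::
  "'a set \<Rightarrow> ('a \<Rightarrow> 'a \<Rightarrow> 'a \<Rightarrow> 'a) \<Rightarrow> 'b set \<Rightarrow> ('b \<Rightarrow> 'b \<Rightarrow> 'b \<Rightarrow> 'b) \<Rightarrow> ('a \<Rightarrow> 'b) \<Rightarrow> bool" where
  "tree_isomorphism A c B d f \<longleftrightarrow> tree_hom A c B d f \<and> bij_betw f A B"


definition algebraic_measure_tree ::
  "'a set \<Rightarrow> ('a \<Rightarrow> 'a \<Rightarrow> 'a \<Rightarrow> 'a) \<Rightarrow> 'a measure \<Rightarrow> bool" where
  "algebraic_measure_tree T c \<mu> \<longleftrightarrow>
     algebraic_tree T c \<and> order_separable T c \<and>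
     space \<mu> = T \<and> sets \<mu> = component_borel T c \<and> prob_space \<mu>"

definition atoms :: "'a measure \<Rightarrow> 'a set" where
  "atoms \<mu> = {x \<in> space \<mu>. measure \<mu> {x} > 0}"

definition measure_preserving_map :: "'a measure \<Rightarrow> 'b measure \<Rightarrow> ('a \<Rightarrow> 'b) \<Rightarrow> bool" where
  "measure_preserving_map M N f \<longleftrightarrow> f \<in> measurable M N \<and> distr M N f = N"

text \<open>
  Non-measurable sets have \<^const>\<open>measure\<close> zero, so the subtrees of full measure below are measurable.
\<close>

definition amt_equivalent ::
  "'a set \<Rightarrow> ('a \<Rightarrow> 'a \<Rightarrow> 'a \<Rightarrow> 'a) \<Rightarrow> 'a measure \<Rightarrow>
   'b set \<Rightarrow> ('b \<Rightarrow> 'b \<Rightarrow> 'b \<Rightarrow> 'b) \<Rightarrow> 'b measure \<Rightarrow> bool" where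
  "amt_equivalent T1 c1 \<mu>1 T2 c2 \<mu>2 \<longleftrightarrow>
     (\<exists>A1 A2 f. subtree T1 c1 A1 \<and> measure \<mu>1 A1 = 1 \<and>
                subtree T2 c2 A2 \<and> measure \<mu>2 A2 = 1 \<and>
                tree_isomorphism A1 c1 A2 c2 f \<and>
                measure_preserving_map (restrict_space \<mu>1 A1) (restrict_space \<mu>2 A2) f)"

text \<open>
  Uniqueness up to \<^const>\<open>amt_equivalent\<close> needs a regularity assumption. Let \<open>X\<close> and \<open>Y\<close> be two
  subsets of the unit interval, both of Lebesgue outer measure 1, that share only the end points.
  With the branch point map given by the median, both are order separable trees; put on each of
  them half of the trace of Lebesgue measure plus half of the point mass at 0. The values of the
  two measures on the components at 0 and 1 are the same. A measure preserving isomorphism between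
  full subtrees is monotone, fixes 0 and preserves the distribution function, hence is the
  identity; but \<open>X \<inter> Y\<close> has measure 1/2 only. Tightness excludes such thick non-measurable
  carriers. Without it, what remains true is that both trees embed, up to null sets, into a
  common one (here the unit interval); this is expressed by \<open>amt_embeds\<close>, where the range of the
  embedding automatically has outer measure 1.
\<close>

definition tight_amt :: "'a set \<Rightarrow> ('a \<Rightarrow> 'a \<Rightarrow> 'a \<Rightarrow> 'a) \<Rightarrow> 'a measure \<Rightarrow> bool" where
  "tight_amt T c \<mu> \<longleftrightarrow>
     (\<forall>e>0. \<exists>K\<in>sets \<mu>. compactin (component_topology T c) K \<and> measure \<mu> K > 1 - e)"

definition amt_embeds ::
  "'a set \<Rightarrow> ('a \<Rightarrow> 'a \<Rightarrow> 'a \<Rightarrow> 'a) \<Rightarrow> 'a measure \<Rightarrow>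
   'b set \<Rightarrow> ('b \<Rightarrow> 'b \<Rightarrow> 'b \<Rightarrow> 'b) \<Rightarrow> 'b measure \<Rightarrow> bool" where
  "amt_embeds T1 c1 \<mu>1 T2 c2 \<mu>2 \<longleftrightarrow>
     (\<exists>A f. subtree T1 c1 A \<and> measure \<mu>1 A = 1 \<and>
            tree_embedding A c1 T2 c2 f \<and>
            measure_preserving_map (restrict_space \<mu>1 A) \<mu>2 f)"

text \<open>
  \<open>\<psi> A x\<close> is the mass prescribed for the component \<open>A\<close> at \<open>x\<close>. The inclusion of \<open>V\<close> in \<open>T\<close> is an
  embedding \<open>\<iota>\<close>, because the points of \<open>T\<close> outside \<open>V\<close> need not exist in the type of \<open>V\<close>.
\<close>

definition psi_pt ::
  "'a set \<Rightarrow> ('a \<Rightarrow> 'a \<Rightarrow> 'a \<Rightarrow> 'a) \<Rightarrow> ('a set \<Rightarrow> 'a \<Rightarrow> real) \<Rightarrow> 'a \<Rightarrow> 'a \<Rightarrow> real" where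
  "psi_pt V cV \<psi> y x = \<psi> (tree_component V cV x y) x"

definition realizes ::
  "'a set \<Rightarrow> ('a \<Rightarrow> 'a \<Rightarrow> 'a \<Rightarrow> 'a) \<Rightarrow> ('a set \<Rightarrow> 'a \<Rightarrow> real) \<Rightarrow> ('a \<Rightarrow> 'b) \<Rightarrow>
   'b set \<Rightarrow> ('b \<Rightarrow> 'b \<Rightarrow> 'b \<Rightarrow> 'b) \<Rightarrow> 'b measure \<Rightarrow> bool" where
  "realizes V cV \<psi> \<iota> T c \<mu> \<longleftrightarrow>
     algebraic_measure_tree T c \<mu> \<and>
     tree_embedding V cV T c \<iota> \<and>
     branch_points T c = \<iota> ` branch_points V cV \<and>
     (\<forall>x\<in>V. \<forall>y\<in>V. measure \<mu> (tree_component T c (\<iota> x) (\<iota> y)) = psi_pt V cV \<psi> y x) \<and>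
     atoms \<mu> \<subseteq> \<iota> ` V"

end

theory Submission
  imports Defs
begin

text \<open>
  Root the tree \<open>V\<close> at a point \<open>r\<close> and enumerate \<open>V\<close>. Exploring the tree depth first, with the components
  at each point ordered by their least index and every point placed after its descendants, assigns to each
  component above a point \<open>v\<close> an interval of the real line whose length is the prescribed mass; the condition
  \<open>\<psi>\<^sub>x(y) + \<psi>\<^sub>y(x) \<ge> 1\<close> says exactly that the intervals of nested components are nested. The positions
  that are consistent with these intervals carry a tree order whose meets of incomparable points lie in \<open>V\<close>,
  and Lebesgue measure, with an interval collapsed to a point for each atom, is the required measure.
  Conversely, in any realization the mass of the set of points explored before \<open>z\<close> is a position for \<open>z\<close>.
  It is injective and order preserving off a null set, and like every distribution function it transports
  the measure to Lebesgue measure up to the atoms. Under tightness, Lusin's theorem makes the image of a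
  subset of full measure sigma-compact, hence measurable.
\<close>

section \<open>Trees as rooted orders\<close>

text \<open>Points of \<open>V\<close> may be densely ordered along a path, so positions cannot be
  assigned by recursion from parent to child. The left end of a block is an infinite sum over all
  ancestors instead; its convergence and the nesting of the blocks both come from a bound on finite
  subsums (\<open>left_sum_bound\<close>). The data may give mass zero to points of \<open>V\<close>
  and even to whole components, so that several points would share a position. Everything is
  therefore carried out for \<open>\<psi>\<close> plus a probability of full support on
  \<open>V\<close>, of total mass \<open>Z\<close> = 2, and the added part is subtracted at the end.
  Placing a point after its descendants lets positions that belong to no point of \<open>V\<close>
  enter the tree: an ancestor is a later position, and every component interval around it also
  surrounds the descendant. Ordering components by least index leaves each with finitely many
  predecessors, so the mass to its left is a finite sum. Lusin's theorem is used because an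
  injective measurable image need not be measurable when the source is not assumed to be a standard
  Borel space.\<close>

locale rooted_tree =
  fixes T :: "'a set" and c :: "'a \<Rightarrow> 'a \<Rightarrow> 'a \<Rightarrow> 'a" and r :: 'a
  assumes tree: "algebraic_tree T c" and root_in: "r \<in> T"
begin

definition meet :: "'a \<Rightarrow> 'a \<Rightarrow> 'a" where "meet x y = c r x y"
definition le :: "'a \<Rightarrow> 'a \<Rightarrow> bool" where "le x y \<longleftrightarrow> c r x y = x"
definition lt :: "'a \<Rightarrow> 'a \<Rightarrow> bool" where "lt x y \<longleftrightarrow> le x y \<and> x \<noteq> y"

lemma c_closed: "x \<in> T \<Longrightarrow> y \<in> T \<Longrightarrow> z \<in> T \<Longrightarrow> c x y z \<in> T"
  and c_swap12: "x \<in> T \<Longrightarrow> y \<in> T \<Longrightarrow> z \<in> T \<Longrightarrow> c x y z = c y x z"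
  and c_swap23: "x \<in> T \<Longrightarrow> y \<in> T \<Longrightarrow> z \<in> T \<Longrightarrow> c x y z = c x z y"
  and c_diag: "x \<in> T \<Longrightarrow> y \<in> T \<Longrightarrow> c x y y = y"
  and c_absorb: "x \<in> T \<Longrightarrow> y \<in> T \<Longrightarrow> z \<in> T \<Longrightarrow> c x y (c x y z) = c x y z"
  and c_four: "x \<in> T \<Longrightarrow> y \<in> T \<Longrightarrow> z \<in> T \<Longrightarrow> w \<in> T \<Longrightarrow> c x y z = c x y w \<or> c x y z = c x z w \<or> c x y z = c y z w"
  using tree unfolding algebraic_tree_def by blast+

lemma meet_closed [simp]: "x \<in> T \<Longrightarrow> y \<in> T \<Longrightarrow> meet x y \<in> T"
  by (simp add: meet_def c_closed root_in)

lemma meet_comm: "x \<in> T \<Longrightarrow> y \<in> T \<Longrightarrow> meet x y = meet y x"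
  by (simp add: meet_def c_swap23 root_in)

lemma le_meet: "le x y \<longleftrightarrow> meet x y = x"
  by (simp add: le_def meet_def)

lemma meet_idem [simp]: "x \<in> T \<Longrightarrow> meet x x = x"
  by (simp add: meet_def c_diag root_in)

lemma le_refl [simp]: "x \<in> T \<Longrightarrow> le x x"
  by (simp add: le_meet)

lemma le_antisym: "x \<in> T \<Longrightarrow> y \<in> T \<Longrightarrow> le x y \<Longrightarrow> le y x \<Longrightarrow> x = y"
  using meet_comm by (force simp: le_meet)

lemma root_le [simp]: "x \<in> T \<Longrightarrow> le r x"
  by (metis c_diag c_swap12 c_swap23 le_def root_in)

lemma meet_le1 [simp]: "x \<in> T \<Longrightarrow> y \<in> T \<Longrightarrow> le (meet x y) x"
  by (metis c_absorb c_closed c_swap23 le_def meet_def root_in)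

lemma meet_le2 [simp]: "x \<in> T \<Longrightarrow> y \<in> T \<Longrightarrow> le (meet x y) y"
  by (metis meet_comm meet_le1)

text \<open>This is the four point axiom for \<open>x\<close>, \<open>y\<close>, \<open>z\<close>
  and the root, applied once for each triple: among the three meets and \<open>c x y z\<close> no
  value stands alone. Transitivity, linearity of lower sets and the meet property are all drawn from
  this.\<close>

lemma four_meets:
  assumes "x \<in> T" "y \<in> T" "z \<in> T"
  shows "c x y z = meet x y \<or> c x y z = meet x z \<or> c x y z = meet y z"
    and "meet x y = meet x z \<or> meet x y = meet y z \<or> meet x y = c x y z"
    and "meet x z = meet x y \<or> meet x z = meet y z \<or> meet x z = c x y z"
    and "meet y z = meet x y \<or> meet y z = meet x z \<or> meet y z = c x y z"
proof -
  note [simp] = assms root_in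
  have s: "c x y r = meet x y" "c x z r = meet x z" "c y z r = meet y z"
      "c r z y = meet y z" "c x z y = c x y z"
      "c r y x = meet x y" "c r z x = meet x z" "c y z x = c x y z"
    unfolding meet_def by (metis assms root_in c_swap12 c_swap23)+
  show "c x y z = meet x y \<or> c x y z = meet x z \<or> c x y z = meet y z"
    using c_four[of x y z r] s by simp
  show "meet x y = meet x z \<or> meet x y = meet y z \<or> meet x y = c x y z"
    using c_four[of r x y z] s by (simp add: meet_def)
  show "meet x z = meet x y \<or> meet x z = meet y z \<or> meet x z = c x y z"
    using c_four[of r x z y] s by (simp add: meet_def)
  show "meet y z = meet x y \<or> meet y z = meet x z \<or> meet y z = c x y z"
    using c_four[of r y z x] s by (simp add: meet_def)
qed

text \<open>Of four values none of which stands alone, two equal ones force the other two to be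
  equal. Hence the three meets determine the median.\<close>

lemma c_meet:
  assumes "x \<in> T" "y \<in> T" "z \<in> T"
  shows "c x y z = (if meet x y = meet x z then meet y z
    else if meet x y = meet y z then meet x z else meet x y)"
  using four_meets[OF assms] by metis

lemma le_trans:
  assumes "x \<in> T" "y \<in> T" "z \<in> T" "le x y" "le y z" shows "le x z"
  using four_meets[of x y z] assms meet_le1[of x z] le_antisym
  unfolding le_meet by metis

lemma le_linear:
  assumes "x \<in> T" "y \<in> T" "z \<in> T" "le x z" "le y z" shows "le x y \<or> le y x"
  using four_meets[of x y z] assms meet_comm[of x y] meet_idem
  unfolding le_meet by metis

lemma meet_glb:
  assumes T: "x \<in> T" "y \<in> T" "z \<in> T" and le: "le z x" "le z y" shows "le z (meet x y)"
proof -
  define q where "q = meet x y"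
  have q: "q \<in> T" "le q x" "le q y" using T by (auto simp: q_def)
  \<comment> \<open>By linearity below \<open>x\<close>, the case to exclude is \<open>q\<close>
    strictly below \<open>z\<close>. There the four point rule gives \<open>c x y z = q\<close>, and
    absorption gives \<open>c z x q = q\<close>, whereas the meets give the value \<open>z\<close>
    for the same triple.\<close>
  have "z = q" if "le q z"
  proof (rule ccontr)
    assume "z \<noteq> q"
    have z: "meet x z = z" "meet y z = z" using le T meet_comm unfolding le_meet by metis+
    then have "c x y z = q" using four_meets[OF T] \<open>z \<noteq> q\<close> unfolding q_def by metis
    then have 1: "c z x q = q" by (metis T c_absorb c_closed c_swap12 c_swap23)
    have "meet q x = q" "meet q z = q" "meet x z = z"
      using q that z unfolding le_meet by auto
    then have "c q x z = z" using four_meets[of q x z] q T \<open>z \<noteq> q\<close> by metis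
    moreover have "c q x z = c z x q" by (metis T q(1) c_swap12 c_swap23)
    ultimately show False using 1 \<open>z \<noteq> q\<close> by simp
  qed
  then show ?thesis
    using le_linear[of z q x] T q le by (auto simp: q_def[symmetric])
qed

text \<open>Neither \<open>meet x y\<close> nor \<open>meet y z\<close> can be \<open>x\<close>, so
  the median of \<open>x\<close>, \<open>y\<close>, \<open>z\<close> is \<open>x\<close> only if
  \<open>meet x z = x\<close>. All points not above \<open>x\<close> thus share one component, that
  of the root unless \<open>x\<close> is the root.\<close>

lemma component_not_above:
  assumes "x \<in> T" "y \<in> T" "\<not> le x y"
  shows "tree_component T c x y = {z \<in> T. \<not> le x z}"
proof -
  have xy: "x \<noteq> y" using assms by auto
  have "z \<noteq> x \<and> c x y z \<noteq> x \<longleftrightarrow> \<not> le x z" if "z \<in> T" for z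
  proof -
    have "meet x y \<noteq> x" using assms by (simp add: le_meet)
    moreover have "meet y z \<noteq> x" using assms meet_le1[of y z] that by metis
    moreover have "meet x z = x \<longleftrightarrow> le x z" by (simp add: le_meet)
    ultimately show ?thesis
      using c_meet[of x y z] assms that four_meets[of x y z] by (smt (verit) le_refl)
  qed
  then show ?thesis using xy unfolding tree_component_def by auto
qed

text \<open>Two points above \<open>x\<close> are connected without passing \<open>x\<close> exactly
  when their meet has moved past \<open>x\<close>. The components above \<open>x\<close> are the
  branches of the rooted order.\<close>

lemma component_above:
  assumes "x \<in> T" "y \<in> T" "lt x y"
  shows "tree_component T c x y = {z \<in> T. le x z \<and> meet y z \<noteq> x}"
proof -
  have xy: "x \<noteq> y" "meet x y = x" using assms by (auto simp: lt_def le_meet)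
  have "z \<noteq> x \<and> c x y z \<noteq> x \<longleftrightarrow> le x z \<and> meet y z \<noteq> x" if "z \<in> T" for z
  proof (cases "z = x")
    case True
    then show ?thesis using xy assms by (simp add: meet_comm)
  next
    case False
    have "meet y z = x \<Longrightarrow> meet x z = x"
      using meet_le2[of y z] assms that by (metis le_meet)
    then show ?thesis using False c_meet[of x y z] xy unfolding le_meet
      by (metis assms(1,2) that)
  qed
  then show ?thesis using xy unfolding tree_component_def by auto
qed

lemma component_self: "tree_component T c x x = {x}"
  by (simp add: tree_component_def)

lemma component_sub: "x \<in> T \<Longrightarrow> y \<in> T \<Longrightarrow> tree_component T c x y \<subseteq> T"
  by (auto simp: tree_component_def)

lemma component_root: "x \<in> T \<Longrightarrow> x \<noteq> r \<Longrightarrow> tree_component T c x r = {z \<in> T. \<not> le x z}"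
  using component_not_above[of x r] le_antisym root_in root_le by blast

lemma interval_le:
  assumes "x \<in> T" "y \<in> T" "le x y"
  shows "tree_interval T c x y = {z \<in> T. le x z \<and> le z y}"
    and "tree_interval T c y x = {z \<in> T. le x z \<and> le z y}"
proof -
  have *: "c x y z = z \<longleftrightarrow> le x z \<and> le z y" if "z \<in> T" for z
  proof -
    have "meet x y = x" using assms by (simp add: le_meet)
    then show ?thesis using c_meet[of x y z] assms that unfolding le_meet
      using four_meets[of x y z] by (smt (verit) le_antisym le_meet le_trans meet_closed meet_comm meet_le1 meet_le2)
  qed
  then show "tree_interval T c x y = {z \<in> T. le x z \<and> le z y}" by (auto simp: tree_interval_def)
  show "tree_interval T c y x = {z \<in> T. le x z \<and> le z y}" 
    using * c_swap12[of x y] assms by (auto simp: tree_interval_def)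
qed

lemma meet_in_interval:
  assumes "x \<in> T" "y \<in> T" shows "meet x y \<in> tree_interval T c x y"
  unfolding tree_interval_def meet_def
  using assms root_in c_absorb[of x y r] c_swap12 c_swap23 c_closed by (metis (mono_tags, lifting) mem_Collect_eq)

end

section \<open>Algebraic trees from meet semilattices whose lower sets are chains\<close>

locale tree_semilattice =
  fixes T :: "'a set" and le :: "'a \<Rightarrow> 'a \<Rightarrow> bool" and meet :: "'a \<Rightarrow> 'a \<Rightarrow> 'a" and r :: 'a
  assumes root: "r \<in> T" "\<And>x. x \<in> T \<Longrightarrow> le r x"
    and refl: "\<And>x. x \<in> T \<Longrightarrow> le x x"
    and antisym: "\<And>x y. x \<in> T \<Longrightarrow> y \<in> T \<Longrightarrow> le x y \<Longrightarrow> le y x \<Longrightarrow> x = y"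
    and trans: "\<And>x y z. x \<in> T \<Longrightarrow> y \<in> T \<Longrightarrow> z \<in> T \<Longrightarrow> le x y \<Longrightarrow> le y z \<Longrightarrow> le x z"
    and linear: "\<And>x y z. x \<in> T \<Longrightarrow> y \<in> T \<Longrightarrow> z \<in> T \<Longrightarrow> le x z \<Longrightarrow> le y z \<Longrightarrow> le x y \<or> le y x"
    and meet_in: "\<And>x y. x \<in> T \<Longrightarrow> y \<in> T \<Longrightarrow> meet x y \<in> T"
    and meet1: "\<And>x y. x \<in> T \<Longrightarrow> y \<in> T \<Longrightarrow> le (meet x y) x"
    and meet2: "\<And>x y. x \<in> T \<Longrightarrow> y \<in> T \<Longrightarrow> le (meet x y) y"
    and glb: "\<And>x y z. x \<in> T \<Longrightarrow> y \<in> T \<Longrightarrow> z \<in> T \<Longrightarrow> le z x \<Longrightarrow> le z y \<Longrightarrow> le z (meet x y)"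
begin

definition median :: "'a \<Rightarrow> 'a \<Rightarrow> 'a \<Rightarrow> 'a" where
  "median x y z = (if meet x y = meet x z then meet y z
    else if meet x y = meet y z then meet x z else meet x y)"

text \<open>As in an ultrametric triangle: any two of the three meets lie below a common point, so
  they are comparable, and a common lower bound of two of the meets is below the third. The smallest
  value therefore occurs at least twice.\<close>

lemma isosceles:
  assumes "x \<in> T" "y \<in> T" "z \<in> T"
  shows "(meet x y = meet x z \<and> le (meet x y) (meet y z)) \<or>
    (meet x y = meet y z \<and> le (meet x y) (meet x z)) \<or>
    (meet x z = meet y z \<and> le (meet x z) (meet x y))"
  by (smt (verit) assms antisym trans linear meet_in meet1 meet2 glb)

lemma commute: "x \<in> T \<Longrightarrow> y \<in> T \<Longrightarrow> meet x y = meet y x"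
  by (meson antisym glb meet1 meet2 meet_in)

lemma idem: "x \<in> T \<Longrightarrow> meet x x = x"
  by (meson antisym glb meet1 meet_in refl)

lemma meet_absorb: "x \<in> T \<Longrightarrow> y \<in> T \<Longrightarrow> le x y \<Longrightarrow> meet x y = x"
  by (meson antisym glb meet1 meet_in refl)

lemma median_in: "x \<in> T \<Longrightarrow> y \<in> T \<Longrightarrow> z \<in> T \<Longrightarrow> median x y z \<in> T"
  by (simp add: median_def meet_in)

lemma median_root: "x \<in> T \<Longrightarrow> y \<in> T \<Longrightarrow> median r x y = meet x y"
  by (simp add: median_def meet_absorb root)

lemma median_perm: 
  assumes "x \<in> T" "y \<in> T" "z \<in> T" 
  shows "median x y z = median y x z" "median x y z = median x z y"
  using isosceles[OF assms] commute[of x y] commute[of x z] commute[of y z] assms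
  by (auto simp: median_def)

lemma median_absorb:
  assumes "x \<in> T" "y \<in> T" "z \<in> T"
  shows "median x y (median x y z) = median x y z"
proof -
  have 1: "median x y (meet x y) = meet x y" if "x \<in> T" "y \<in> T" for x y
  proof -
    have "meet x (meet x y) = meet x y" "meet y (meet x y) = meet x y"
      using that meet_absorb[of "meet x y" x] meet_absorb[of "meet x y" y]
        commute[of x "meet x y"] commute[of y "meet x y"] meet1 meet2 meet_in by auto
    then show ?thesis by (simp add: median_def)
  qed
  have sym: "median x y (meet y z) = meet y z"
    if T: "x \<in> T" "y \<in> T" "z \<in> T" and eq: "meet x y = meet x z" for x y z
  proof -
    have "le (meet x y) (meet y z)" using T eq by (metis glb meet2 meet_in)
    then have "meet x (meet y z) = meet x y"
      using T by (meson antisym glb meet1 meet2 meet_in trans)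
    moreover have "meet y (meet y z) = meet y z"
      using T meet_absorb[of "meet y z" y] commute[of y "meet y z"] meet1 meet_in by auto
    ultimately show ?thesis by (simp add: median_def)
  qed
  consider "meet x y = meet x z" | "meet x y = meet y z" | "median x y z = meet x y"
    unfolding median_def by presburger
  then show ?thesis
  proof cases
    case 1
    then show ?thesis using sym[of x y z] assms by (simp add: median_def)
  next
    case 2
    have "meet y x = meet y z" using 2 assms commute[of x y] by simp
    moreover from this have "median y x z = meet x z" by (simp add: median_def)
    ultimately show ?thesis using sym[of y x z] assms median_perm(1)[of x y z] median_perm(1)[of x y "meet x z"] meet_in by simp
  next
    case 3
    then show ?thesis using 1 assms by simp
  qed
qed

text \<open>Each of the four triples contributes its ultrametric alternative, and in every
  combination antisymmetry identifies the values that have to agree.\<close>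

lemma median_four:
  assumes T: "x \<in> T" "y \<in> T" "z \<in> T" "w \<in> T"
  shows "median x y z \<in> {median x y w, median x z w, median y z w}"
proof -
  have eq: "u = v" if "le u v" "le v u" "u \<in> T" "v \<in> T" for u v
    using that antisym by blast
  have *: "meet x y \<in> T" "meet x z \<in> T" "meet x w \<in> T" "meet y z \<in> T" "meet y w \<in> T" "meet z w \<in> T"
    using T meet_in by auto
  show ?thesis
    using isosceles[OF T(1,2,3)] isosceles[OF T(1,2,4)] isosceles[OF T(1,3,4)] isosceles[OF T(2,3,4)]
    by (elim disjE conjE; simp add: median_def *; metis eq *)
qed

lemma algebraic_tree_median: "algebraic_tree T median"
  unfolding algebraic_tree_def
proof (intro conjI ballI)
  show "T \<noteq> {}" using root by auto
  fix x y assume *: "x \<in> T" "y \<in> T"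
  show "median x y y = y" using * isosceles[of x y y] idem by (simp add: median_def)
qed (use median_in median_perm median_absorb median_four in simp_all)

end

section \<open>The component topology\<close>

context rooted_tree begin

text \<open>Rooting the tree at the very point whose components are studied turns membership into
  \<open>meet y z \<noteq> r\<close>, an equivalence relation away from the root. Later facts about
  components at \<open>x\<close> are obtained by interpreting the locale with root
  \<open>x\<close>.\<close>

lemma component_at_root:
  assumes "y \<in> T" "y \<noteq> r"
  shows "tree_component T c r y = {z \<in> T. meet y z \<noteq> r}"
proof -
  have "lt r y" using assms root_le[of y] unfolding lt_def by metis
  then have "tree_component T c r y = {z \<in> T. le r z \<and> meet y z \<noteq> r}"
    by (rule component_above[OF root_in assms(1)])
  then show ?thesis using root_le by (simp cong: conj_cong)
qed

text \<open>Both meets are below \<open>y\<close>, hence comparable, and the smaller one is a common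
  lower bound of \<open>x\<close> and \<open>z\<close> other than the root.\<close>

lemma meet_root_trans:
  assumes "x \<in> T" "y \<in> T" "z \<in> T" "meet x y \<noteq> r" "meet y z \<noteq> r" 
  shows "meet x z \<noteq> r"
proof
  assume xz: "meet x z = r"
  have below: "u = r" if "u \<in> T" "le u x" "le u z" for u
    using meet_glb[of x z u] le_antisym[of u r] that assms root_in xz by simp
  have "le (meet x y) (meet y z) \<or> le (meet y z) (meet x y)"
    using le_linear[of "meet x y" "meet y z" y] assms by simp
  then show False
  proof
    assume "le (meet x y) (meet y z)"
    then have "le (meet x y) z" using le_trans[of "meet x y" "meet y z" z] assms by simp
    then show False using below[of "meet x y"] assms by simp
  next
    assume "le (meet y z) (meet x y)"
    then have "le (meet y z) x" using le_trans[of "meet y z" "meet x y" x] assms by simp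
    then show False using below[of "meet y z"] assms by simp
  qed
qed

lemma component_eq_root:
  assumes "y \<in> T" "y' \<in> tree_component T c r y"
  shows "tree_component T c r y' = tree_component T c r y"
proof (cases "y = r")
  case True then show ?thesis using assms by (simp add: tree_component_def)
next
  case False
  then have y: "y' \<in> T" "meet y y' \<noteq> r" using assms component_at_root by auto
  then have "y' \<noteq> r" using assms root_le meet_comm[of y y'] le_meet by metis
  then show ?thesis 
    using y assms(1) False meet_root_trans[of y y'] meet_root_trans[of y' y] meet_comm[of y y']
    by (auto simp: component_at_root)
qed

end

lemma component_eq:
  assumes "algebraic_tree T c" "x \<in> T" "y \<in> T" "y' \<in> tree_component T c x y"
  shows "tree_component T c x y' = tree_component T c x y"
proof -
  interpret X: rooted_tree T c x using assms by unfold_locales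
  show ?thesis using X.component_eq_root assms by blast
qed

lemma component_mem:
  assumes "algebraic_tree T c" "x \<in> T" "y \<in> T" 
  shows "y \<in> tree_component T c x y"
proof -
  interpret X: rooted_tree T c x using assms by unfold_locales
  show ?thesis using X.component_at_root[of y] assms by (cases "x = y") (auto simp: tree_component_def X.c_diag)
qed

lemma component_openin:
  assumes "x \<in> T" "y \<in> T" "x \<noteq> y"
  shows "openin (component_topology T c) (tree_component T c x y)"
  using assms unfolding component_topology_def
  by (intro topology_generated_by_Basis) auto

lemma component_topspace [simp]: 
  assumes "algebraic_tree T c"
  shows "topspace (component_topology T c) = T"
proof -
  obtain r where "r \<in> T" using assms by (auto simp: algebraic_tree_def)
  then interpret rooted_tree T c r using assms by unfold_locales
  show ?thesis
    unfolding component_topology_def topology_generated_by_topspace using component_sub by auto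
qed

lemma component_Hausdorff:
  assumes "algebraic_tree T c"
  shows "Hausdorff_space (component_topology T c)"
  unfolding Hausdorff_space_def component_topspace[OF assms]
proof (intro allI impI, elim conjE)
  fix x y assume xy: "x \<in> T" "y \<in> T" "x \<noteq> y"
  interpret rooted_tree T c x using assms xy by unfold_locales
  have lt: "lt x y" using xy by (simp add: lt_def)
  have yx: "\<not> le y x" using xy le_antisym root_le by blast
  show "\<exists>U V. openin (component_topology T c) U \<and> openin (component_topology T c) V \<and> x \<in> U \<and> y \<in> V \<and> disjnt U V"
  proof (cases "\<exists>z\<in>T. lt x z \<and> lt z y")
    case True
    \<comment> \<open>A point strictly between separates: take the two components at it that face
      \<open>x\<close> and \<open>y\<close>.\<close>
    then obtain z where z: "z \<in> T" "lt x z" "lt z y" by auto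
    then have "z \<noteq> x" "z \<noteq> y" by (auto simp: lt_def)
    moreover have "disjnt (tree_component T c z x) (tree_component T c z y)"
      using component_root[of z] component_above[of z y] z xy \<open>z \<noteq> x\<close> by (auto simp: disjnt_def)
    ultimately show ?thesis
      using component_openin z(1) xy component_mem[OF assms] by metis
  next
    case False
    \<comment> \<open>With nothing strictly between, the components at \<open>x\<close> and
      \<open>y\<close> that face each other are already disjoint: for a common point
      \<open>w\<close> the meet of \<open>y\<close> and \<open>w\<close> would lie strictly
      between.\<close>
    have "disjnt (tree_component T c y x) (tree_component T c x y)"
    proof -
      have "False" if "w \<in> T" "\<not> le y w" "meet y w \<noteq> x" for w
        using False that xy meet_le1[of y w] meet_le2[of y w] root_le meet_closed unfolding lt_def by metis
      then show ?thesis
        using component_root[of y] component_above[of x y] xy lt by (auto simp: disjnt_def)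
    qed
    then show ?thesis
      using component_openin xy component_mem[OF assms] by metis
  qed
qed

section \<open>Countable generation of the topology and of its Borel sets\<close>

locale separable_tree = rooted_tree +
  fixes D :: "'a set"
  assumes D_sub: "D \<subseteq> T" and D_countable: "countable D"
    and D_sep: "\<And>x y. x \<in> T \<Longrightarrow> y \<in> T \<Longrightarrow> x \<noteq> y \<Longrightarrow> \<exists>d\<in>D. d \<in> tree_interval T c x y \<and> d \<noteq> y"
begin

text \<open>Take \<open>d\<close> of \<open>D\<close> in [x, z) and then \<open>d'\<close> of
  \<open>D\<close> in (d, z]. The component at \<open>d\<close> facing \<open>d'\<close> contains
  \<open>z\<close> and stays on the side of \<open>x\<close> where \<open>z\<close> is, so
  components between points of \<open>D\<close> suffice.\<close>

lemma component_refine: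
  assumes "x \<in> T" "y \<in> T" "x \<noteq> y" "z \<in> tree_component T c x y"
  obtains d d' where "d \<in> D" "d' \<in> D" "d \<noteq> d'" "z \<in> tree_component T c d d'"
    "tree_component T c d d' \<subseteq> tree_component T c x y"
proof -
  interpret X: rooted_tree T c x using assms tree by unfold_locales
  have z: "z \<in> T" "X.meet y z \<noteq> x" "z \<noteq> x"
    using X.component_at_root[of y] assms(2-4) by (auto simp: tree_component_def)
  obtain d where d: "d \<in> D" "d \<in> tree_interval T c x z" "d \<noteq> z"
    using D_sep[of x z] z assms by auto
  have dT: "d \<in> T" using d D_sub by auto
  have dz: "X.le d z" using d X.interval_le[of x z] z assms by auto
  obtain d' where d': "d' \<in> D" "d' \<in> tree_interval T c z d" "d' \<noteq> d"
    using D_sep[of z d] z dT d by auto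
  have d'T: "d' \<in> T" using d' D_sub by auto
  have dd': "X.le d d'" "X.le d' z" using d' X.interval_le(2)[of d z] z dT dz by auto
  have ltd: "X.lt d d'" using dd' d' by (simp add: X.lt_def)
  have comp: "tree_component T c d d' = {w \<in> T. X.le d w \<and> X.meet d' w \<noteq> d}"
    using X.component_above[OF dT d'T ltd] .
  have "X.meet d' z = d'" using dd' by (simp add: X.le_meet)
  then have 1: "z \<in> tree_component T c d d'" using comp z dz d' by simp
  have 2: "tree_component T c d d' = tree_component T c d z"
    using component_eq[OF tree dT d'T 1] by simp
  have "tree_component T c d z \<subseteq> tree_component T c x y"
  proof
    fix w assume "w \<in> tree_component T c d z"
    then have w: "w \<in> T" "X.le d w" "X.meet z w \<noteq> d"
      using X.component_above[OF dT z(1)] dz d by (auto simp: X.lt_def)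
    have "X.le d (X.meet z w)" using X.meet_glb w dz dT z by blast
    then have "X.meet z w \<noteq> x" using w dT X.le_antisym X.root_le assms(1) by metis
    then have "X.meet y w \<noteq> x" using X.meet_root_trans[of y z w] z w assms by blast
    then show "w \<in> tree_component T c x y"
      using X.component_at_root[of y] assms w by auto
  qed
  then show thesis using that[of d d'] 1 2 d d' by auto
qed

text \<open>A subbase only: a neighbourhood contains a finite intersection of members, possibly the
  empty one, which is why \<open>base_refine\<close> cuts intersections down to
  \<open>T\<close>.\<close>

definition base :: "'a set set" where
  "base = {tree_component T c d d' | d d'. d \<in> D \<and> d' \<in> D \<and> d \<noteq> d'}"

lemma countable_base: "countable base"
proof -
  have "base \<subseteq> (\<lambda>(d,d'). tree_component T c d d') ` (D \<times> D)" by (auto simp: base_def)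
  then show ?thesis by (rule countable_subset) (intro countable_image countable_SIGMA D_countable)
qed

lemma baseE:
  assumes "B \<in> base"
  obtains d d' where "d \<in> D" "d' \<in> D" "d \<in> T" "d' \<in> T" "d \<noteq> d'" "B = tree_component T c d d'"
proof -
  obtain d d' where d: "B = tree_component T c d d'" "d \<in> D" "d' \<in> D" "d \<noteq> d'"
    using assms unfolding base_def by auto
  show thesis by (rule that[of d d']) (use d D_sub in auto)
qed


lemma base_sub: "base \<subseteq> Pow T"
proof
  fix B assume "B \<in> base"
  then obtain d d' where d: "d \<in> T" "d' \<in> T" and B: "B = tree_component T c d d'" by (rule baseE)
  show "B \<in> Pow T" using component_sub[OF d] unfolding B by (rule PowI)
qed


lemma base_refine:
  assumes "openin (component_topology T c) U" "z \<in> U"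
  shows "\<exists>F. finite F \<and> F \<subseteq> base \<and> z \<in> T \<inter> \<Inter>F \<and> T \<inter> \<Inter>F \<subseteq> U"
proof -
  have "generate_topology_on (insert T {tree_component T c x y | x y. x \<in> T \<and> y \<in> T \<and> x \<noteq> y}) U"
    using assms(1) unfolding component_topology_def openin_topology_generated_by_iff .
  then show ?thesis using assms(2)
  proof (induction arbitrary: z)
    case Empty then show ?case by simp
  next
    case (Int a b)
    obtain F where F: "finite F" "F \<subseteq> base" "z \<in> T \<inter> \<Inter>F" "T \<inter> \<Inter>F \<subseteq> a" using Int.IH(1)[of z] Int.prems by blast
    obtain F' where F': "finite F'" "F' \<subseteq> base" "z \<in> T \<inter> \<Inter>F'" "T \<inter> \<Inter>F' \<subseteq> b" using Int.IH(2)[of z] Int.prems by blast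
    show ?case using F F' by (intro exI[of _ "F \<union> F'"]) auto
  next
    case (UN K)
    then obtain k where k: "k \<in> K" "z \<in> k" by auto
    obtain F where "finite F" "F \<subseteq> base" "z \<in> T \<inter> \<Inter>F" "T \<inter> \<Inter>F \<subseteq> k"
      using UN.IH[OF k] by blast
    then show ?case using k by (intro exI[of _ F]) auto
  next
    case (Basis s)
    show ?case
    proof (cases "s = T")
      case True then show ?thesis using Basis by (intro exI[of _ "{}"]) auto
    next
      case False
      then obtain x y where xy: "x \<in> T" "y \<in> T" "x \<noteq> y" "s = tree_component T c x y" using Basis by auto
      obtain d d' where "d \<in> D" "d' \<in> D" "d \<noteq> d'" "z \<in> tree_component T c d d'"
          "tree_component T c d d' \<subseteq> tree_component T c x y"
        using component_refine[of x y z] xy Basis.prems by metis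
      then show ?thesis using xy
        by (intro exI[of _ "{tree_component T c d d'}"]) (auto simp: base_def tree_component_def split: if_splits)
    qed
  qed
qed

text \<open>An open set is the union of the finite intersections of members of \<open>base\<close>
  that it contains, and there are only countably many of these. This countable generating family is
  what Lusin's theorem is applied to.\<close>

lemma component_borel_base: "component_borel T c = sigma_sets T base"
proof
  have "openin (component_topology T c) B" if B: "B \<in> base" for B
  proof -
    obtain d d' where "d \<in> T" "d' \<in> T" "d \<noteq> d'" "B = tree_component T c d d'"
      by (rule baseE[OF B])
    then show ?thesis using component_openin[of d T d' c] by simp
  qed
  then show "sigma_sets T base \<subseteq> component_borel T c"
    unfolding component_borel_def by (intro sigma_sets_mono') (simp add: subset_iff)
  interpret B: sigma_algebra T "sigma_sets T base"
    using base_sub by (rule sigma_algebra_sigma_sets)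
  have "U \<in> sigma_sets T base" if U: "openin (component_topology T c) U" for U
  proof -
    define \<F> where "\<F> = {F. finite F \<and> F \<subseteq> base \<and> T \<inter> \<Inter>F \<subseteq> U}"
    have "countable \<F>"
      using countable_Collect_finite_subset[OF countable_base]
      by (rule countable_subset[rotated]) (auto simp: \<F>_def)
    moreover have "T \<inter> \<Inter>F \<in> sigma_sets T base" if "F \<in> \<F>" for F
    proof -
      have "finite F" "F \<subseteq> base" using that by (auto simp: \<F>_def)
      then show ?thesis
      proof (induction F)
        case (insert a F)
        then have "(T \<inter> \<Inter>F) \<inter> a \<in> sigma_sets T base"
          by (metis B.Int insert_subset sigma_sets.Basic)
        then show ?case by (simp add: Int_ac)
      qed (simp add: B.top)
    qed
    moreover have "U = (\<Union>F\<in>\<F>. T \<inter> \<Inter>F)"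
    proof (intro equalityI subsetI)
      fix z assume "z \<in> U"
      from base_refine[OF U this] show "z \<in> (\<Union>F\<in>\<F>. T \<inter> \<Inter>F)" unfolding \<F>_def by auto
    qed (auto simp: \<F>_def)
    moreover have "(\<Union>F\<in>\<F>. T \<inter> \<Inter>F) \<in> sigma_sets T base"
      by (rule B.countable_UN') (use calculation in auto)
    ultimately show ?thesis by (simp only:)
  qed
  then show "component_borel T c \<subseteq> sigma_sets T base"
    unfolding component_borel_def by (intro sigma_sets_mono subsetI) (simp only: mem_Collect_eq)
qed

lemma component_borel_component:
    "x \<in> T \<Longrightarrow> y \<in> T \<Longrightarrow> x \<noteq> y \<Longrightarrow> tree_component T c x y \<in> component_borel T c"
    and component_borel_above: "x \<in> T \<Longrightarrow> {z \<in> T. le x z} \<in> component_borel T c"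
    and component_borel_singleton: "x \<in> T \<Longrightarrow> {x} \<in> component_borel T c"
proof -
  have sub: "{U. openin (component_topology T c) U} \<subseteq> Pow T"
    using openin_subset component_topspace[OF tree] by fastforce
  interpret B: sigma_algebra T "component_borel T c"
    unfolding component_borel_def using sub by (rule sigma_algebra_sigma_sets)
  show comp: "tree_component T c x y \<in> component_borel T c" if "x \<in> T" "y \<in> T" "x \<noteq> y" for x y
    unfolding component_borel_def using component_openin that by (intro sigma_sets.Basic) auto
  show "{z \<in> T. le x z} \<in> component_borel T c" if "x \<in> T" for x
  proof (cases "x = r")
    case True
    then have "{z \<in> T. le x z} = T" by auto
    then show ?thesis by simp
  next
    case False
    then have "{z \<in> T. le x z} = T - tree_component T c x r"
      using component_root[OF that] by auto
    then show ?thesis using B.compl_sets[OF comp[OF that root_in False]] by simp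
  qed
  show "{x} \<in> component_borel T c" if x: "x \<in> T" for x
  proof -
    \<comment> \<open>Every component at \<open>x\<close> other than \<open>{x}\<close> contains a
      point of \<open>D\<close>, because \<open>D\<close> meets [z, x) for each
      \<open>z \<noteq> x\<close>. The complement of a point is thus a countable union of
      components.\<close>
    have "T - {x} = (\<Union>d\<in>D - {x}. tree_component T c x d)"
    proof (intro equalityI subsetI)
      fix z assume z: "z \<in> T - {x}"
      interpret X: rooted_tree T c x using x tree by unfold_locales
      obtain d where d: "d \<in> D" "d \<in> tree_interval T c z x" "d \<noteq> x" using D_sep[of z x] z x by auto
      then have "X.le d z" using X.interval_le(2)[of x z] z x by auto
      then have "z \<in> tree_component T c x d"
        using X.component_at_root[of d] d D_sub z X.le_meet by auto
      then show "z \<in> (\<Union>d\<in>D - {x}. tree_component T c x d)" using d by auto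
    next
      fix z assume "z \<in> (\<Union>d\<in>D - {x}. tree_component T c x d)"
      then show "z \<in> T - {x}" by (auto simp: tree_component_def split: if_splits)
    qed
    moreover have "(\<Union>d\<in>D - {x}. tree_component T c x d) \<in> component_borel T c"
    proof (rule B.countable_UN')
      show "tree_component T c x ` (D - {x}) \<subseteq> component_borel T c" using comp[OF x] D_sub by auto
    qed (simp add: D_countable)
    ultimately have "T - (T - {x}) \<in> component_borel T c" by (simp add: B.compl_sets)
    moreover have "T - (T - {x}) = {x}" using x by auto
    ultimately show ?thesis by simp
  qed
qed

text \<open>The points beyond \<open>e\<close> as seen from \<open>x\<close> form a closed set, the
  complement of the component at \<open>e\<close> that contains \<open>x\<close>. As
  \<open>e\<close> runs through the points of \<open>D\<close> in the component, these closed sets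
  exhaust it; regularity of measurable sets rests on this.\<close>

lemma component_fsigma:
  assumes "x \<in> T" "y \<in> T" "x \<noteq> y"
  shows "tree_component T c x y = (\<Union>e\<in>D \<inter> tree_component T c x y. T - tree_component T c e x)"
proof -
  interpret X: rooted_tree T c x using assms tree by unfold_locales
  have e: "X.le e z \<longleftrightarrow> z \<notin> tree_component T c e x" if "e \<in> T" "e \<noteq> x" "z \<in> T" for e z
    using X.component_root[of e] that by auto
  have ne: "e \<in> T \<and> e \<noteq> x" if "e \<in> D \<inter> tree_component T c x y" for e
    using that assms by (auto simp: tree_component_def split: if_splits)
  show ?thesis
  proof (intro equalityI subsetI)
    fix z assume z: "z \<in> tree_component T c x y"
    then have zT: "z \<in> T" "z \<noteq> x" using assms by (auto simp: tree_component_def split: if_splits)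
    obtain d where d: "d \<in> D" "d \<in> tree_interval T c z x" "d \<noteq> x" using D_sep[of z x] zT assms by auto
    then have dz: "X.le d z" "d \<in> T" using X.interval_le(2)[of x z] zT assms by auto
    then have "z \<in> tree_component T c x d"
      using X.component_at_root[of d] d zT X.le_meet by auto
    then have "tree_component T c x d = tree_component T c x y"
      using component_eq[OF tree] dz z assms by metis
    then have "d \<in> D \<inter> tree_component T c x y"
      using d component_mem[OF tree, of x d] dz assms by auto
    then show "z \<in> (\<Union>e\<in>D \<inter> tree_component T c x y. T - tree_component T c e x)"
      using e[of d z] dz d zT by auto
  next
    fix w assume "w \<in> (\<Union>e\<in>D \<inter> tree_component T c x y. T - tree_component T c e x)"
    then obtain d where d: "d \<in> D \<inter> tree_component T c x y" "w \<in> T" "w \<notin> tree_component T c d x" by auto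
    then have "X.le d w" using e[of d w] ne[of d] by auto
    then have "w \<in> tree_component T c x d"
      using X.component_at_root[of d] d ne X.le_meet by auto
    then show "w \<in> tree_component T c x y"
      using component_eq[OF tree, of x y d] d assms by auto
  qed
qed

end

lemma order_separable_iff:
  "order_separable T c \<longleftrightarrow> (\<exists>D\<subseteq>T. countable D \<and> 
     (\<forall>x\<in>T. \<forall>y\<in>T. x \<noteq> y \<longrightarrow> (\<exists>d\<in>D. d \<in> tree_interval T c x y \<and> d \<noteq> y)))"
proof -
  have "D \<inter> (I - {y}) \<noteq> {} \<longleftrightarrow> (\<exists>d\<in>D. d \<in> I \<and> d \<noteq> y)" for D I and y :: 'a by blast
  then show ?thesis unfolding order_separable_def by simp
qed

section \<open>Regular sets and Lusin's theorem\<close>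

locale finite_topological_measure = finite_measure M for M :: "'a measure" +
  fixes X :: "'a topology"
  assumes space_top: "space M = topspace X" and open_in_sets: "\<And>U. openin X U \<Longrightarrow> U \<in> sets M"
begin

text \<open>Regularity with closed rather than compact inner sets: the space is not assumed compact,
  and compactness is supplied separately where it is used.\<close>

definition sandwiched :: "'a set \<Rightarrow> bool" where
  "sandwiched B \<longleftrightarrow> (\<forall>e>0. \<exists>C U. closedin X C \<and> openin X U \<and> C \<subseteq> B \<and> B \<subseteq> U \<and> measure M (U - C) < e)"

lemma closed_in_sets: "closedin X C \<Longrightarrow> C \<in> sets M"
  using open_in_sets[of "topspace X - C"] sets.compl_sets[of "topspace X - C" M] closedin_subset[of X C]
  by (auto simp: closedin_def space_top double_diff)

lemma sandwiched_compl:
  assumes "sandwiched B" shows "sandwiched (space M - B)"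
  unfolding sandwiched_def
proof (intro allI impI)
  fix e :: real assume "e > 0"
  then obtain C U where *: "closedin X C" "openin X U" "C \<subseteq> B" "B \<subseteq> U" "measure M (U - C) < e"
    using assms unfolding sandwiched_def by meson
  have "(topspace X - C) - (topspace X - U) = U - C" using openin_subset[OF *(2)] by auto
  then show "\<exists>C U. closedin X C \<and> openin X U \<and> C \<subseteq> space M - B \<and> space M - B \<subseteq> U \<and> measure M (U - C) < e"
    using * unfolding space_top
    by (intro exI[of _ "topspace X - U"] exI[of _ "topspace X - C"] conjI closedin_diff openin_diff
        closedin_topspace openin_topspace) auto
qed

lemma sandwiched_choose:
  assumes "\<And>n::nat. sandwiched (B n)" "e > 0"
  obtains C U where "\<And>n. closedin X (C n)" "\<And>n. openin X (U n)" "\<And>n. C n \<subseteq> B n" "\<And>n. B n \<subseteq> U n"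
    "measure M (\<Union>n. U n - C n) \<le> e"
proof -
  have "\<forall>n. \<exists>C U. closedin X C \<and> openin X U \<and> C \<subseteq> B n \<and> B n \<subseteq> U \<and> measure M (U - C) < e * (1/2)^Suc n"
  proof
    fix n
    have "e * (1/2)^Suc n > 0" using assms(2) by simp
    then show "\<exists>C U. closedin X C \<and> openin X U \<and> C \<subseteq> B n \<and> B n \<subseteq> U \<and> measure M (U - C) < e * (1/2)^Suc n"
      using assms(1)[of n] unfolding sandwiched_def by meson
  qed
  then obtain C U where *: "\<And>n. closedin X (C n)" "\<And>n. openin X (U n)" "\<And>n. C n \<subseteq> B n" "\<And>n. B n \<subseteq> U n"
    "\<And>n. measure M (U n - C n) < e * (1/2)^Suc n"
    by metis
  have sums: "(\<lambda>n. e * (1/2)^Suc n) sums e"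
    using sums_mult[OF power_half_series, of e] by simp
  have sm: "summable (\<lambda>n. measure M (U n - C n))"
    by (rule summable_comparison_test'[OF sums_summable[OF sums], of 0]) (use *(5) in \<open>auto intro: less_imp_le\<close>)
  have "measure M (\<Union>n. U n - C n) \<le> (\<Sum>n. measure M (U n - C n))"
    by (rule finite_measure_subadditive_countably) (use * open_in_sets closed_in_sets sm in auto)
  also have "\<dots> \<le> (\<Sum>n. e * (1/2)^Suc n)"
    by (rule suminf_le[OF _ sm sums_summable[OF sums]]) (use *(5) less_imp_le in blast)
  also have "\<dots> = e" using sums by (rule sums_unique[symmetric])
  finally show thesis using that[of C U] * by blast
qed

text \<open>A countable union of closed sets need not be closed, but continuity of a finite measure
  from above cuts it off at a finite stage with the same strict error bound.\<close>

lemma closed_approximation: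
  assumes C: "\<And>n::nat. closedin X (C n)" and U: "U \<in> sets M" "(\<Union>n. C n) \<subseteq> U"
    and e: "measure M (U - (\<Union>n. C n)) < e"
  obtains N where "measure M (U - (\<Union>n<N. C n)) < e"
proof -
  have "(\<lambda>N. measure M (U - (\<Union>n<N. C n))) \<longlonglongrightarrow> measure M (\<Inter>N. U - (\<Union>n<N. C n))"
  proof (rule finite_Lim_measure_decseq)
    show "range (\<lambda>N. U - (\<Union>n<N. C n)) \<subseteq> sets M" using C U closed_in_sets by auto
    show "decseq (\<lambda>N. U - (\<Union>n<N. C n))" unfolding decseq_def by force
  qed
  moreover have "(\<Inter>N. U - (\<Union>n<N. C n)) = U - (\<Union>n. C n)" by auto
  ultimately have "eventually (\<lambda>N. measure M (U - (\<Union>n<N. C n)) < e) sequentially"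
    using e by (simp add: order_tendstoD(2))
  then show thesis using that by (auto dest: eventually_happens)
qed

lemma closedin_Union_lessThan: "(\<And>n::nat. closedin X (C n)) \<Longrightarrow> closedin X (\<Union>n<N. C n)"
  by (intro closedin_Union) auto

lemma sandwiched_UN:
  assumes "\<And>n::nat. sandwiched (B n)" shows "sandwiched (\<Union>n. B n)"
  unfolding sandwiched_def
proof (intro allI impI)
  fix e :: real assume e: "e > 0"
  then have e2: "e/2 > 0" by simp
  obtain C U where *: "\<And>n. closedin X (C n)" "\<And>n. openin X (U n)" "\<And>n. C n \<subseteq> B n" "\<And>n. B n \<subseteq> U n"
    "measure M (\<Union>n. U n - C n) \<le> e/2"
    by (rule sandwiched_choose[where B=B and e="e/2", OF assms e2]) blast
  define V where "V = (\<Union>n. U n)"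
  have V: "openin X V" unfolding V_def using *(2) by (intro openin_Union) auto
  have "measure M (V - (\<Union>n. C n)) \<le> measure M (\<Union>n. U n - C n)"
    by (rule finite_measure_mono) (use * open_in_sets closed_in_sets in \<open>auto simp: V_def\<close>)
  then have "measure M (V - (\<Union>n. C n)) < e" using * e by simp
  then obtain N where N: "measure M (V - (\<Union>n<N. C n)) < e"
  proof (rule closed_approximation[rotated 3])
    show "(\<Union>n. C n) \<subseteq> V" using *(3,4) unfolding V_def by (meson SUP_mono' order_trans)
  qed (use * V open_in_sets in auto)
  have "(\<Union>n<N. C n) \<subseteq> (\<Union>n. B n)" using *(3) by (intro SUP_mono) auto
  moreover have "(\<Union>n. B n) \<subseteq> V" unfolding V_def using *(4) by (intro SUP_mono) auto
  ultimately show "\<exists>C U. closedin X C \<and> openin X U \<and> C \<subseteq> (\<Union>n. B n) \<and> (\<Union>n. B n) \<subseteq> U \<and> measure M (U - C) < e"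
    using N V closedin_Union_lessThan[of C N] *(1)
    by (intro exI[of _ "\<Union>n<N. C n"] exI[of _ V] conjI) auto
qed

text \<open>The set is its own outer approximation, and finite subunions approximate it from
  inside.\<close>

lemma sandwiched_open:
  assumes "openin X (\<Union>\<C>)" "countable \<C>" "\<And>C. C \<in> \<C> \<Longrightarrow> closedin X C"
  shows "sandwiched (\<Union>\<C>)"
proof -
  define C where "C = (\<lambda>n. from_nat_into (insert {} \<C>) n)"
  have r: "range C = insert {} \<C>" unfolding C_def using assms by (intro range_from_nat_into) auto
  have U: "(\<Union>n. C n) = \<Union>\<C>" unfolding r by auto
  have cl: "closedin X (C n)" for n using r assms(3) by (metis closedin_empty insertE rangeI)
  show ?thesis unfolding sandwiched_def
  proof (intro allI impI)
    fix e :: real assume e: "e > 0"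
    have "measure M (\<Union>\<C> - (\<Union>n. C n)) < e" using e unfolding U by simp
    then obtain N where N: "measure M (\<Union>\<C> - (\<Union>n<N. C n)) < e"
      by (rule closed_approximation[OF cl open_in_sets[OF assms(1)] equalityD1[OF U]])
    have "(\<Union>n<N. C n) \<subseteq> \<Union>\<C>" unfolding U[symmetric] by auto
    then show "\<exists>D U. closedin X D \<and> openin X U \<and> D \<subseteq> \<Union>\<C> \<and> \<Union>\<C> \<subseteq> U \<and> measure M (U - D) < e"
      using N assms(1) closedin_Union_lessThan[OF cl]
      by (intro exI[of _ "\<Union>n<N. C n"] exI[of _ "\<Union>\<C>"]) auto
  qed
qed

lemma sandwiched_sigma_sets:
  assumes "\<And>S. S \<in> \<S> \<Longrightarrow> sandwiched S" "B \<in> sigma_sets (space M) \<S>"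
  shows "sandwiched B"
  using assms(2)
proof induction
  case Empty
  then show ?case unfolding sandwiched_def by (intro allI impI exI[of _ "{}"]) auto
qed (use assms sandwiched_compl sandwiched_UN in auto)

text \<open>Removing the open set \<open>U n - C n\<close> for every set \<open>E n\<close> leaves a
  closed set on which \<open>E n\<close> agrees with \<open>U n\<close> and its complement with that
  of \<open>C n\<close>; each given set becomes relatively clopen. Applied to preimages of a
  countable subbase, this says that the map is continuous on the closed set.\<close>

lemma Lusin:
  assumes sw: "\<And>B. B \<in> \<E> \<Longrightarrow> sandwiched B" and "countable \<E>" "e > 0"
  obtains C where "closedin X C" "measure M (space M - C) < e"
    "\<And>E. E \<in> \<E> \<Longrightarrow> openin (subtopology X C) (E \<inter> C)" "\<And>E. E \<in> \<E> \<Longrightarrow> openin (subtopology X C) (C - E)"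
proof -
  have "sandwiched {}" unfolding sandwiched_def by (intro allI impI exI[of _ "{}"]) auto
  define E where "E = (\<lambda>n. from_nat_into (insert {} \<E>) n)"
  have r: "range E = insert {} \<E>" unfolding E_def using assms by (intro range_from_nat_into) auto
  have swE: "sandwiched (E n)" for n using r sw \<open>sandwiched {}\<close> by (metis insertE rangeI)
  have e2: "e/2 > 0" using \<open>e > 0\<close> by simp
  obtain C U where *: "\<And>n. closedin X (C n)" "\<And>n. openin X (U n)" "\<And>n. C n \<subseteq> E n" "\<And>n. E n \<subseteq> U n"
    "measure M (\<Union>n. U n - C n) \<le> e/2"
    by (rule sandwiched_choose[where B=E and e="e/2", OF swE e2]) blast
  define K where "K = topspace X - (\<Union>n. U n - C n)"
  have op: "openin X (\<Union>n. U n - C n)" using * by (intro openin_Union) (auto intro!: openin_diff)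
  have cl: "closedin X K" unfolding K_def using op by (intro closedin_diff closedin_topspace)
  have sub: "(\<Union>n. U n - C n) \<subseteq> topspace X" by (rule openin_subset[OF op])
  have "space M - K = (\<Union>n. U n - C n)"
    unfolding K_def space_top by (rule double_diff[OF sub order_refl])
  then have m: "measure M (space M - K) < e" using * \<open>e > 0\<close> by simp
  have 1: "E n \<inter> K = U n \<inter> K" for n using *(3,4)[of n] by (auto simp: K_def)
  have 2: "K - E n = (topspace X - C n) \<inter> K" for n using *(3,4)[of n] by (auto simp: K_def)
  have "openin (subtopology X K) (E n \<inter> K)" for n
    unfolding 1 using *(2) by (simp add: openin_subtopology_Int)
  moreover have "openin (subtopology X K) (K - E n)" for n
    unfolding 2 using *(1) by (intro openin_subtopology_Int openin_diff openin_topspace)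
  moreover have "\<exists>n. E n = B" if "B \<in> \<E>" for B using r that by (metis imageE insertI2)
  ultimately show thesis using that[OF cl m] by metis
qed

end

section \<open>Depth-first positions\<close>

context rooted_tree begin

lemma ltD: "lt x y \<Longrightarrow> le x y" "lt x y \<Longrightarrow> x \<noteq> y"
  by (auto simp: lt_def)

lemma lt_not_le: "x \<in> T \<Longrightarrow> y \<in> T \<Longrightarrow> lt x y \<Longrightarrow> \<not> le y x"
  using le_antisym lt_def by blast

lemma le_lt_trans: "x \<in> T \<Longrightarrow> y \<in> T \<Longrightarrow> z \<in> T \<Longrightarrow> le x y \<Longrightarrow> lt y z \<Longrightarrow> lt x z"
  unfolding lt_def using le_trans[of x y z] le_antisym[of x y] by auto

lemma lt_le_trans: "x \<in> T \<Longrightarrow> y \<in> T \<Longrightarrow> z \<in> T \<Longrightarrow> lt x y \<Longrightarrow> le y z \<Longrightarrow> lt x z"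
  unfolding lt_def using le_trans[of x y z] le_antisym[of x y] by auto

lemma lt_trans: "x \<in> T \<Longrightarrow> y \<in> T \<Longrightarrow> z \<in> T \<Longrightarrow> lt x y \<Longrightarrow> lt y z \<Longrightarrow> lt x z"
  using lt_le_trans ltD(1) by blast

abbreviation S :: "'a \<Rightarrow> 'a \<Rightarrow> 'a set" where "S \<equiv> tree_component T c"

lemma mem_S_above:
  assumes "x \<in> T" "y \<in> T" "lt x y" "z \<in> S x y"
  shows "z \<in> T" "lt x z" "S x z = S x y"
proof -
  have z: "z \<in> T" "le x z" "meet y z \<noteq> x" using assms component_above[of x y] by auto
  then show "z \<in> T" by simp
  have "meet y x = x" using assms meet_comm[of x y] by (simp add: lt_def le_meet)
  then have "x \<noteq> z" using z by metis
  then show "lt x z" using z unfolding lt_def by simp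
  show "S x z = S x y" by (rule component_eq[OF tree assms(1,2,4)])
qed

lemma S_mono:
  assumes "x \<in> T" "v \<in> T" "y \<in> T" "lt x v" "le v y"
  shows "y \<in> S x v" "S x y = S x v"
proof -
  have "meet v y = v" using assms by (simp add: le_meet)
  then show y: "y \<in> S x v"
    using assms component_above[of x v] le_trans[of x v y] by (auto simp: lt_def)
  show "S x y = S x v" by (rule component_eq[OF tree assms(1,2) y])
qed

text \<open>\<open>U x\<close> collects the components at \<open>x\<close> that do not contain the root.\<close>

definition U :: "'a \<Rightarrow> 'a set set" where "U x = S x ` {y \<in> T. lt x y}"

lemma U_memD:
  assumes "x \<in> T" "A \<in> U x" "y \<in> A"
  shows "y \<in> T" "lt x y" "S x y = A"
proof -
  obtain y0 where y0: "y0 \<in> T" "lt x y0" "A = S x y0" using assms(2) by (auto simp: U_def)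
  show "y \<in> T" "lt x y" "S x y = A"
    using mem_S_above[OF assms(1) y0(1,2)] assms(3) y0(3) by auto
qed

lemma S_in_U: "y \<in> T \<Longrightarrow> lt x y \<Longrightarrow> S x y \<in> U x"
  by (simp add: U_def)

lemma S_in_U_mem: "x \<in> T \<Longrightarrow> y \<in> T \<Longrightarrow> lt x y \<Longrightarrow> A \<in> U x \<Longrightarrow> y \<in> A \<longleftrightarrow> A = S x y"
  using U_memD(3)[of x A y] component_mem[OF tree, of x y] by auto

lemma U_nonempty:
  assumes "x \<in> T" "A \<in> U x" obtains y where "y \<in> A"
proof -
  obtain y where "y \<in> T" "A = S x y" using assms(2) by (auto simp: U_def)
  then show thesis using component_mem[OF tree assms(1), of y] that[of y] by simp
qed

lemma U_disjoint: "x \<in> T \<Longrightarrow> A \<in> U x \<Longrightarrow> B \<in> U x \<Longrightarrow> y \<in> A \<Longrightarrow> y \<in> B \<Longrightarrow> A = B"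
  using U_memD(3)[of x A y] U_memD(3)[of x B y] by simp

lemma components_eq:
  assumes "x \<in> T"
  shows "S x ` T = insert {x} (U x) \<union> (if x = r then {} else {S x r})"
proof -
  have "S x y \<in> insert {x} (U x) \<union> (if x = r then {} else {S x r})" if y: "y \<in> T" for y
  proof -
    consider "y = x" | "lt x y" | "\<not> le x y" unfolding lt_def by auto
    then show ?thesis
    proof cases
      case 3
      then have "x \<noteq> r" using y by auto
      then show ?thesis
        using component_root[OF assms \<open>x \<noteq> r\<close>] component_not_above[OF assms y 3] by simp
    qed (use y in \<open>auto simp: component_self U_def\<close>)
  qed
  then have 1: "S x ` T \<subseteq> insert {x} (U x) \<union> (if x = r then {} else {S x r})" by (rule image_subsetI)
  have "{x} \<in> S x ` T" using imageI[OF assms, of "S x"] by (simp only: component_self)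
  moreover have "U x \<subseteq> S x ` T" unfolding U_def by (intro image_mono) simp
  moreover have "S x r \<in> S x ` T" by (rule imageI[OF root_in])
  ultimately have "insert {x} (U x) \<union> (if x = r then {} else {S x r}) \<subseteq> S x ` T" by simp
  with 1 show ?thesis by (rule equalityI)
qed

lemma not_in_U: 
  assumes "x \<in> T"
  shows "{x} \<notin> U x" "S x r \<notin> U x"
proof -
  show "{x} \<notin> U x" using U_memD(2)[of x "{x}" x] assms by (auto simp: lt_def)
  show "S x r \<notin> U x"
    using U_memD(2)[of x "S x r" r] component_mem[OF tree assms root_in] le_antisym[of x r] assms root_in
    by (auto simp: lt_def)
qed

end

section \<open>Masses above a point and the intervals assigned to them\<close>

locale weighted_tree = rooted_tree V c r for V :: "'a set" and c :: "'a \<Rightarrow> 'a \<Rightarrow> 'a \<Rightarrow> 'a" and r :: 'a +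
  fixes \<phi> :: "'a set \<Rightarrow> 'a \<Rightarrow> real" and Z :: real
  assumes countable_V: "countable V"
    and nonneg: "\<And>x y. x \<in> V \<Longrightarrow> y \<in> V \<Longrightarrow> 0 \<le> \<phi> (tree_component V c x y) x"
    and total: "\<And>x. x \<in> V \<Longrightarrow> ((\<lambda>A. \<phi> A x) has_sum Z) (tree_component V c x ` V)"
    and compat: "\<And>x y. x \<in> V \<Longrightarrow> y \<in> V \<Longrightarrow> x \<noteq> y \<Longrightarrow> Z \<le> \<phi> (tree_component V c x y) x + \<phi> (tree_component V c y x) y"
    and atom_pos: "\<And>x. x \<in> V \<Longrightarrow> 0 < \<phi> {x} x"
begin

lemma phi_U_nonneg: "x \<in> V \<Longrightarrow> A \<in> U x \<Longrightarrow> 0 \<le> \<phi> A x"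
  using nonneg by (auto simp: U_def)

lemma U_summable:
  assumes "x \<in> V" shows "(\<lambda>A. \<phi> A x) summable_on U x"
proof (rule summable_on_subset_banach[OF has_sum_imp_summable[OF total[OF assms]]])
  show "U x \<subseteq> S x ` V" unfolding U_def by (intro image_mono) simp
qed

text \<open>Both are masses of upper sets of the rooted order: strictly above \<open>x\<close>, and
  with \<open>x\<close> included.\<close>

definition sz :: "'a \<Rightarrow> real" where "sz x = infsum (\<lambda>A. \<phi> A x) (U x)"
definition m :: "'a \<Rightarrow> real" where "m x = sz x + \<phi> {x} x"

lemma sz_nonneg: "x \<in> V \<Longrightarrow> 0 \<le> sz x"
  unfolding sz_def using phi_U_nonneg by (intro infsum_nonneg)

lemma total_m:
  assumes "x \<in> V" shows "Z = m x + (if x = r then 0 else \<phi> (S x r) x)"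
proof -
  have 1: "((\<lambda>A. \<phi> A x) has_sum sz x) (U x)"
    unfolding sz_def by (rule has_sum_infsum[OF U_summable[OF assms]])
  have 2: "((\<lambda>A. \<phi> A x) has_sum (sz x + (\<phi> {x} x + (if x = r then 0 else \<phi> (S x r) x))))
    (U x \<union> ({{x}} \<union> (if x = r then {} else {S x r})))"
  proof (rule has_sum_Un_disjoint[OF 1])
    have "S x r \<noteq> {x}" if "x \<noteq> r"
      using component_mem[OF tree assms root_in] that by auto
    then show "((\<lambda>A. \<phi> A x) has_sum (\<phi> {x} x + (if x = r then 0 else \<phi> (S x r) x))) ({{x}} \<union> (if x = r then {} else {S x r}))"
      by (intro has_sum_finiteI) auto
    show "U x \<inter> ({{x}} \<union> (if x = r then {} else {S x r})) = {}"
      using not_in_U[OF assms] by auto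
  qed
  have "S x ` V = U x \<union> ({{x}} \<union> (if x = r then {} else {S x r}))"
    using components_eq[OF assms] by auto
  then have "Z = sz x + (\<phi> {x} x + (if x = r then 0 else \<phi> (S x r) x))"
    using has_sum_unique[OF total[OF assms]] 2 by simp
  then show ?thesis by (simp add: m_def)
qed

lemma m_root: "m r = Z"
  using total_m[OF root_in] by simp

lemma m_pos: "x \<in> V \<Longrightarrow> 0 < m x"
  using sz_nonneg[of x] atom_pos[of x] by (simp add: m_def)

lemma sz_less_m: "x \<in> V \<Longrightarrow> sz x < m x"
  using atom_pos[of x] by (simp add: m_def)

text \<open>Here the compatibility assumption enters: seen from \<open>y\<close>, the component
  facing \<open>x\<close> is that of the root, and its mass is \<open>Z - m y\<close>.\<close>

lemma m_le_component:
  assumes "x \<in> V" "y \<in> V" "lt x y"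
  shows "m y \<le> \<phi> (S x y) x"
proof -
  have "\<not> le y x" using lt_not_le[of x y] assms by simp
  moreover from this have "y \<noteq> r" using assms by auto
  ultimately have "S y x = S y r" using component_not_above[of y x] component_root[of y] assms by simp
  then show ?thesis using compat[of x y] total_m[of y] assms \<open>y \<noteq> r\<close> by (auto simp: lt_def)
qed

text \<open>Components at a point are disjoint, so numbering them by their least element is
  injective and gives order type at most omega: each has finitely many predecessors.\<close>

definition idx :: "'a set \<Rightarrow> nat" where "idx A = (LEAST n. n \<in> to_nat_on V ` A)"

lemma idx_inj:
  assumes "x \<in> V" "A \<in> U x" "B \<in> U x" "idx A = idx B"
  shows "A = B"
proof -
  have 1: "idx C \<in> to_nat_on V ` C" if C: "C \<in> U x" for C
  proof -
    obtain y where "y \<in> C" by (rule U_nonempty[OF assms(1) C])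
    then have "\<exists>n. n \<in> to_nat_on V ` C" by blast
    then show ?thesis unfolding idx_def by (rule LeastI_ex)
  qed
  obtain a where a: "a \<in> A" "idx A = to_nat_on V a" using 1[OF assms(2)] by (rule imageE)
  obtain b where b: "b \<in> B" "idx B = to_nat_on V b" using 1[OF assms(3)] by (rule imageE)
  have "a \<in> V" "b \<in> V" using U_memD(1) assms a b by blast+
  then have "a = b"
    using inj_onD[OF inj_on_to_nat_on[OF countable_V], of a b] a b assms(4) by simp
  then show ?thesis using U_disjoint[of x A B a] assms a b by simp
qed

lemma finite_idx_less: 
  assumes "x \<in> V" shows "finite {A \<in> U x. idx A < n}"
proof (rule inj_on_finite[of idx _ "{..<n}"])
  show "inj_on idx {A \<in> U x. idx A < n}" using idx_inj[OF assms] by (auto intro: inj_onI)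
qed auto

definition psum :: "'a \<Rightarrow> nat \<Rightarrow> real" where "psum x n = (\<Sum>A | A \<in> U x \<and> idx A < n. \<phi> A x)"
definition pre :: "'a \<Rightarrow> 'a set \<Rightarrow> real" where "pre x A = psum x (idx A)"

lemma psum_mono: "x \<in> V \<Longrightarrow> i \<le> j \<Longrightarrow> psum x i \<le> psum x j"
  unfolding psum_def by (intro sum_mono2 finite_idx_less) (auto simp: phi_U_nonneg)

lemma psum_nonneg: "x \<in> V \<Longrightarrow> 0 \<le> psum x i"
  unfolding psum_def by (intro sum_nonneg) (auto simp: phi_U_nonneg)

lemma pre_nonneg: "x \<in> V \<Longrightarrow> 0 \<le> pre x A"
  by (simp add: pre_def psum_nonneg)

lemma psum_Suc:
  assumes "x \<in> V" "A \<in> U x" shows "psum x (Suc (idx A)) = pre x A + \<phi> A x"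
proof -
  have "{B. B \<in> U x \<and> idx B < Suc (idx A)} = insert A {B. B \<in> U x \<and> idx B < idx A}"
    using idx_inj[OF assms(1) _ assms(2)] assms(2) by (auto simp: less_Suc_eq)
  then show ?thesis using finite_idx_less[OF assms(1), of "idx A"] by (simp add: psum_def pre_def)
qed

lemma psum_Suc_other:
  assumes "\<And>A. A \<in> U x \<Longrightarrow> idx A \<noteq> n" shows "psum x (Suc n) = psum x n"
proof -
  have "{A. A \<in> U x \<and> idx A < Suc n} = {A. A \<in> U x \<and> idx A < n}"
    using assms by (auto simp: less_Suc_eq)
  then show ?thesis by (simp add: psum_def)
qed

lemma psum_le_sz: "x \<in> V \<Longrightarrow> psum x n \<le> sz x"
  unfolding psum_def sz_def by (intro finite_sum_le_infsum U_summable) (auto simp: finite_idx_less phi_U_nonneg)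

lemma pre_le_sz: "x \<in> V \<Longrightarrow> A \<in> U x \<Longrightarrow> pre x A + \<phi> A x \<le> sz x"
  using psum_le_sz[of x "Suc (idx A)"] psum_Suc[of x A] by simp

lemma pre_le_pre: "x \<in> V \<Longrightarrow> A \<in> U x \<Longrightarrow> idx A < idx B \<Longrightarrow> pre x A + \<phi> A x \<le> pre x B"
  using psum_mono[of x "Suc (idx A)" "idx B"] psum_Suc[of x A] by (simp add: pre_def)

text \<open>The partial sums grow from 0 towards \<open>sz x\<close>, so there is a first one that
  exceeds \<open>u\<close>. It differs from the one before, hence its last index is that of a
  component, and \<open>u\<close> lies in the interval of this component.\<close>

lemma cells_cover:
  assumes x: "x \<in> V" and u: "0 \<le> u" "u < sz x"
  obtains A where "A \<in> U x" "pre x A \<le> u" "u < pre x A + \<phi> A x"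
proof -
  have "\<exists>n. u < psum x n"
  proof (rule ccontr)
    assume "\<not> (\<exists>n. u < psum x n)"
    then have le: "psum x n \<le> u" for n by (simp add: not_less)
    have "sz x \<le> u" unfolding sz_def
    proof (rule infsum_le_finite_sums[OF U_summable[OF x]])
      fix F assume F: "finite F" "F \<subseteq> U x"
      define n where "n = Suc (Max (insert 0 (idx ` F)))"
      have "idx A < n" if "A \<in> F" for A
        using F that unfolding n_def less_Suc_eq_le by (intro Max_ge) auto
      then have "(\<Sum>A\<in>F. \<phi> A x) \<le> psum x n" unfolding psum_def
        using F x finite_idx_less by (intro sum_mono2) (auto simp: phi_U_nonneg)
      then show "(\<Sum>A\<in>F. \<phi> A x) \<le> u" using le[of n] by simp
    qed
    then show False using u by simp
  qed
  then have n: "u < psum x (LEAST n. u < psum x n)" by (rule LeastI_ex)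
  have "psum x 0 = 0" by (simp add: psum_def)
  then have "(LEAST n. u < psum x n) \<noteq> 0"
    using n u by (intro notI) simp
  then obtain k where k: "(LEAST n. u < psum x n) = Suc k" using not0_implies_Suc by blast
  have "psum x k \<le> u" using not_less_Least[of k "\<lambda>n. u < psum x n"] k by simp
  moreover have uk: "u < psum x (Suc k)" using n k by simp
  ultimately obtain A where A: "A \<in> U x" "idx A = k" using psum_Suc_other[of x k] by fastforce
  show thesis
    using that[OF A(1)] \<open>psum x k \<le> u\<close> uk psum_Suc[OF x A(1)] A(2) by (simp add: pre_def)
qed

text \<open>Split at an arbitrary \<open>w\<close> of \<open>W\<close>. The bounds for the points
  below and above \<open>w\<close> are glued by the fact that the left mass at \<open>w\<close> and
  the mass of the component containing \<open>y\<close> fit together into \<open>m w\<close>. Only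
  finitely many points occur at a time, so a densely ordered path causes no trouble.\<close>

lemma left_sum_bound:
  assumes "finite W" "x \<in> V" "y \<in> V" "lt x y" "\<And>v. v \<in> W \<Longrightarrow> v \<in> V \<and> lt x v \<and> lt v y"
  shows "(\<Sum>v\<in>W. pre v (S v y)) + m y \<le> \<phi> (S x y) x"
  using assms
proof (induction "card W" arbitrary: W x y rule: less_induct)
  case less
  show ?case
  proof (cases "W = {}")
    case True
    then show ?thesis using m_le_component less.prems by simp
  next
    case False
    then obtain w where w: "w \<in> W" by auto
    then have wV: "w \<in> V" "lt x w" "lt w y" using less.prems by auto
    define W1 where "W1 = {v \<in> W. lt v w}"
    define W2 where "W2 = {v \<in> W. lt w v}"
    have fin: "finite W1" "finite W2" unfolding W1_def W2_def using less.prems by auto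
    have "W \<subseteq> insert w (W1 \<union> W2)"
    proof
      fix v assume v: "v \<in> W"
      then have "le v w \<or> le w v" using le_linear[of v w y] wV less.prems by (auto simp: lt_def)
      then show "v \<in> insert w (W1 \<union> W2)" using v unfolding W1_def W2_def lt_def by auto
    qed
    then have W: "W = insert w (W1 \<union> W2)" using w by (auto simp: W1_def W2_def)
    have nw: "w \<notin> W1 \<union> W2" by (auto simp: W1_def W2_def lt_def)
    have dis: "W1 \<inter> W2 = {}" using lt_not_le less.prems(5) wV by (auto simp: W1_def W2_def lt_def)
    have c: "card W1 < card W" "card W2 < card W"
      using nw w less.prems(1) by (auto intro!: psubset_card_mono simp: W1_def W2_def)
    have 1: "(\<Sum>v\<in>W1. pre v (S v w)) + m w \<le> \<phi> (S x w) x"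
      using less.prems wV by (intro less.hyps[OF c(1)] fin) (auto simp: W1_def)
    have 2: "(\<Sum>v\<in>W2. pre v (S v y)) + m y \<le> \<phi> (S w y) w"
      using less.prems wV by (intro less.hyps[OF c(2)] fin) (auto simp: W2_def)
    have 3: "(\<Sum>v\<in>W1. pre v (S v w)) = (\<Sum>v\<in>W1. pre v (S v y))"
    proof (rule sum.cong)
      fix v assume "v \<in> W1"
      then show "pre v (S v w) = pre v (S v y)"
        using S_mono(2)[of v w y] less.prems wV by (auto simp: W1_def ltD)
    qed simp
    have 4: "S x w = S x y" using S_mono(2)[of x w y] less.prems wV by (simp add: ltD)
    have 5: "pre w (S w y) + \<phi> (S w y) w \<le> m w"
      using pre_le_sz[of w "S w y"] S_in_U[of y w] sz_less_m[of w] wV less.prems by simp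
    have "(\<Sum>v\<in>W. pre v (S v y)) = pre w (S w y) + ((\<Sum>v\<in>W1. pre v (S v y)) + (\<Sum>v\<in>W2. pre v (S v y)))"
      using nw fin dis by (subst W, subst sum.insert) (auto simp: sum.union_disjoint)
    then show ?thesis using 1 2 3 4 5 by simp
  qed
qed

definition anc :: "'a \<Rightarrow> 'a set" where "anc y = {v \<in> V. lt v y}"
text \<open>The total mass that branches off to the left of the path from the root to
  \<open>y\<close>; the bound behind its convergence is \<open>left_sum_bound_root\<close>.\<close>

definition a :: "'a \<Rightarrow> real" where "a y = infsum (\<lambda>v. pre v (S v y)) (anc y)"

lemma left_sum_bound_root:
  assumes "finite W" "W \<subseteq> anc y" "y \<in> V"
  shows "(\<Sum>v\<in>W. pre v (S v y)) + m y \<le> Z"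
proof (cases "y = r")
  case True
  then have "anc y = {}" using root_le le_antisym root_in by (auto simp: anc_def lt_def)
  then show ?thesis using assms True m_root by auto
next
  case False
  then have ry: "lt r y" using assms by (auto simp: lt_def)
  have "(\<Sum>v\<in>W. pre v (S v y)) \<le> (\<Sum>v\<in>insert r (W - {r}). pre v (S v y))"
    using assms root_in by (intro sum_mono2) (auto simp: pre_nonneg anc_def)
  also have "\<dots> = pre r (S r y) + (\<Sum>v\<in>W - {r}. pre v (S v y))"
    by (subst sum.insert_remove) (use assms in auto)
  finally have 1: "(\<Sum>v\<in>W. pre v (S v y)) \<le> pre r (S r y) + (\<Sum>v\<in>W - {r}. pre v (S v y))" .
  have 2: "(\<Sum>v\<in>W - {r}. pre v (S v y)) + m y \<le> \<phi> (S r y) r"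
    using assms ry root_in by (intro left_sum_bound) (auto simp: anc_def lt_def)
  have "pre r (S r y) + \<phi> (S r y) r \<le> m r"
    using pre_le_sz[of r "S r y"] S_in_U[of y r] sz_less_m[of r] root_in assms ry by simp
  then show ?thesis using 1 2 m_root by simp
qed

lemma a_summable:
  assumes "y \<in> V" "B \<subseteq> anc y" shows "(\<lambda>v. pre v (S v y)) summable_on B"
proof (rule summable_on_subset_banach[OF _ assms(2)], rule nonneg_bdd_above_summable_on)
  show "bdd_above (sum (\<lambda>v. pre v (S v y)) ` {F. F \<subseteq> anc y \<and> finite F})"
    using left_sum_bound_root[OF _ _ assms(1)] m_pos[OF assms(1)]
    by (intro bdd_aboveI2[of _ _ Z]) fastforce
qed (auto simp: anc_def pre_nonneg)

lemma a_nonneg: "0 \<le> a y"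
  unfolding a_def by (intro infsum_nonneg) (auto simp: anc_def pre_nonneg)

lemma a_root: "a r = 0"
proof -
  have "anc r = {}" using root_le le_antisym root_in by (auto simp: anc_def lt_def)
  then show ?thesis by (simp add: a_def)
qed

text \<open>A point \<open>x\<close> owns the block from \<open>a x\<close> to \<open>b x\<close>.
  The block starts with the intervals of the components above \<open>x\<close> and ends with the gap
  from \<open>p x\<close> to \<open>b x\<close>, whose length is the mass of \<open>x\<close>
  itself. So \<open>p x\<close> comes after all descendants.\<close>

definition lo :: "'a \<Rightarrow> 'a set \<Rightarrow> real" where "lo v A = a v + pre v A"
definition hi :: "'a \<Rightarrow> 'a set \<Rightarrow> real" where "hi v A = lo v A + \<phi> A v"
definition p :: "'a \<Rightarrow> real" where "p x = a x + sz x"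
definition b :: "'a \<Rightarrow> real" where "b x = a x + m x"

lemma b_root: "b r = Z" by (simp add: b_def a_root m_root)

lemma b_le_Z: "y \<in> V \<Longrightarrow> b y \<le> Z"
proof -
  assume y: "y \<in> V"
  have "a y \<le> Z - m y"
    unfolding a_def
  proof (rule infsum_le_finite_sums)
    show "(\<lambda>v. pre v (S v y)) summable_on anc y" using a_summable[OF y] by simp
    fix F assume "finite F" "F \<subseteq> anc y"
    then show "(\<Sum>v\<in>F. pre v (S v y)) \<le> Z - m y" using left_sum_bound_root[of F y] y by simp
  qed
  then show ?thesis by (simp add: b_def)
qed

text \<open>The ancestors of \<open>y\<close> are those of \<open>x\<close>, then \<open>x\<close>
  itself, then the points strictly between. The first two parts sum to the left end of the interval;
  the third is controlled by \<open>left_sum_bound\<close>, which leaves room for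
  \<open>m y\<close>.\<close>

lemma cell_nested:
  assumes "x \<in> V" "y \<in> V" "lt x y"
  shows "lo x (S x y) \<le> a y" "b y \<le> hi x (S x y)"
proof -
  define B where "B = {v \<in> V. lt x v \<and> lt v y}"
  let ?f = "\<lambda>v. pre v (S v y)"
  have anc: "anc y = (anc x \<union> {x}) \<union> B"
  proof
    show "anc y \<subseteq> (anc x \<union> {x}) \<union> B"
    proof
      fix v assume v: "v \<in> anc y"
      then have "le v x \<or> le x v" using le_linear[of v x y] assms by (auto simp: lt_def anc_def)
      then show "v \<in> (anc x \<union> {x}) \<union> B" using v unfolding anc_def B_def lt_def by auto
    qed
    show "(anc x \<union> {x}) \<union> B \<subseteq> anc y"
      using assms lt_trans[of _ x y] by (auto simp: anc_def B_def)
  qed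
  have sub: "anc x \<union> {x} \<subseteq> anc y" "B \<subseteq> anc y" "anc x \<subseteq> anc y" "{x} \<subseteq> anc y" using anc by auto
  have dis: "(anc x \<union> {x}) \<inter> B = {}"
    using assms lt_not_le[of x] by (auto simp: anc_def B_def lt_def)
  have dis2: "anc x \<inter> {x} = {}" by (auto simp: anc_def lt_def)
  have ax: "infsum ?f (anc x) = a x"
    unfolding a_def
  proof (rule infsum_cong)
    fix v assume "v \<in> anc x"
    then show "pre v (S v y) = pre v (S v x)"
      using S_mono(2)[of v x y] assms by (auto simp: anc_def ltD)
  qed
  have s: "infsum ?f {x} = pre x (S x y)" by simp
  have "a y = infsum ?f (anc x \<union> {x}) + infsum ?f B"
    unfolding a_def anc by (rule infsum_Un_disjoint) (intro a_summable assms sub dis)+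
  also have "infsum ?f (anc x \<union> {x}) = infsum ?f (anc x) + infsum ?f {x}"
    by (rule infsum_Un_disjoint) (intro a_summable assms sub dis2)+
  finally have ay: "a y = lo x (S x y) + infsum ?f B" using ax s by (simp add: lo_def)
  have "0 \<le> infsum ?f B" by (intro infsum_nonneg) (auto simp: B_def pre_nonneg)
  then show "lo x (S x y) \<le> a y" using ay by simp
  have "infsum ?f B \<le> \<phi> (S x y) x - m y"
  proof (rule infsum_le_finite_sums)
    show "?f summable_on B" by (intro a_summable assms sub)
    fix F assume F: "finite F" "F \<subseteq> B"
    then have "\<And>v. v \<in> F \<Longrightarrow> v \<in> V \<and> lt x v \<and> lt v y" by (auto simp: B_def)
    then show "(\<Sum>v\<in>F. pre v (S v y)) \<le> \<phi> (S x y) x - m y"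
      using left_sum_bound[OF F(1) assms] by simp
  qed
  then show "b y \<le> hi x (S x y)" using ay by (simp add: b_def hi_def)
qed

lemma p_less_b: "x \<in> V \<Longrightarrow> p x < b x"
  using sz_less_m by (simp add: p_def b_def)

lemma a_le_p: "x \<in> V \<Longrightarrow> a x \<le> p x"
  using sz_nonneg by (simp add: p_def)

lemma a_le_lo: "v \<in> V \<Longrightarrow> a v \<le> lo v A"
  using pre_nonneg by (simp add: lo_def)

lemma lo_le_hi: "v \<in> V \<Longrightarrow> A \<in> U v \<Longrightarrow> lo v A \<le> hi v A"
  using phi_U_nonneg by (simp add: hi_def)

lemma hi_le_p: "v \<in> V \<Longrightarrow> A \<in> U v \<Longrightarrow> hi v A \<le> p v"
  using pre_le_sz by (simp add: hi_def lo_def p_def)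

lemma hi_le_lo: "v \<in> V \<Longrightarrow> A \<in> U v \<Longrightarrow> idx A < idx B \<Longrightarrow> hi v A \<le> lo v B"
  using pre_le_pre[of v A B] by (simp add: hi_def lo_def)

lemma cells_ordered:
  assumes "v \<in> V" "A \<in> U v" "B \<in> U v" "A \<noteq> B"
  shows "hi v A \<le> lo v B \<or> hi v B \<le> lo v A"
  using idx_inj[of v A B] assms hi_le_lo[of v A B] hi_le_lo[of v B A]
  by (cases "idx A" "idx B" rule: linorder_cases) simp_all

lemma cell_exists:
  assumes "v \<in> V" "a v \<le> t" "t < p v"
  obtains A where "A \<in> U v" "lo v A \<le> t" "t < hi v A"
proof -
  have "0 \<le> t - a v" "t - a v < sz v" using assms by (auto simp: p_def)
  from cells_cover[OF assms(1) this] obtain A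
    where "A \<in> U v" "pre v A \<le> t - a v" "t - a v < pre v A + \<phi> A v" by blast
  then show thesis using that[of A] by (simp add: lo_def hi_def)
qed

section \<open>Nesting and disjointness of intervals and blocks\<close>

definition J :: "'a \<Rightarrow> 'a set \<Rightarrow> real set" where "J v A = {lo v A..<hi v A}"

lemma J_mem: "t \<in> J v A \<longleftrightarrow> lo v A \<le> t \<and> t < hi v A" by (auto simp: J_def)

lemma J_unique: "v \<in> V \<Longrightarrow> A \<in> U v \<Longrightarrow> B \<in> U v \<Longrightarrow> t \<in> J v A \<Longrightarrow> t \<in> J v B \<Longrightarrow> A = B"
  using cells_ordered[of v A B] by (force simp: J_mem)

lemma J_sub: "v \<in> V \<Longrightarrow> A \<in> U v \<Longrightarrow> t \<in> J v A \<Longrightarrow> a v \<le> t \<and> t < p v"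
  using a_le_lo[of v A] hi_le_p[of v A] by (auto simp: J_mem)

lemma block_sub_J:
  "v \<in> V \<Longrightarrow> x \<in> V \<Longrightarrow> lt v x \<Longrightarrow> a x \<le> t \<Longrightarrow> t < b x \<Longrightarrow> t \<in> J v (S v x)"
  using cell_nested[of v x] by (simp add: J_mem)

text \<open>Blocks of incomparable points lie in different, hence disjoint, intervals at their
  meet.\<close>

lemma blocks_comparable:
  assumes xy: "x \<in> V" "y \<in> V" and t: "a x \<le> t" "t < b x" "a y \<le> t" "t < b y"
  shows "le x y \<or> le y x"
proof (rule ccontr)
  assume n: "\<not> (le x y \<or> le y x)"
  define w where "w = meet x y"
  have w: "w \<in> V" "le w x" "le w y" using xy by (auto simp: w_def)
  then have lt: "lt w x" "lt w y" using n by (auto simp: lt_def)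
  have "S w x = S w y"
    using J_unique[of w "S w x" "S w y" t] block_sub_J[of w x t] block_sub_J[of w y t] w lt xy t S_in_U by simp
  then have "y \<in> S w x" using component_mem[OF tree w(1) xy(2)] by simp
  then have "meet x y \<noteq> w" using component_above[OF w(1) xy(1) lt(1)] by simp
  then show False by (simp add: w_def)
qed

lemma J_block:
  assumes "w \<in> V" "B \<in> U w" "v \<in> V" "t \<in> J w B" "a v \<le> t" "t < b v"
  shows "v = w \<or> lt v w \<or> (lt w v \<and> B = S w v)"
proof -
  have "a w \<le> t" "t < b w" using J_sub[of w B t] p_less_b[of w] assms by auto
  then have "le v w \<or> le w v" using blocks_comparable[of v w t] assms by simp
  moreover have "B = S w v" if "lt w v"
    using J_unique[of w B "S w v" t] block_sub_J[of w v t] S_in_U[of v w] assms that by simp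
  ultimately show ?thesis by (auto simp: lt_def)
qed

lemma p_in_J:
  assumes "x \<in> V" "v \<in> V" "A \<in> U v"
  shows "p x \<in> J v A \<longleftrightarrow> x \<in> A"
proof
  assume "x \<in> A"
  then have "lt v x" "S v x = A" using U_memD[of v A x] assms by auto
  then show "p x \<in> J v A" using block_sub_J[of v x "p x"] assms a_le_p p_less_b by auto
next
  assume *: "p x \<in> J v A"
  then consider "x = v" | "lt x v" | "lt v x \<and> A = S v x"
    using J_block[of v A x "p x"] assms a_le_p p_less_b by auto
  then show "x \<in> A"
  proof cases
    case 1
    then show ?thesis using * J_sub[of v A "p x"] assms by simp
  next
    \<comment> \<open>Here \<open>p x\<close> is to the right of everything placed above
      \<open>x\<close>, while the interval in question is part of the block of \<open>v\<close>,
      which is above \<open>x\<close>.\<close>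
    case 2
    have "hi x (S x v) \<le> p x" using hi_le_p[of x "S x v"] S_in_U assms 2 by simp
    moreover have "b v \<le> hi x (S x v)" using cell_nested[of x v] 2 assms by simp
    moreover have "p x < b v" using J_sub[of v A "p x"] * assms p_less_b[of v] by simp
    ultimately show ?thesis by simp
  next
    case 3
    then show ?thesis using component_mem[OF tree assms(2,1)] by simp
  qed
qed

text \<open>The gap behind \<open>p x\<close> stands for the point mass at \<open>x\<close>.
  Positions of descendants precede it, those of ancestors come at its end or later, and those of
  unrelated points are outside the block.\<close>

lemma p_not_in_gap:
  assumes "x \<in> V" "y \<in> V" shows "\<not> (p x < p y \<and> p y < b x)"
proof
  assume *: "p x < p y \<and> p y < b x"
  then have "le x y \<or> le y x"
    using blocks_comparable[of x y "p y"] assms a_le_p[of x] a_le_p[of y] p_less_b[of y] by simp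
  moreover have "\<not> lt x y"
  proof
    assume "lt x y"
    then have "b y \<le> p x" using cell_nested[of x y] hi_le_p[of x "S x y"] S_in_U[of y x] assms by simp
    then show False using * p_less_b[of y] assms by simp
  qed
  moreover have "\<not> lt y x"
  proof
    assume "lt y x"
    then have "b x \<le> p y" using cell_nested[of y x] hi_le_p[of y "S y x"] S_in_U[of x y] assms by simp
    then show False using * by simp
  qed
  ultimately show False using * by (auto simp: lt_def)
qed

lemma p_lt_order:
  assumes "x \<in> V" "y \<in> V" "lt x y" shows "b y \<le> p x" "a x \<le> a y"
  using cell_nested[of x y] hi_le_p[of x "S x y"] S_in_U[of y x] a_le_lo[of x "S x y"] assms by auto

lemma p_inj: 
  assumes "x \<in> V" "y \<in> V" "p x = p y" shows "x = y"
proof -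
  have "le x y \<or> le y x"
    using blocks_comparable[of x y "p y"] assms a_le_p[of x] a_le_p[of y] p_less_b[of x] p_less_b[of y] by simp
  then show ?thesis
    using p_lt_order(1)[of x y] p_lt_order(1)[of y x] assms p_less_b[of x] p_less_b[of y] by (auto simp: lt_def)
qed

lemma p_bounds: "x \<in> V \<Longrightarrow> 0 \<le> p x" "x \<in> V \<Longrightarrow> p x < Z"
  using a_nonneg[of x] a_le_p[of x] p_less_b[of x] b_le_Z[of x] by auto

end

section \<open>The tree of positions\<close>

context tree_semilattice begin

lemma rooted: "rooted_tree T median r"
  using algebraic_tree_median root by unfold_locales

lemma rooted_meet: "x \<in> T \<Longrightarrow> y \<in> T \<Longrightarrow> rooted_tree.meet median r x y = meet x y"
  by (simp add: rooted_tree.meet_def[OF rooted] median_root)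

lemma rooted_le: "x \<in> T \<Longrightarrow> y \<in> T \<Longrightarrow> rooted_tree.le median r x y \<longleftrightarrow> le x y"
  using meet2[of x y] meet_absorb[of x y] by (auto simp: rooted_tree.le_def[OF rooted] median_root)

lemma meet_eqI:
  assumes "x \<in> T" "y \<in> T" "u \<in> T" "le u x" "le u y" "\<And>w. w \<in> T \<Longrightarrow> le w x \<Longrightarrow> le w y \<Longrightarrow> le w u"
  shows "meet x y = u"
  using antisym[of "meet x y" u] glb[of x y u] meet1[of x y] meet2[of x y] meet_in[of x y] assms by simp

end

context weighted_tree begin

text \<open>\<open>leftcov t\<close> says that a position left of the block of \<open>x\<close> lies in a component branching off
  on the left of the path from the root to \<open>x\<close>; this fails only on a null set.\<close>

definition leftcov :: "real \<Rightarrow> bool" where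
  "leftcov t \<longleftrightarrow> (\<forall>x\<in>V. t < a x \<longrightarrow> (\<exists>v\<in>V. \<exists>A\<in>U v. lt v x \<and> t \<in> J v A \<and> x \<notin> A))"

text \<open>The half-open gaps are removed because each stands for the single point
  \<open>p x\<close>. The condition \<open>leftcov\<close> is what makes unrelated positions branch
  at a point of \<open>V\<close>.\<close>

definition G :: "real set" where
  "G = p ` V \<union> {t. 0 \<le> t \<and> t < Z \<and> leftcov t \<and> (\<forall>x\<in>V. \<not> (p x \<le> t \<and> t < b x))}"

text \<open>Descendants are placed earlier, hence the reversed inequality. A position off
  \<open>V\<close> has no components of its own, so its place in the tree is read off from the
  intervals around it: a component that holds an ancestor also holds the descendant.\<close>

definition leG :: "real \<Rightarrow> real \<Rightarrow> bool" where
  "leG t s \<longleftrightarrow> s \<le> t \<and> (\<forall>v\<in>V. \<forall>A\<in>U v. t \<in> J v A \<longrightarrow> s \<in> J v A)"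

definition meetG :: "real \<Rightarrow> real \<Rightarrow> real" where
  "meetG s t = (SOME u. u \<in> G \<and> leG u s \<and> leG u t \<and> (\<forall>w\<in>G. leG w s \<longrightarrow> leG w t \<longrightarrow> leG w u))"

lemma p_in_G: "x \<in> V \<Longrightarrow> p x \<in> G"
  by (simp add: G_def)

text \<open>A position of \<open>y\<close> to the left of the block of \<open>x\<close> forces
  \<open>x\<close> and \<open>y\<close> to be incomparable, and then their meet is the required
  ancestor.\<close>

lemma leftcov_p:
  assumes "y \<in> V" shows "leftcov (p y)"
  unfolding leftcov_def
proof (intro ballI impI)
  fix x assume x: "x \<in> V" "p y < a x"
  have 1: "\<not> le x y"
  proof
    assume "le x y"
    then have "a x \<le> a y" using p_lt_order(2)[of x y] x assms by (cases "x = y") (auto simp: lt_def)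
    then show False using x a_le_p[of y] assms by simp
  qed
  have 2: "\<not> le y x"
  proof
    assume "le y x"
    then have "lt y x" using 1 x by (auto simp: lt_def)
    then show False using p_lt_order(1)[of y x] x assms a_le_p[of x] p_less_b[of x] by simp
  qed
  define w where "w = meet x y"
  have w: "w \<in> V" "le w x" "le w y" using x assms by (auto simp: w_def)
  then have lt: "lt w x" "lt w y" using 1 2 by (auto simp: lt_def)
  have "meet y x = w" using x assms by (simp add: w_def meet_comm)
  then have "x \<notin> S w y" using component_above[OF w(1) assms lt(2)] by simp
  moreover have "p y \<in> J w (S w y)"
    using p_in_J[of y w "S w y"] S_in_U[of y w] component_mem[OF tree w(1) assms] lt w assms by simp
  ultimately show "\<exists>v\<in>V. \<exists>A\<in>U v. lt v x \<and> p y \<in> J v A \<and> x \<notin> A"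
    using w lt S_in_U[OF assms lt(2)] by blast
qed

lemma G_leftcov: "t \<in> G \<Longrightarrow> leftcov t"
  using leftcov_p by (auto simp: G_def)

lemma G_bounds: "t \<in> G \<Longrightarrow> 0 \<le> t" "t \<in> G \<Longrightarrow> t < Z"
  using p_bounds by (auto simp: G_def)

lemma G_gap: "t \<in> G \<Longrightarrow> x \<in> V \<Longrightarrow> p x < t \<Longrightarrow> t < b x \<Longrightarrow> False"
  using p_not_in_gap[of x] by (force simp: G_def)

lemma G_left:
  assumes "t \<in> G" "x \<in> V" "t < a x"
  obtains v A where "v \<in> V" "A \<in> U v" "lt v x" "t \<in> J v A" "x \<notin> A" "A \<noteq> S v x"
proof -
  obtain v A where "v \<in> V" "A \<in> U v" "lt v x" "t \<in> J v A" "x \<notin> A"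
    using G_leftcov[OF assms(1)] assms unfolding leftcov_def by blast
  moreover from this have "A \<noteq> S v x" using component_mem[OF tree _ assms(2)] by blast
  ultimately show thesis using that by blast
qed

lemma leG_refl: "leG t t" by (simp add: leG_def)
lemma leG_trans: "leG s t \<Longrightarrow> leG t u \<Longrightarrow> leG s u" by (force simp: leG_def)
lemma leG_antisym: "leG s t \<Longrightarrow> leG t s \<Longrightarrow> s = t" by (simp add: leG_def)

text \<open>Intervals are convex: one that contains \<open>z\<close> and the later of
  \<open>x\<close> and \<open>y\<close> also contains the earlier of them, which is not before
  \<open>z\<close>.\<close>

lemma leG_linear: 
  assumes "leG x z" "leG y z" shows "leG x y \<or> leG y x"
proof -
  have *: "leG y x" if xy: "x \<le> y" and z: "leG x z" "leG y z" for x y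
    unfolding leG_def
  proof (intro conjI ballI impI)
    fix v A assume v: "v \<in> V" "A \<in> U v" "y \<in> J v A"
    then have "z \<in> J v A" "z \<le> x" using z unfolding leG_def by auto
    then show "x \<in> J v A" using v xy by (auto simp: J_mem)
  qed (rule xy)
  show ?thesis using *[of x y] *[of y x] assms by (cases "x \<le> y") auto
qed

section \<open>Branching of positions and existence of meets\<close>

definition split_at :: "'a \<Rightarrow> real \<Rightarrow> real \<Rightarrow> bool" where
  "split_at v s t \<longleftrightarrow> v \<in> V \<and> (\<exists>A\<in>U v. \<exists>B\<in>U v. A \<noteq> B \<and> s \<in> J v A \<and> t \<in> J v B)"

lemma split_at_sym: "split_at v s t \<Longrightarrow> split_at v t s"
  unfolding split_at_def by blast

lemma leG_p_block:
  assumes "x \<in> V" "a x \<le> z" "z \<le> p x" shows "leG (p x) z"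
  unfolding leG_def
proof (intro conjI ballI impI)
  fix v A assume v: "v \<in> V" "A \<in> U v" "p x \<in> J v A"
  then have "x \<in> A" using p_in_J assms by blast
  then have "lt v x" "S v x = A" using U_memD[OF v(1,2)] by auto
  then show "z \<in> J v A" using block_sub_J[of v x z] v assms p_less_b[of x] by auto
qed (rule assms)

text \<open>Positions to the left of \<open>a x\<close> are the issue: by \<open>leftcov\<close>
  such a position lies in an interval at some ancestor of \<open>x\<close> other than the interval
  that contains \<open>p x\<close>.\<close>

lemma leG_p_iff:
  assumes "x \<in> V" "z \<in> G" shows "leG (p x) z \<longleftrightarrow> a x \<le> z \<and> z \<le> p x"
proof
  assume le: "leG (p x) z"
  have "a x \<le> z"
  proof (rule ccontr)
    assume "\<not> a x \<le> z"
    then have "z < a x" by simp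
    then obtain v A where v: "v \<in> V" "A \<in> U v" "lt v x" "z \<in> J v A" "A \<noteq> S v x"
      using G_left[OF assms(2,1)] by blast
    have "p x \<in> J v (S v x)"
      using block_sub_J[of v x "p x"] v assms a_le_p p_less_b by simp
    then have "z \<in> J v (S v x)" using le v S_in_U[OF assms(1) v(3)] unfolding leG_def by blast
    then show False using J_unique[of v A "S v x" z] S_in_U[OF assms(1) v(3)] v by simp
  qed
  then show "a x \<le> z \<and> z \<le> p x" using le by (simp add: leG_def)
qed (use leG_p_block assms in blast)

lemma split_at_glb:
  assumes sp: "split_at v s t"
  shows "leG (p v) s" "leG (p v) t" and "leG u s \<Longrightarrow> leG u t \<Longrightarrow> leG u (p v)"
proof -
  obtain A B where v: "v \<in> V" and AB: "A \<in> U v" "B \<in> U v" "A \<noteq> B" "s \<in> J v A" "t \<in> J v B"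
    using sp unfolding split_at_def by blast
  note s = J_sub[OF v AB(1,4)] and t = J_sub[OF v AB(2,5)]
  show "leG (p v) s" "leG (p v) t" using leG_p_block v s t by auto
  assume u: "leG u s" "leG u t"
  have nocell: "\<not> (C \<in> U v \<and> s \<in> J v C \<and> t \<in> J v C)" for C
    using J_unique[OF v AB(1) _ AB(4)] J_unique[OF v AB(2) _ AB(5)] AB(3) by metis
  show "leG u (p v)" unfolding leG_def
  proof (intro conjI ballI impI)
    \<comment> \<open>A lower bound placed before \<open>p v\<close> would lie in some interval at
      \<open>v\<close>, and this interval would contain both \<open>s\<close> and
      \<open>t\<close>.\<close>
    show "p v \<le> u"
    proof (rule ccontr)
      assume "\<not> p v \<le> u"
      then have "u < p v" "a v \<le> u" using u s by (auto simp: leG_def)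
      then obtain C where C: "C \<in> U v" "lo v C \<le> u" "u < hi v C" using cell_exists[OF v] by metis
      then have "u \<in> J v C" by (simp add: J_mem)
      then have "s \<in> J v C \<and> t \<in> J v C" using u v C unfolding leG_def by blast
      then show False using nocell C by blast
    qed
    fix w C assume w: "w \<in> V" "C \<in> U w" "u \<in> J w C"
    then have st: "s \<in> J w C" "t \<in> J w C" using u unfolding leG_def by auto
    have "s < b v" "t < b v" using s t p_less_b[OF v] by auto
    then consider "v = w" | "lt v w" | "lt w v" "C = S w v"
      using J_block[OF w(1,2) v st(1)] s by auto
    then show "p v \<in> J w C"
    proof cases
      case 1
      then show ?thesis using nocell w st by blast
    next
      case 2
      have "s \<in> J v (S v w)" "t \<in> J v (S v w)"
        using block_sub_J[OF v w(1) 2] J_sub[OF w(1,2)] st p_less_b[OF w(1)] by (meson less_trans)+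
      then show ?thesis using nocell S_in_U[OF w(1) 2] by blast
    next
      case 3
      then show ?thesis using p_in_J[OF v w(1,2)] component_mem[OF tree w(1) v] by simp
    qed
  qed
qed

text \<open>Some interval at a point \<open>v\<close> contains \<open>t\<close> but not
  \<open>s\<close>, so \<open>s\<close> is to its left. If \<open>s\<close> is still in the block of
  \<open>v\<close>, it lies in another interval at \<open>v\<close>; otherwise
  \<open>leftcov\<close> provides an ancestor of \<open>v\<close> at which the two part.\<close>

lemma split_exists_less:
  assumes G: "s \<in> G" and st: "s < t" and n: "\<not> leG t s"
  obtains v where "split_at v s t"
proof -
  obtain v A where v: "v \<in> V" "A \<in> U v" "t \<in> J v A" "s \<notin> J v A"
    using st n unfolding leG_def by auto
  have s: "s < lo v A" using v st by (auto simp: J_mem)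
  show thesis
  proof (cases "a v \<le> s")
    case True
    have "s < p v" using J_sub[OF v(1,2,3)] st by simp
    then obtain B where B: "B \<in> U v" "s \<in> J v B" 
      using cell_exists[OF v(1) True] unfolding J_mem by metis
    then have "B \<noteq> A" using v by auto
    then show thesis using that[of v] B v unfolding split_at_def by blast
  next
    case False
    then have "s < a v" by simp
    then obtain w B where w: "w \<in> V" "B \<in> U w" "lt w v" "s \<in> J w B" "B \<noteq> S w v"
      using G_left[OF G v(1)] by blast
    have "t \<in> J w (S w v)"
      using block_sub_J[OF w(1) v(1) w(3)] J_sub[OF v(1,2,3)] p_less_b[OF v(1)] by simp
    then show thesis using that[of w] w S_in_U[OF v(1) w(3)] unfolding split_at_def by blast
  qed
qed

lemma split_exists:
  assumes G: "s \<in> G" "t \<in> G" and n: "\<not> leG t s" "\<not> leG s t"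
  obtains v where "split_at v s t"
proof -
  have "s \<noteq> t" using n leG_refl by auto
  then consider "s < t" | "t < s" by linarith
  then show thesis
  proof cases
    case 1
    show thesis by (rule split_exists_less[OF G(1) 1 n(1)]) (rule that)
  next
    case 2
    show thesis by (rule split_exists_less[OF G(2) 2 n(2)]) (rule that[OF split_at_sym])
  qed
qed

lemma glb_exists:
  assumes G: "s \<in> G" "t \<in> G"
  shows "\<exists>u. u \<in> G \<and> leG u s \<and> leG u t \<and> (\<forall>w\<in>G. leG w s \<longrightarrow> leG w t \<longrightarrow> leG w u)"
proof -
  consider "leG t s" | "leG s t" | v where "split_at v s t" using split_exists[OF G] by blast
  then show ?thesis
  proof cases
    case 1 then show ?thesis using G leG_refl by blast
  next
    case 2 then show ?thesis using G leG_refl by blast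
  next
    case (3 v)
    then have "v \<in> V" by (simp add: split_at_def)
    then show ?thesis using split_at_glb[OF 3] p_in_G by blast
  qed
qed

lemma meetG_props:
  assumes "s \<in> G" "t \<in> G"
  shows "meetG s t \<in> G" "leG (meetG s t) s" "leG (meetG s t) t"
    "w \<in> G \<Longrightarrow> leG w s \<Longrightarrow> leG w t \<Longrightarrow> leG w (meetG s t)"
proof -
  have "meetG s t \<in> G \<and> leG (meetG s t) s \<and> leG (meetG s t) t \<and>
      (\<forall>w\<in>G. leG w s \<longrightarrow> leG w t \<longrightarrow> leG w (meetG s t))"
    unfolding meetG_def by (rule someI_ex[OF glb_exists[OF assms]])
  then show "meetG s t \<in> G" "leG (meetG s t) s" "leG (meetG s t) t"
    "w \<in> G \<Longrightarrow> leG w s \<Longrightarrow> leG w t \<Longrightarrow> leG w (meetG s t)" by blast+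
qed

lemma leG_root:
  assumes "t \<in> G" shows "leG (p r) t"
proof -
  \<comment> \<open>The gap of the root ends at \<open>Z\<close>, so no position of \<open>G\<close>
    lies beyond \<open>p r\<close>.\<close>
  have "t \<le> p r" using G_gap[OF assms root_in] G_bounds[OF assms] b_root by fastforce
  then show ?thesis using leG_p_block[OF root_in] a_root G_bounds[OF assms] by simp
qed

sublocale GT: tree_semilattice G leG meetG "p r"
proof
  show "p r \<in> G" by (rule p_in_G[OF root_in])
  show "leG (p r) x" if "x \<in> G" for x using that by (rule leG_root)
  show "leG x x" for x by (rule leG_refl)
  show "x = y" if "leG x y" "leG y x" for x y using that by (rule leG_antisym)
  show "leG x z" if "leG x y" "leG y z" for x y z using that by (rule leG_trans)
  show "leG x y \<or> leG y x" if "leG x z" "leG y z" for x y z using that by (rule leG_linear)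
  fix x y assume xy: "x \<in> G" "y \<in> G"
  show "meetG x y \<in> G" "leG (meetG x y) x" "leG (meetG x y) y" using meetG_props[OF xy] by auto
  fix z assume "z \<in> G" "leG z x" "leG z y"
  then show "leG z (meetG x y)" using meetG_props(4)[OF xy] by simp
qed

lemma meetG_split: "split_at v s t \<Longrightarrow> s \<in> G \<Longrightarrow> t \<in> G \<Longrightarrow> meetG s t = p v"
  using split_at_glb[of v s t] p_in_G[of v] unfolding split_at_def by (intro GT.meet_eqI) simp_all

lemma meetG_cases:
  assumes "s \<in> G" "t \<in> G"
  obtains "leG t s" "meetG s t = t" | "leG s t" "meetG s t = s" | v where "split_at v s t" "meetG s t = p v"
proof -
  consider "leG t s" | "leG s t" | v where "split_at v s t" using split_exists[OF assms] by blast
  then show thesis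
  proof cases
    case 1
    then show ?thesis using that(1) GT.meet_absorb[of t s] GT.commute[of s t] assms by simp
  next
    case 2
    then show ?thesis using that(2) GT.meet_absorb[of s t] assms by simp
  next
    case 3
    then show ?thesis using that(3) meetG_split assms by simp
  qed
qed

section \<open>The embedding of \<open>V\<close> into the tree of positions\<close>

lemma leG_p_p:
  assumes "x \<in> V" "y \<in> V" shows "leG (p x) (p y) \<longleftrightarrow> le x y"
proof
  assume "le x y"
  then have "a x \<le> a y \<and> p y \<le> p x"
    using p_lt_order[of x y] p_less_b[of y] assms by (cases "x = y") (auto simp: lt_def)
  then show "leG (p x) (p y)" using leG_p_block[of x "p y"] a_le_p[of y] assms by simp
next
  assume *: "leG (p x) (p y)"
  show "le x y"
  proof (rule ccontr)
    assume n: "\<not> le x y"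
    define w where "w = meet x y"
    have w: "w \<in> V" "le w x" "le w y" using assms by (auto simp: w_def)
    then have lt: "lt w x" using n by (auto simp: lt_def)
    have "p x \<in> J w (S w x)"
      using p_in_J[OF assms(1) w(1)] S_in_U[OF assms(1) lt] component_mem[OF tree w(1) assms(1)] by simp
    then have "p y \<in> J w (S w x)" using * w S_in_U[OF assms(1) lt] unfolding leG_def by blast
    then have "y \<in> S w x" using p_in_J[OF assms(2) w(1)] S_in_U[OF assms(1) lt] by simp
    then show False using component_above[OF w(1) assms(1) lt] by (simp add: w_def)
  qed
qed

lemma meet_different_components:
  assumes "v \<in> V" "A \<in> U v" "B \<in> U v" "A \<noteq> B" "x \<in> A" "y \<in> B"
  shows "meet x y = v"
proof (rule ccontr)
  assume n: "meet x y \<noteq> v"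
  have x: "x \<in> V" "lt v x" "S v x = A" using U_memD[OF assms(1,2,5)] by auto
  have y: "y \<in> V" "lt v y" "S v y = B" using U_memD[OF assms(1,3,6)] by auto
  have "y \<in> S v x" using component_above[OF assms(1) x(1,2)] n y ltD by auto
  then show False using x U_disjoint[OF assms(1,2,3) _ assms(6)] assms(4) by simp
qed

lemma meetG_p:
  assumes "x \<in> V" "y \<in> V" shows "meetG (p x) (p y) = p (meet x y)"
proof (rule GT.meet_eqI)
  define w where "w = meet x y"
  have w: "w \<in> V" "le w x" "le w y" using assms by (auto simp: w_def)
  show "leG (p (meet x y)) (p x)" "leG (p (meet x y)) (p y)"
    using leG_p_p assms by auto
  fix u assume u: "u \<in> G" "leG u (p x)" "leG u (p y)"
  show "leG u (p (meet x y))"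
  proof (cases "le x y \<or> le y x")
    case True
    then have "meet x y = x \<or> meet x y = y" using assms meet_comm unfolding le_meet by metis
    then show ?thesis using u by auto
  next
    case False
    then have lt: "lt w x" "lt w y" using w by (auto simp: lt_def)
    have "y \<notin> S w x" using component_above[OF w(1) assms(1) lt(1)] by (simp add: w_def)
    then have ne: "S w x \<noteq> S w y" using component_mem[OF tree w(1) assms(2)] by auto
    have "split_at w (p x) (p y)"
      unfolding split_at_def using ne w
        p_in_J[OF assms(1) w(1) S_in_U[OF assms(1) lt(1)]] component_mem[OF tree w(1) assms(1)]
        p_in_J[OF assms(2) w(1) S_in_U[OF assms(2) lt(2)]] component_mem[OF tree w(1) assms(2)]
        S_in_U[OF assms(1) lt(1)] S_in_U[OF assms(2) lt(2)] by blast
    then show ?thesis using split_at_glb(3) u by (simp add: w_def)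
  qed
qed (use assms p_in_G in auto)

lemma p_embedding: "tree_embedding V c G GT.median p"
  unfolding tree_embedding_def tree_hom_def
proof (intro conjI ballI)
  show "p ` V \<subseteq> G" using p_in_G by auto
  show "inj_on p V" using p_inj by (auto intro: inj_onI)
  fix x y z assume V: "x \<in> V" "y \<in> V" "z \<in> V"
  have "p u = p w \<longleftrightarrow> u = w" if "u \<in> V" "w \<in> V" for u w using p_inj that by auto
  then show "p (c x y z) = GT.median (p x) (p y) (p z)"
    using V by (simp add: c_meet GT.median_def meetG_p)
qed

section \<open>Components and branch points of the tree of positions\<close>

lemma GT_component_p_above:
  assumes x: "x \<in> V" "A \<in> U x" and y: "y \<in> G" "y \<in> J x A"
  shows "tree_component G GT.median (p x) y = G \<inter> J x A"
proof -
  interpret R: rooted_tree G GT.median "p r" by (rule GT.rooted)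
  note yx = J_sub[OF x y(2)]
  have "leG (p x) y" using leG_p_block x yx by simp
  then have lt: "R.lt (p x) y" unfolding R.lt_def using GT.rooted_le[OF p_in_G[OF x(1)] y(1)] yx by auto
  have iff: "z \<in> G \<inter> J x A \<longleftrightarrow> leG (p x) z \<and> meetG y z \<noteq> p x" if z: "z \<in> G" for z
  proof
    assume zJ: "z \<in> G \<inter> J x A"
    note zx = J_sub[OF x IntD2[OF zJ]]
    have "meetG y z \<noteq> p x"
    proof (rule meetG_cases[OF y(1) z])
      fix v assume v: "split_at v y z" "meetG y z = p v"
      have "v \<noteq> x"
        using v(1) J_unique[OF x(1) x(2) _ y(2)] J_unique[OF x(1) x(2) _ IntD2[OF zJ]]
        unfolding split_at_def by blast
      then show ?thesis using v p_inj x by (auto simp: split_at_def)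
    qed (use zx yx in auto)
    then show "leG (p x) z \<and> meetG y z \<noteq> p x" using leG_p_block x zx by simp
  next
    assume *: "leG (p x) z \<and> meetG y z \<noteq> p x"
    have "z \<noteq> p x" using * \<open>leG (p x) y\<close> GT.meet_absorb[of "p x" y] GT.commute[of "p x" y] p_in_G[OF x(1)] y by auto
    then have "a x \<le> z" "z < p x" using * leG_p_iff[OF x(1) z] by auto
    then obtain B where B: "B \<in> U x" "z \<in> J x B" using cell_exists[OF x(1)] unfolding J_mem by metis
    have "A = B"
    proof (rule ccontr)
      assume "A \<noteq> B"
      then have "split_at x y z" using B x y unfolding split_at_def by blast
      then show False using meetG_split[of x y z] * y z by simp
    qed
    then show "z \<in> G \<inter> J x A" using B z by simp
  qed
  have "tree_component G GT.median (p x) y = {z \<in> G. R.le (p x) z \<and> R.meet y z \<noteq> p x}"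
    by (rule R.component_above[OF p_in_G[OF x(1)] y(1) lt])
  also have "\<dots> = {z \<in> G. leG (p x) z \<and> meetG y z \<noteq> p x}"
    by (rule Collect_cong) (simp add: GT.rooted_le[OF p_in_G[OF x(1)]] GT.rooted_meet[OF y(1)] cong: conj_cong)
  also have "\<dots> = {z \<in> G. z \<in> G \<inter> J x A}" by (rule Collect_cong) (simp only: iff cong: conj_cong)
  also have "\<dots> = G \<inter> J x A" by auto
  finally show ?thesis .
qed

lemma GT_component_not_above:
  assumes "s \<in> G" "t \<in> G" "\<not> leG s t"
  shows "tree_component G GT.median s t = {z \<in> G. \<not> leG s z}"
proof -
  interpret R: rooted_tree G GT.median "p r" by (rule GT.rooted)
  have "\<not> R.le s t" using GT.rooted_le[OF assms(1,2)] assms(3) by simp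
  then have "tree_component G GT.median s t = {z \<in> G. \<not> R.le s z}"
    by (rule R.component_not_above[OF assms(1,2)])
  also have "\<dots> = {z \<in> G. \<not> leG s z}"
    by (rule Collect_cong) (simp add: GT.rooted_le[OF assms(1)] cong: conj_cong)
  finally show ?thesis .
qed

text \<open>Meets of incomparable positions have the form \<open>p v\<close>. Off \<open>V\<close>
  there is hence no branching, and everything strictly above \<open>s\<close> is one
  component.\<close>

lemma GT_component_above_other:
  assumes "s \<in> G" "t \<in> G" "leG s t" "s \<noteq> t" "s \<notin> p ` V"
  shows "tree_component G GT.median s t = {z \<in> G. leG s z \<and> z \<noteq> s}"
proof -
  interpret R: rooted_tree G GT.median "p r" by (rule GT.rooted)
  have "R.lt s t" using assms(3,4) GT.rooted_le[OF assms(1,2)] unfolding R.lt_def by simp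
  then have "tree_component G GT.median s t = {z \<in> G. R.le s z \<and> R.meet t z \<noteq> s}"
    by (rule R.component_above[OF assms(1,2)])
  also have "\<dots> = {z \<in> G. leG s z \<and> meetG t z \<noteq> s}"
    by (rule Collect_cong) (simp add: GT.rooted_le[OF assms(1)] GT.rooted_meet[OF assms(2)] cong: conj_cong)
  finally have 1: "tree_component G GT.median s t = {z \<in> G. leG s z \<and> meetG t z \<noteq> s}" .
  have iff: "leG s z \<and> meetG t z \<noteq> s \<longleftrightarrow> leG s z \<and> z \<noteq> s" if z: "z \<in> G" for z
  proof -
    have "meetG t s = s" using GT.meet_absorb[of s t] GT.commute[of s t] assms by simp
    moreover have "meetG t z \<noteq> s" if "z \<noteq> s"
      by (rule meetG_cases[OF assms(2) z]) (use that assms(4,5) in \<open>auto simp: split_at_def\<close>)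
    ultimately show ?thesis by auto
  qed
  show ?thesis unfolding 1 by (rule Collect_cong) (simp only: iff cong: conj_cong)
qed

lemma GT_component_cases:
  assumes "s \<in> G" "t \<in> G" "s \<noteq> t"
  obtains "tree_component G GT.median s t = {z \<in> G. \<not> leG s z}"
  | "tree_component G GT.median s t = {z \<in> G. leG s z \<and> z \<noteq> s}"
  | x A where "x \<in> V" "A \<in> U x" "tree_component G GT.median s t = G \<inter> J x A"
proof -
  consider "\<not> leG s t" | "leG s t" "s \<notin> p ` V" | x where "leG s t" "s = p x" "x \<in> V" by blast
  then show thesis
  proof cases
    case 1 then show ?thesis using that(1) GT_component_not_above assms by blast
  next
    case 2 then show ?thesis using that(2) GT_component_above_other assms by blast
  next
    case (3 x)
    then have "a x \<le> t" "t < p x" using leG_p_iff[of x t] assms by auto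
    then obtain A where A: "A \<in> U x" "t \<in> J x A" using cell_exists[OF 3(3)] unfolding J_mem by metis
    then show ?thesis using that(3)[OF 3(3) A(1)] GT_component_p_above[OF 3(3) A(1) assms(2) A(2)] 3 by simp
  qed
qed

lemma GT_branch_points: "branch_points G GT.median = p ` branch_points V c"
proof
  show "p ` branch_points V c \<subseteq> branch_points G GT.median"
  proof
    fix u assume "u \<in> p ` branch_points V c"
    then obtain w x y z where u: "u = p w" "w \<in> V" "x \<in> V - {w}" "y \<in> V - {w}" "z \<in> V - {w}" "c x y z = w"
      by (auto simp: branch_points_def)
    then have "GT.median (p x) (p y) (p z) = u"
      using p_embedding by (auto simp: tree_embedding_def tree_hom_def)
    moreover have "p x \<in> G - {u}" "p y \<in> G - {u}" "p z \<in> G - {u}" using u p_inj p_in_G by auto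
    moreover have "u \<in> G" using u p_in_G by simp
    ultimately show "u \<in> branch_points G GT.median"
      unfolding branch_points_def by (intro CollectI conjI bexI[of _ "p x"] bexI[of _ "p y"] bexI[of _ "p z"])
  qed
  show "branch_points G GT.median \<subseteq> p ` branch_points V c"
  proof
    fix u assume "u \<in> branch_points G GT.median"
    then obtain s0 t0 q0 where *: "s0 \<in> G - {u}" "t0 \<in> G - {u}" "q0 \<in> G - {u}" "GT.median s0 t0 q0 = u"
      unfolding branch_points_def by (elim CollectE conjE bexE)
    \<comment> \<open>The median is one of the three pairwise meets; by symmetry it may be taken to
      be that of the first two.\<close>
    have "\<exists>s t q. s \<in> G \<and> t \<in> G \<and> q \<in> G \<and> s \<noteq> u \<and> t \<noteq> u \<and> q \<noteq> u \<and> GT.median s t q = u \<and> meetG s t = u"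
    proof -
      consider "meetG s0 t0 = u" | "meetG s0 q0 = u" | "meetG t0 q0 = u"
        using *(4) by (auto simp: GT.median_def split: if_splits)
      then show ?thesis
      proof cases
        case 1 then show ?thesis using * by (intro exI[of _ s0] exI[of _ t0] exI[of _ q0]) auto
      next
        case 2 then show ?thesis using * GT.median_perm(2)[of s0 t0 q0]
          by (intro exI[of _ s0] exI[of _ q0] exI[of _ t0]) auto
      next
        case 3 then show ?thesis using * GT.median_perm(1)[of s0 t0 q0] GT.median_perm(2)[of t0 s0 q0]
          by (intro exI[of _ t0] exI[of _ q0] exI[of _ s0]) auto
      qed
    qed
    then obtain s t q where st: "s \<in> G" "t \<in> G" "q \<in> G" "s \<noteq> u" "t \<noteq> u" "q \<noteq> u"
      and med: "GT.median s t q = u" and mst: "meetG s t = u" by (elim exE conjE)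
    obtain v where v: "split_at v s t" "u = p v"
      by (rule meetG_cases[OF st(1,2)]) (use mst st in auto)
    then obtain A B where vV: "v \<in> V" and AB: "A \<in> U v" "B \<in> U v" "A \<noteq> B" "s \<in> J v A" "t \<in> J v B"
      unfolding split_at_def by blast
    obtain x where x: "x \<in> A" by (rule U_nonempty[OF vV AB(1)])
    obtain y where y: "y \<in> B" by (rule U_nonempty[OF vV AB(2)])
    note xy = x y
    have xV: "x \<in> V" "x \<noteq> v" and yV: "y \<in> V" "y \<noteq> v"
      using U_memD[OF vV AB(1) xy(1)] U_memD[OF vV AB(2) xy(2)] by (auto simp: lt_def)
    have mxy: "meet x y = v" using meet_different_components[OF vV AB(1,2,3) xy] .
    have "v \<in> branch_points V c"
    \<comment> \<open>If the third position is above \<open>u\<close>, its interval at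
      \<open>v\<close> differs from those of \<open>s\<close> and \<open>t\<close>, and points of
      \<open>V\<close> chosen from the three components have median \<open>v\<close>. Otherwise the
      root serves as the third direction.\<close>
    proof (cases "leG u q")
      case True
      then have "a v \<le> q" "q < p v" using leG_p_iff[OF vV st(3)] v st by auto
      then obtain C where C: "C \<in> U v" "q \<in> J v C" using cell_exists[OF vV] unfolding J_mem by metis
      have qs: "meetG s q \<noteq> u" if "C = A"
      proof -
        interpret R: rooted_tree G GT.median "p r" by (rule GT.rooted)
        have "q \<in> tree_component G GT.median u s"
          using GT_component_p_above[OF vV AB(1) st(1) AB(4)] C that v st by simp
        moreover have "R.lt u s" using R.lt_def GT.rooted_le[of u s] split_at_glb(1)[OF v(1)] v st p_in_G[OF vV] by simp
        ultimately show ?thesis using R.component_above[of u s] GT.rooted_meet[of s q] st v p_in_G[OF vV] by simp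
      qed
      have qt: "meetG t q \<noteq> u" if "C = B"
      proof -
        interpret R: rooted_tree G GT.median "p r" by (rule GT.rooted)
        have "q \<in> tree_component G GT.median u t"
          using GT_component_p_above[OF vV AB(2) st(2) AB(5)] C that v st by simp
        moreover have "R.lt u t" using R.lt_def GT.rooted_le[of u t] split_at_glb(2)[OF v(1)] v st p_in_G[OF vV] by simp
        ultimately show ?thesis using R.component_above[of u t] GT.rooted_meet[of t q] st v p_in_G[OF vV] by simp
      qed
      have "C \<noteq> A"
      proof
        assume CA: "C = A"
        then have "split_at v q t" using C AB vV unfolding split_at_def by blast
        then have "meetG t q = u" using meetG_split[of v t q] split_at_sym st v by simp
        then show False using med mst qs[OF CA] by (auto simp: GT.median_def split: if_splits)
      qed
      moreover have "C \<noteq> B"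
      proof
        assume CB: "C = B"
        then have "split_at v s q" using C AB vV unfolding split_at_def by blast
        then have "meetG s q = u" using meetG_split[of v s q] st v by simp
        then show False using med mst qt[OF CB] by (auto simp: GT.median_def split: if_splits)
      qed
      moreover obtain z where z: "z \<in> C" by (rule U_nonempty[OF vV C(1)])
      ultimately have "meet x z = v" "meet y z = v"
        using meet_different_components[OF vV AB(1) C(1) _ xy(1) z]
          meet_different_components[OF vV AB(2) C(1) _ xy(2) z] by auto
      moreover have "z \<in> V" "z \<noteq> v" using U_memD[OF vV C(1) z] by (auto simp: lt_def)
      ultimately have "c x y z = v" using c_meet[of x y z] xV yV mxy by simp
      then show ?thesis unfolding branch_points_def using vV xV yV \<open>z \<in> V\<close> \<open>z \<noteq> v\<close>
        by (intro CollectI conjI bexI[of _ x] bexI[of _ y] bexI[of _ z]) auto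
    next
      case False
      then have "v \<noteq> r" using leG_root st v by auto
      moreover have "c r x y = v" using mxy by (simp add: meet_def)
      ultimately show ?thesis unfolding branch_points_def using vV xV yV root_in
        by (intro CollectI conjI bexI[of _ r] bexI[of _ x] bexI[of _ y]) auto
    qed
    then show "u \<in> p ` branch_points V c" using v by simp
  qed
qed

end

section \<open>Transport and separability\<close>

text \<open>Positions are reals, but the realization has to contain \<open>V\<close> under
  \<open>Inl\<close>; the tree structure is therefore carried along an injection.\<close>

locale transported_tree =
  fixes G :: "'b set" and cG :: "'b \<Rightarrow> 'b \<Rightarrow> 'b \<Rightarrow> 'b" and g :: "'b \<Rightarrow> 'a"
  assumes tree: "algebraic_tree G cG" and inj: "inj_on g G"
begin

abbreviation q :: "'a \<Rightarrow> 'b" where "q \<equiv> inv_into G g"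

definition cT :: "'a \<Rightarrow> 'a \<Rightarrow> 'a \<Rightarrow> 'a" where "cT x y z = g (cG (q x) (q y) (q z))"

lemma q_g [simp]: "s \<in> G \<Longrightarrow> q (g s) = s"
  by (rule inv_into_f_f[OF inj])

lemma cG_in: "s \<in> G \<Longrightarrow> t \<in> G \<Longrightarrow> u \<in> G \<Longrightarrow> cG s t u \<in> G"
  using tree unfolding algebraic_tree_def by simp

lemma cT_g: "s \<in> G \<Longrightarrow> t \<in> G \<Longrightarrow> u \<in> G \<Longrightarrow> cT (g s) (g t) (g u) = g (cG s t u)"
  by (simp add: cT_def)

lemma g_eq: "s \<in> G \<Longrightarrow> t \<in> G \<Longrightarrow> g s = g t \<longleftrightarrow> s = t"
  using inj by (simp add: inj_on_eq_iff)

lemma algebraic_tree_cT: "algebraic_tree (g ` G) cT"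
  using tree unfolding algebraic_tree_def
  by (simp add: cT_g g_eq cG_in ball_simps)

lemma component_cT:
  assumes "s \<in> G" "t \<in> G"
  shows "tree_component (g ` G) cT (g s) (g t) = g ` tree_component G cG s t"
  using assms by (auto simp: tree_component_def cT_g g_eq cG_in)

lemma interval_cT:
  assumes "s \<in> G" "t \<in> G"
  shows "tree_interval (g ` G) cT (g s) (g t) = g ` tree_interval G cG s t"
  using assms by (auto simp: tree_interval_def cT_g g_eq cG_in)

lemma branch_points_cT: "branch_points (g ` G) cT = g ` branch_points G cG"
proof (intro equalityI subsetI)
  fix z assume "z \<in> branch_points (g ` G) cT"
  then obtain u x v w where "u \<in> G" "x \<in> G" "v \<in> G" "w \<in> G" "g x \<noteq> g u" "g v \<noteq> g u" "g w \<noteq> g u"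
    and z: "z = g u" "cT (g x) (g v) (g w) = g u"
    unfolding branch_points_def by auto
  then have "u \<in> branch_points G cG"
    unfolding branch_points_def by (intro CollectI conjI bexI[of _ x] bexI[of _ v] bexI[of _ w]) (auto simp: cT_g g_eq cG_in)
  then show "z \<in> g ` branch_points G cG" using z by simp
next
  fix z assume "z \<in> g ` branch_points G cG"
  then obtain u x v w where u: "u \<in> G" "x \<in> G" "v \<in> G" "w \<in> G" "x \<noteq> u" "v \<noteq> u" "w \<noteq> u"
    and z: "z = g u" "cG x v w = u"
    unfolding branch_points_def by auto
  then show "z \<in> branch_points (g ` G) cT"
    unfolding branch_points_def
    by (intro CollectI conjI bexI[of _ "g x"] bexI[of _ "g v"] bexI[of _ "g w"]) (auto simp: cT_g g_eq cG_in)
qed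

lemma embedding_cT: "tree_embedding G cG (g ` G) cT g"
  unfolding tree_embedding_def tree_hom_def using inj by (auto simp: cT_g)

lemma separable_cT:
  assumes "D \<subseteq> G" "\<And>x y. x \<in> G \<Longrightarrow> y \<in> G \<Longrightarrow> x \<noteq> y \<Longrightarrow> \<exists>d\<in>D. d \<in> tree_interval G cG x y \<and> d \<noteq> y"
    and "x \<in> g ` G" "y \<in> g ` G" "x \<noteq> y"
  shows "\<exists>d\<in>g ` D. d \<in> tree_interval (g ` G) cT x y \<and> d \<noteq> y"
proof -
  obtain s t where st: "s \<in> G" "t \<in> G" "x = g s" "y = g t" "s \<noteq> t" using assms by auto
  then obtain d where d: "d \<in> D" "d \<in> tree_interval G cG s t" "d \<noteq> t" using assms(2)[of s t] by auto
  then have "g d \<noteq> g t" using g_eq[of d t] assms(1) st by auto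
  then show ?thesis using d st interval_cT[of s t] by auto
qed

end

lemma tree_embedding_comp:
  assumes f: "tree_embedding A a B b f" and g: "tree_embedding B b C c g"
  shows "tree_embedding A a C c (g \<circ> f)"
proof -
  have fB: "f ` A \<subseteq> B" and gC: "g ` B \<subseteq> C" using f g by (auto simp: tree_embedding_def tree_hom_def)
  have "inj_on (g \<circ> f) A" 
    using f g fB by (intro comp_inj_on) (auto simp: tree_embedding_def intro: inj_on_subset)
  moreover have "(g \<circ> f) (a x y z) = c ((g \<circ> f) x) ((g \<circ> f) y) ((g \<circ> f) z)" if "x \<in> A" "y \<in> A" "z \<in> A" for x y z
  proof -
    have "f (a x y z) = b (f x) (f y) (f z)" using f that by (simp add: tree_embedding_def tree_hom_def)
    moreover have "g (b (f x) (f y) (f z)) = c (g (f x)) (g (f y)) (g (f z))"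
    proof -
      have "f x \<in> B" "f y \<in> B" "f z \<in> B" using fB that by auto
      then show ?thesis using g by (simp add: tree_embedding_def tree_hom_def)
    qed
    ultimately show ?thesis by simp
  qed
  moreover have "(g \<circ> f) ` A \<subseteq> C"
    unfolding image_comp[symmetric] by (rule order_trans[OF image_mono[OF fB] gC])
  ultimately show ?thesis by (simp add: tree_embedding_def tree_hom_def)
qed

section \<open>Countable order-dense sets of positions\<close>

lemma countable_right_isolated:
  fixes G :: "real set"
  shows "countable {s \<in> G. \<exists>t>s. \<forall>z\<in>G. \<not> (s < z \<and> z < t)}" (is "countable ?R")
proof -
  \<comment> \<open>Choose a rational in the empty interval to the right of each isolated point;
    distinct points get distinct rationals.\<close>
  have step: "\<exists>q. q \<in> \<rat> \<and> s < q \<and> (\<forall>z\<in>G. s < z \<longrightarrow> q < z)" if s: "s \<in> ?R" for s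
  proof -
    obtain t where t: "t > s" "\<forall>z\<in>G. \<not> (s < z \<and> z < t)" using s by blast
    obtain q where "q \<in> \<rat>" "s < q" "q < t" using Rats_dense_in_real[OF t(1)] by auto
    then show ?thesis using t by (intro exI[of _ q]) force
  qed
  have "\<exists>f. \<forall>s\<in>?R. f s \<in> \<rat> \<and> s < f s \<and> (\<forall>z\<in>G. s < z \<longrightarrow> f s < z)"
    by (rule bchoice, rule ballI) (rule step)
  then obtain f where f: "\<forall>s\<in>?R. f s \<in> \<rat> \<and> s < f s \<and> (\<forall>z\<in>G. s < z \<longrightarrow> f s < z)" ..
  have mono: "f s < f s'" if "s \<in> ?R" "s' \<in> ?R" "s < s'" for s s'
  proof -
    have "s' \<in> G" using that by simp
    then have "f s < s'" "s' < f s'" using f[rule_format, OF that(1)] f[rule_format, OF that(2)] that(3) by auto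
    then show ?thesis by simp
  qed
  have "inj_on f ?R"
  proof (rule inj_onI)
    fix s s' assume "s \<in> ?R" "s' \<in> ?R" "f s = f s'"
    then show "s = s'" using mono[of s s'] mono[of s' s] by (cases s s' rule: linorder_cases) auto
  qed
  moreover have "countable (f ` ?R)" by (rule countable_subset[OF _ countable_rat]) (use f in blast)
  ultimately show ?thesis by (rule countable_image_inj_on[rotated])
qed

text \<open>Windows with rational ends give a countable set that meets every open interval meeting
  \<open>G\<close>. For the half-open intervals, the countably many points isolated on one side are
  added; those isolated on the left are found by reflecting the line.\<close>

lemma half_open_dense:
  fixes G :: "real set"
  obtains D where "D \<subseteq> G" "countable D" "\<And>s t. s \<in> G \<Longrightarrow> s < t \<Longrightarrow> \<exists>d\<in>D. s \<le> d \<and> d < t"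
    "\<And>s t. t \<in> G \<Longrightarrow> s < t \<Longrightarrow> \<exists>d\<in>D. s < d \<and> d \<le> t"
proof -
  define R where "R = {s \<in> G. \<exists>t>s. \<forall>z\<in>G. \<not> (s < z \<and> z < t)}"
  define R' where "R' = {s \<in> uminus ` G. \<exists>t>s. \<forall>z\<in>uminus ` G. \<not> (s < z \<and> z < t)}"
  define e where "e = (\<lambda>(u::real,v). SOME z. z \<in> G \<and> u < z \<and> z < v)"
  define D0 where "D0 = e ` {(u,v). u \<in> \<rat> \<and> v \<in> \<rat> \<and> (\<exists>z\<in>G. u < z \<and> z < v)}"
  have eG: "e (u,v) \<in> G \<and> u < e (u,v) \<and> e (u,v) < v" if "\<exists>z\<in>G. u < z \<and> z < v" for u v
  proof -
    have "\<exists>z. z \<in> G \<and> u < z \<and> z < v" using that by blast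
    from someI_ex[OF this] show ?thesis by (simp add: e_def)
  qed
  have D0: "\<exists>d\<in>D0. s < d \<and> d < t" if z: "z \<in> G" "s < z" "z < t" for s z t
  proof -
    obtain u where u: "u \<in> \<rat>" "s < u" "u < z" using Rats_dense_in_real[OF z(2)] by auto
    obtain v where v: "v \<in> \<rat>" "z < v" "v < t" using Rats_dense_in_real[OF z(3)] by auto
    have "e (u,v) \<in> D0" unfolding D0_def using u v z by (intro imageI) auto
    moreover have "u < e (u,v) \<and> e (u,v) < v" using eG[of u v] u v z by blast
    ultimately show ?thesis using u v by (intro bexI[of _ "e (u,v)"]) auto
  qed
  have cD0: "countable D0" unfolding D0_def
    by (intro countable_image countable_subset[OF _ countable_SIGMA[OF countable_rat countable_rat]]) auto
  have cR: "countable R" unfolding R_def by (rule countable_right_isolated)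
  have cR': "countable (uminus ` R')" unfolding R'_def by (intro countable_image countable_right_isolated)
  show thesis
  proof (rule that[of "D0 \<union> R \<union> uminus ` R'"])
    show "D0 \<union> R \<union> uminus ` R' \<subseteq> G" using eG by (auto simp: D0_def R_def R'_def)
    show "countable (D0 \<union> R \<union> uminus ` R')" using cD0 cR cR' by simp
    show "\<exists>d\<in>D0 \<union> R \<union> uminus ` R'. s \<le> d \<and> d < t" if st: "s \<in> G" "s < t" for s t
    proof (cases "s \<in> R")
      case False
      then obtain z where "z \<in> G" "s < z" "z < t" using st unfolding R_def by blast
      from D0[OF this] show ?thesis by (meson UnI1 less_imp_le)
    qed (use st in auto)
    show "\<exists>d\<in>D0 \<union> R \<union> uminus ` R'. s < d \<and> d \<le> t" if "t \<in> G" "s < t" for s t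
    proof (cases "- t \<in> R'")
      case True
      then show ?thesis using that by (intro bexI[of _ t]) (auto intro!: image_eqI[of t uminus "- t"])
    next
      case False
      have "\<exists>z\<in>uminus ` G. - t < z \<and> z < - s"
      proof (rule ccontr)
        assume "\<not> ?thesis"
        then have "- t \<in> R'" using that unfolding R'_def by (intro CollectI conjI exI[of _ "- s"]) auto
        then show False using False by simp
      qed
      then obtain z where "z \<in> G" "s < z" "z < t" by force
      from D0[OF this] show ?thesis by (meson UnI1 less_imp_le)
    qed
  qed
qed

context weighted_tree begin

lemma leG_convex:
  assumes "leG t w" "w \<le> z" "z \<le> t" shows "leG t z"
  unfolding leG_def
proof (intro conjI ballI impI)
  fix v A assume v: "v \<in> V" "A \<in> U v" "t \<in> J v A"
  then have "w \<in> J v A" using assms unfolding leG_def by auto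
  then show "z \<in> J v A" using v assms by (auto simp: J_mem)
qed (rule assms)

lemma GT_interval:
  assumes "t \<in> G" "w \<in> G" "leG t w"
  shows "tree_interval G GT.median t w = {z \<in> G. leG t z \<and> leG z w}"
    and "tree_interval G GT.median w t = {z \<in> G. leG t z \<and> leG z w}"
proof -
  interpret R: rooted_tree G GT.median "p r" by (rule GT.rooted)
  have le: "R.le t w" using GT.rooted_le[OF assms(1,2)] assms(3) by simp
  have eq: "{z \<in> G. R.le t z \<and> R.le z w} = {z \<in> G. leG t z \<and> leG z w}"
    by (rule Collect_cong) (simp add: GT.rooted_le[OF assms(1)] GT.rooted_le[OF _ assms(2)] cong: conj_cong)
  show "tree_interval G GT.median t w = {z \<in> G. leG t z \<and> leG z w}"
    "tree_interval G GT.median w t = {z \<in> G. leG t z \<and> leG z w}"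
    using R.interval_le[OF assms(1,2) le] eq by simp_all
qed

lemma GT_separable:
  obtains D where "D \<subseteq> G" "countable D"
    "\<And>x y. x \<in> G \<Longrightarrow> y \<in> G \<Longrightarrow> x \<noteq> y \<Longrightarrow> \<exists>d\<in>D. d \<in> tree_interval G GT.median x y \<and> d \<noteq> y"
proof -
  obtain D0 where D0: "D0 \<subseteq> G" "countable D0" "\<And>s t. s \<in> G \<Longrightarrow> s < t \<Longrightarrow> \<exists>d\<in>D0. s \<le> d \<and> d < t"
    "\<And>s t. t \<in> G \<Longrightarrow> s < t \<Longrightarrow> \<exists>d\<in>D0. s < d \<and> d \<le> t"
    by (rule half_open_dense[of G]) blast
  \<comment> \<open>A position \<open>z\<close> between \<open>w\<close> and its ancestor
    \<open>t\<close> need not be an ancestor of \<open>w\<close>. If it is not, the point of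
    \<open>V\<close> where it branches off is one, and it is not below \<open>t\<close> in the
    tree.\<close>
  have between: "leG z w \<or> (\<exists>v\<in>V. split_at v w z \<and> leG t (p v) \<and> leG (p v) w \<and> w < p v)"
    if tw: "w \<in> G" "z \<in> G" "leG t w" "w \<le> z" "z \<le> t" for t w z
  proof (cases "leG z w")
    case False
    then have "w < z" using tw leG_refl by (cases "w = z") auto
    then obtain v where v: "split_at v w z" using split_exists_less[OF tw(1)] False by blast
    then have "v \<in> V" by (simp add: split_at_def)
    moreover have "leG t (p v)" using split_at_glb(3)[OF v tw(3)] leG_convex[OF tw(3-5)] by simp
    moreover have "w < p v" using v J_sub unfolding split_at_def by blast
    ultimately show ?thesis using v split_at_glb(1)[OF v] by blast
  qed simp
  have C: "\<exists>d\<in>p ` V \<union> D0. d \<in> G \<and> leG t d \<and> leG d w \<and> d \<noteq> w"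
    if tw: "t \<in> G" "w \<in> G" "t \<noteq> w" "leG t w" for t w
  proof -
    have lt: "w < t" using tw by (auto simp: leG_def)
    obtain z where z: "z \<in> D0" "w < z" "z \<le> t" using D0(4)[OF tw(1) lt] by blast
    then have zG: "z \<in> G" using D0 by blast
    have tz: "leG t z" using leG_convex[OF tw(4)] z by simp
    show ?thesis
    proof (cases "leG z w")
      case True
      then show ?thesis using z zG tz by (intro bexI[of _ z]) auto
    next
      case False
      then obtain v where "v \<in> V" "leG t (p v)" "leG (p v) w" "w < p v"
        using between[OF tw(2) zG tw(4)] z by auto
      then show ?thesis using p_in_G by (intro bexI[of _ "p v"]) auto
    qed
  qed
  have B: "\<exists>d\<in>p ` V \<union> D0. d \<in> G \<and> leG t d \<and> leG d w \<and> d \<noteq> t"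
    if tw: "t \<in> G" "w \<in> G" "t \<noteq> w" "leG t w" for t w
  proof -
    have lt: "w < t" using tw by (auto simp: leG_def)
    obtain z where z: "z \<in> D0" "w \<le> z" "z < t" using D0(3)[OF tw(2) lt] by blast
    then have zG: "z \<in> G" using D0 by blast
    have tz: "leG t z" using leG_convex[OF tw(4)] z by simp
    show ?thesis
    proof (cases "leG z w")
      case True
      then show ?thesis using z zG tz by (intro bexI[of _ z]) auto
    next
      case False
      then obtain v where v: "v \<in> V" "split_at v w z" "leG t (p v)" "leG (p v) w" "w < p v"
        using between[OF tw(2) zG tw(4)] z by auto
      show ?thesis
      proof (cases "p v = t")
        case False
        then show ?thesis using v p_in_G by (intro bexI[of _ "p v"]) auto
      next
        case True
        \<comment> \<open>The branching point is \<open>t\<close> itself, which is excluded. The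
          search restarts with a position \<open>z'\<close> in the interval at \<open>v\<close> that
          contains \<open>w\<close>; a further branching point cannot be \<open>v\<close> again,
          since \<open>w\<close> and \<open>z'\<close> share that interval.\<close>
        obtain A where A: "A \<in> U v" "w \<in> J v A" using v(2) unfolding split_at_def by blast
        then have wh: "w < hi v A" by (simp add: J_mem)
        obtain z' where z': "z' \<in> D0" "w \<le> z'" "z' < hi v A" using D0(3)[OF tw(2) wh] by blast
        then have z'J: "z' \<in> J v A" using A by (auto simp: J_mem)
        then have z't: "z' < t" using J_sub[OF v(1) A(1)] True by auto
        have z'G: "z' \<in> G" using z' D0 by blast
        have tz': "leG t z'" using leG_convex[OF tw(4)] z' z't by simp
        show ?thesis
        proof (cases "leG z' w")
          case True
          then show ?thesis using z' z'G z't tz' by (intro bexI[of _ z']) auto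
        next
          case False
          then obtain u where u: "u \<in> V" "split_at u w z'" "leG t (p u)" "leG (p u) w" "w < p u"
            using between[OF tw(2) z'G tw(4)] z' z't by auto
          have "u \<noteq> v"
          proof
            assume "u = v"
            then obtain B C where "B \<in> U v" "C \<in> U v" "B \<noteq> C" "w \<in> J v B" "z' \<in> J v C"
              using u(2) unfolding split_at_def by blast
            then show False using J_unique[OF v(1) A(1) _ A(2)] J_unique[OF v(1) A(1) _ z'J] by metis
          qed
          then have "p u \<noteq> t" using p_inj[OF u(1) v(1)] True by auto
          then show ?thesis using u p_in_G by (intro bexI[of _ "p u"]) auto
        qed
      qed
    qed
  qed
  show thesis
  proof (rule that[of "p ` V \<union> D0"])
    show "p ` V \<union> D0 \<subseteq> G" using D0 p_in_G by auto
    show "countable (p ` V \<union> D0)" using D0 countable_V by simp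
    fix x y assume xy: "x \<in> G" "y \<in> G" "x \<noteq> y"
    consider "leG x y" | "leG y x" | v where "split_at v x y" using split_exists[OF xy(1,2)] by blast
    then show "\<exists>d\<in>p ` V \<union> D0. d \<in> tree_interval G GT.median x y \<and> d \<noteq> y"
    proof cases
      case 1
      show ?thesis using C[OF xy 1] unfolding GT_interval(1)[OF xy(1,2) 1] by blast
    next
      case 2
      show ?thesis using B[OF xy(2,1) _ 2] xy(3) unfolding GT_interval(2)[OF xy(2,1) 2] by blast
    next
      case (3 v)
      interpret R: rooted_tree G GT.median "p r" by (rule GT.rooted)
      have v: "v \<in> V" "y < p v" using 3 J_sub unfolding split_at_def by blast+
      have "R.meet x y = p v" using GT.rooted_meet[OF xy(1,2)] meetG_split[OF 3 xy(1,2)] by simp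
      then have "p v \<in> tree_interval G GT.median x y" using R.meet_in_interval[OF xy(1,2)] by simp
      then show ?thesis using v by (intro bexI[of _ "p v"]) auto
    qed
  qed
qed

end

section \<open>The measure\<close>

context weighted_tree begin

lemma Z_pos: "0 < Z"
  using m_pos[OF root_in] m_root by simp

lemma countable_U: "countable (U x)"
  unfolding U_def by (intro countable_image countable_subset[OF _ countable_V]) auto

lemma countable_anc: "countable (anc x)"
  unfolding anc_def by (rule countable_subset[OF _ countable_V]) auto

definition lam :: "real measure" where "lam = density lborel (indicator {0..<Z})"

lemma sets_lam [simp, measurable_cong]: "sets lam = sets borel"
  by (simp add: lam_def)

lemma space_lam [simp]: "space lam = UNIV"
  by (simp add: lam_def)

lemma emeasure_lam: "E \<in> sets borel \<Longrightarrow> emeasure lam E = emeasure lborel ({0..<Z} \<inter> E)"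
  unfolding lam_def by (subst emeasure_density) (auto simp: indicator_inter_arith[symmetric])

lemma finite_lam: "finite_measure lam"
proof
  show "emeasure lam (space lam) \<noteq> \<infinity>"
    using Z_pos by (simp add: emeasure_lam)
qed

sublocale lam: finite_measure lam by (rule finite_lam)

lemma lam_interval: "0 \<le> u \<Longrightarrow> u \<le> v \<Longrightarrow> v \<le> Z \<Longrightarrow> measure lam {u..<v} = v - u"
proof -
  assume *: "0 \<le> u" "u \<le> v" "v \<le> Z"
  have "{0..<Z} \<inter> {u..<v} = {u..<v}" using * by auto
  then show ?thesis using * by (simp add: measure_def emeasure_lam)
qed

lemma lam_UNIV: "measure lam UNIV = Z"
  using Z_pos by (simp add: measure_def emeasure_lam)

lemma lam_sing: "measure lam {t} = 0"
proof -
  have "emeasure lborel ({0..<Z} \<inter> {t}) \<le> emeasure lborel {t}" by (intro emeasure_mono) auto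
  then show ?thesis by (simp add: measure_def emeasure_lam)
qed

text \<open>The left parts of the blocks of the ancestors. Their lengths are the summands of
  \<open>a x\<close>, so up to a null set they fill everything to the left of
  \<open>a x\<close>.\<close>

definition Lf :: "'a \<Rightarrow> real set" where "Lf x = (\<Union>v\<in>anc x. {a v..<lo v (S v x)})"
definition bad :: "'a \<Rightarrow> real set" where "bad x = {0..<a x} - Lf x"

lemma Lf_borel: "Lf x \<in> sets borel"
  unfolding Lf_def using countable_anc by (intro sets.countable_UN') auto

lemma bad_borel: "bad x \<in> sets borel"
  unfolding bad_def using Lf_borel by (intro sets.Diff) auto

lemma a_le_Z: "x \<in> V \<Longrightarrow> a x \<le> Z"
  using b_le_Z[of x] m_pos[of x] by (simp add: b_def)

lemma lo_le_a: "x \<in> V \<Longrightarrow> v \<in> anc x \<Longrightarrow> lo v (S v x) \<le> a x"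
  using cell_nested(1)[of v x] by (simp add: anc_def)

lemma lam_bad:
  assumes x: "x \<in> V" shows "measure lam (bad x) = 0"
proof -
  \<comment> \<open>Finitely many left intervals are disjoint from \<open>bad x\<close> and fit
    together with it into [0, a x). The bound passes to the supremum of their total lengths, which
    is \<open>a x\<close>, and leaves no room for \<open>bad x\<close>.\<close>
  have "a x \<le> a x - measure lam (bad x)"
    unfolding a_def[of x]
  proof (rule infsum_le_finite_sums)
    show "(\<lambda>v. pre v (S v x)) summable_on anc x" using a_summable[OF x] by simp
    fix W assume W: "finite W" "W \<subseteq> anc x"
    define I where "I = (\<lambda>v. {a v..<lo v (S v x)})"
    have len: "measure lam (I v) = pre v (S v x)" if v: "v \<in> W" for v
    proof -
      have "v \<in> V" "v \<in> anc x" using v W by (auto simp: anc_def)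
      then have "measure lam (I v) = lo v (S v x) - a v"
        unfolding I_def using lo_le_a[OF x] a_le_Z[OF x] a_le_lo a_nonneg
        by (intro lam_interval) (auto intro: order_trans)
      then show ?thesis by (simp add: lo_def)
    qed
    have disj: "I v \<inter> I w = {}" if vw: "v \<in> anc x" "w \<in> anc x" "lt v w" for v w
    proof -
      have "S v w = S v x" using S_mono(2)[of v w x] vw x by (auto simp: anc_def ltD)
      then have "lo v (S v x) \<le> a w" using cell_nested(1)[of v w] vw by (simp add: anc_def)
      then show ?thesis by (auto simp: I_def)
    qed
    have "disjoint_family_on I W" unfolding disjoint_family_on_def
    proof (intro ballI impI)
      fix v w assume vw: "v \<in> W" "w \<in> W" "v \<noteq> w"
      then have anc: "v \<in> anc x" "w \<in> anc x" using W by auto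
      then have "lt v w \<or> lt w v" using le_linear[of v w x] vw x by (auto simp: anc_def lt_def)
      then show "I v \<inter> I w = {}" using disj[of v w] disj[of w v] anc by auto
    qed
    then have "measure lam (\<Union>v\<in>W. I v) = (\<Sum>v\<in>W. measure lam (I v))"
      using W by (intro lam.finite_measure_finite_Union) (auto simp: I_def)
    also have "\<dots> = (\<Sum>v\<in>W. pre v (S v x))" using len by (intro sum.cong) auto
    finally have 1: "(\<Sum>v\<in>W. pre v (S v x)) = measure lam (\<Union>v\<in>W. I v)" ..
    have Lf: "(\<Union>v\<in>W. I v) \<subseteq> Lf x" unfolding Lf_def I_def using W by auto
    have sub: "(\<Union>v\<in>W. I v) \<subseteq> {0..<a x}"
    proof
      fix t assume "t \<in> (\<Union>v\<in>W. I v)"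
      then obtain v where v: "v \<in> anc x" "a v \<le> t" "t < lo v (S v x)" using W by (auto simp: I_def)
      then show "t \<in> {0..<a x}" using lo_le_a[OF x v(1)] a_nonneg[of v] by auto
    qed
    have I_borel: "(\<Union>v\<in>W. I v) \<in> sets borel"
      using W by (intro sets.finite_UN) (auto simp: I_def)
    have "measure lam (bad x \<union> (\<Union>v\<in>W. I v)) = measure lam (bad x) + measure lam (\<Union>v\<in>W. I v)"
    proof (rule lam.finite_measure_Union)
      show "bad x \<inter> (\<Union>v\<in>W. I v) = {}" using Lf unfolding bad_def by blast
    qed (use bad_borel I_borel in simp_all)
    moreover have "measure lam (bad x \<union> (\<Union>v\<in>W. I v)) \<le> measure lam {0..<a x}"
      by (rule lam.finite_measure_mono) (use sub in \<open>auto simp: bad_def\<close>)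
    moreover have "measure lam {0..<a x} = a x" using lam_interval[of 0 "a x"] a_le_Z[OF x] a_nonneg by simp
    ultimately show "(\<Sum>v\<in>W. pre v (S v x)) \<le> infsum (\<lambda>v. pre v (S v x)) (anc x) - measure lam (bad x)"
      using 1 unfolding a_def[of x] by simp
  qed
  then show ?thesis using measure_nonneg[of lam "bad x"] by simp
qed

section \<open>Collapsing the gaps to atoms\<close>

definition At :: "real set" where "At = (\<Union>x\<in>V. {p x..<b x})"
definition Gd :: "real set" where "Gd = {0..<Z} - At - (\<Union>x\<in>V. bad x)"

lemma At_borel: "At \<in> sets borel"
  unfolding At_def using countable_V by (intro sets.countable_UN') auto

lemma Gd_borel: "Gd \<in> sets borel"
  unfolding Gd_def using countable_V At_borel bad_borel by (intro sets.Diff sets.countable_UN') auto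

text \<open>Outside \<open>bad x\<close>, a position to the left of \<open>a x\<close> lies in the
  left part of the block of some ancestor of \<open>x\<close>, hence in an interval there other than
  the one leading to \<open>x\<close>.\<close>

lemma Gd_sub_G: "Gd \<subseteq> G"
proof
  fix t assume t: "t \<in> Gd"
  have "leftcov t" unfolding leftcov_def
  proof (intro ballI impI)
    fix x assume x: "x \<in> V" "t < a x"
    then have "t \<in> Lf x" using t by (auto simp: Gd_def bad_def)
    then obtain v where v: "v \<in> V" "lt v x" "a v \<le> t" "t < lo v (S v x)" by (auto simp: Lf_def anc_def)
    have Sv: "S v x \<in> U v" using S_in_U v x by simp
    have "lo v (S v x) \<le> p v" using lo_le_hi[OF v(1) Sv] hi_le_p[OF v(1) Sv] by simp
    then have "t < p v" using v by simp
    then obtain A where A: "A \<in> U v" "lo v A \<le> t" "t < hi v A" using cell_exists[OF v(1,3)] by blast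
    have "A \<noteq> S v x" using A v by auto
    then have "x \<notin> A" using S_in_U_mem[OF v(1) x(1) v(2) A(1)] by simp
    then show "\<exists>v\<in>V. \<exists>A\<in>U v. lt v x \<and> t \<in> J v A \<and> x \<notin> A"
      using A v by (auto simp: J_mem)
  qed
  moreover have "0 \<le> t" "t < Z" "\<forall>x\<in>V. \<not> (p x \<le> t \<and> t < b x)" using t by (auto simp: Gd_def At_def)
  ultimately show "t \<in> G" by (simp add: G_def)
qed

lemma AE_good: "AE t in lam. t \<in> At \<union> Gd"
proof (rule AE_I)
  show "{t \<in> space lam. t \<notin> At \<union> Gd} \<subseteq> (- {0..<Z}) \<union> (\<Union>x\<in>V. bad x)" by (auto simp: Gd_def)
  have b: "emeasure lam (bad x) = 0" if "x \<in> V" for x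
    using lam_bad[OF that] by (simp add: lam.emeasure_eq_measure)
  have 1: "(\<Union>x\<in>V. bad x) \<in> null_sets lam"
    using countable_V b bad_borel by (intro null_sets_UN') auto
  have "emeasure lam (- {0..<Z}) = emeasure lborel {}"
    by (subst emeasure_lam) (auto intro!: arg_cong[where f="emeasure lborel"])
  then have 2: "- {0..<Z} \<in> null_sets lam" by auto
  have 3: "(- {0..<Z}) \<union> (\<Union>x\<in>V. bad x) \<in> null_sets lam" using 1 2 by (rule null_sets.Un[rotated])
  then show "emeasure lam ((- {0..<Z}) \<union> (\<Union>x\<in>V. bad x)) = 0" by auto
  show "(- {0..<Z}) \<union> (\<Union>x\<in>V. bad x) \<in> sets lam" using 3 by auto
qed

lemma At_unique:
  assumes "x \<in> V" "y \<in> V" "p x \<le> t" "t < b x" "p y \<le> t" "t < b y" shows "x = y"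
proof -
  have "le x y \<or> le y x"
    using blocks_comparable[of x y t] assms a_le_p[of x] a_le_p[of y] by simp
  then show ?thesis
    using p_lt_order(1)[of x y] p_lt_order(1)[of y x] assms by (auto simp: lt_def)
qed

text \<open>The image of Lebesgue measure has an atom of mass \<open>b x - p x\<close> at each
  \<open>p x\<close>. The value \<open>p r\<close> on the remaining set is an arbitrary default in
  \<open>G\<close>; that set is null by \<open>AE_good\<close>.\<close>

definition kap :: "real \<Rightarrow> real" where
  "kap t = (if t \<in> At then p (THE x. x \<in> V \<and> p x \<le> t \<and> t < b x) else if t \<in> Gd then t else p r)"

lemma kap_At: "x \<in> V \<Longrightarrow> p x \<le> t \<Longrightarrow> t < b x \<Longrightarrow> kap t = p x"
proof -
  assume x: "x \<in> V" "p x \<le> t" "t < b x"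
  then have "t \<in> At" by (auto simp: At_def)
  moreover have "(THE x. x \<in> V \<and> p x \<le> t \<and> t < b x) = x"
    by (rule the_equality) (use x At_unique in auto)
  ultimately show ?thesis by (simp add: kap_def)
qed

lemma kap_Gd: "t \<in> Gd \<Longrightarrow> kap t = t"
  by (simp add: kap_def Gd_def)

lemma kap_in_G: "kap t \<in> G"
proof (cases "t \<in> At")
  case True
  then obtain x where "x \<in> V" "p x \<le> t" "t < b x" by (auto simp: At_def)
  then show ?thesis using kap_At p_in_G by simp
next
  case False
  then show ?thesis using p_in_G[OF root_in] Gd_sub_G by (auto simp: kap_def)
qed

lemma kap_borel [measurable]: "kap \<in> borel_measurable borel"
proof (rule measurableI)
  fix E :: "real set" assume E: "E \<in> sets borel"
  have "kap -` E = (\<Union>x\<in>{x \<in> V. p x \<in> E}. {p x..<b x}) \<union> (E \<inter> Gd) \<union> (if p r \<in> E then - (At \<union> Gd) else {})"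
    (is "_ = ?R")
  proof (rule set_eqI)
    fix t
    consider x where "x \<in> V" "p x \<le> t" "t < b x" | "t \<notin> At" "t \<in> Gd" | "t \<notin> At" "t \<notin> Gd" by (auto simp: At_def)
    then show "t \<in> kap -` E \<longleftrightarrow> t \<in> ?R"
    proof cases
      case (1 x)
      then have "t \<in> At" by (auto simp: At_def)
      then have "t \<in> ?R \<longleftrightarrow> (\<exists>y\<in>V. p y \<in> E \<and> p y \<le> t \<and> t < b y)" by (auto simp: Gd_def)
      also have "\<dots> \<longleftrightarrow> p x \<in> E" using 1 At_unique[of x _ t] by metis
      finally show ?thesis using kap_At[OF 1] by simp
    next
      case 2
      then have "t \<notin> (\<Union>x\<in>{x \<in> V. p x \<in> E}. {p x..<b x})" by (auto simp: At_def)
      then show ?thesis using 2 kap_Gd by auto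
    next
      case 3
      then have "t \<notin> (\<Union>x\<in>{x \<in> V. p x \<in> E}. {p x..<b x})" by (auto simp: At_def)
      then show ?thesis using 3 by (auto simp: kap_def)
    qed
  qed
  moreover have "countable {x \<in> V. p x \<in> E}" by (rule countable_subset[OF _ countable_V]) auto
  then have "(\<Union>x\<in>{x \<in> V. p x \<in> E}. {p x..<b x}) \<in> sets borel" by (intro sets.countable_UN') auto
  moreover have "- (At \<union> Gd) \<in> sets borel" using At_borel Gd_borel by (intro borel_comp sets.Un)
  ultimately have "kap -` E \<in> sets borel" using E Gd_borel by auto
  then show "kap -` E \<inter> space borel \<in> sets borel" by simp
qed simp

text \<open>Each gap, left end included, is contained wholly or not at all. For Borel sets of this
  kind collapsing the gaps does not change the measure, so masses become lengths.\<close>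

definition saturated :: "real set \<Rightarrow> bool" where
  "saturated B \<longleftrightarrow> (\<forall>y\<in>V. \<forall>t. p y \<le> t \<longrightarrow> t < b y \<longrightarrow> (t \<in> B \<longleftrightarrow> p y \<in> B))"

lemma lam_saturated:
  assumes B: "B \<in> sets borel" and s: "saturated B"
  shows "measure lam (kap -` B) = measure lam B"
proof (rule lam.finite_measure_eq_AE)
  show "AE t in lam. (t \<in> kap -` B) = (t \<in> B)"
    using AE_good
  proof eventually_elim
    fix t assume "t \<in> At \<union> Gd"
    then consider x where "x \<in> V" "p x \<le> t" "t < b x" | "t \<in> Gd" by (auto simp: At_def)
    then show "(t \<in> kap -` B) = (t \<in> B)"
    proof cases
      case (1 x)
      then show ?thesis using s[unfolded saturated_def, rule_format, OF 1] kap_At[OF 1] by simp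
    qed (simp add: kap_Gd)
  qed
  show "kap -` B \<in> sets lam" using measurable_sets[OF kap_borel B] by simp
qed (use B in simp)

lemma saturated_J:
  assumes "x \<in> V" "A \<in> U x" shows "saturated (J x A)"
  unfolding saturated_def
proof (intro ballI allI impI)
  fix y t assume y: "y \<in> V" "p y \<le> t" "t < b y"
  show "t \<in> J x A \<longleftrightarrow> p y \<in> J x A"
  proof
    assume "p y \<in> J x A"
    then have "y \<in> A" using p_in_J y assms by simp
    then have "lt x y" "S x y = A" using U_memD[OF assms] by auto
    then show "t \<in> J x A" using block_sub_J[of x y t] y assms a_le_p[of y] by auto
  next
    assume t: "t \<in> J x A"
    then consider "y = x" | "lt y x" | "lt x y" "A = S x y"
      using J_block[OF assms y(1) t] y a_le_p[of y] by auto
    then show "p y \<in> J x A"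
    proof cases
      case 1
      then show ?thesis using J_sub[OF assms t] y by simp
    next
      case 2
      then show ?thesis using p_lt_order(1)[of y x] J_sub[OF assms t] y assms p_less_b[of x] by simp
    next
      case 3
      then show ?thesis using p_in_J[OF y(1) assms] component_mem[OF tree assms(1) y(1)] by simp
    qed
  qed
qed

lemma saturated_block:
  assumes "x \<in> V" shows "saturated {a x..<b x}"
  unfolding saturated_def
proof (intro ballI allI impI)
  fix y t assume y: "y \<in> V" "p y \<le> t" "t < b y"
  have 1: "p y \<in> {a x..<b x} \<and> t \<in> {a x..<b x}" if c: "\<exists>s\<in>{a x..<b x}. p y \<le> s \<and> s < b y"
  proof -
    obtain s where s: "a x \<le> s" "s < b x" "p y \<le> s" "s < b y" using c by auto
    then have "le x y \<or> le y x" using blocks_comparable[of x y s] assms y a_le_p[of y] by simp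
    moreover have "\<not> lt y x" using p_lt_order(1)[of y x] s assms y by auto
    ultimately have "x = y \<or> lt x y" by (auto simp: lt_def)
    then have "a x \<le> a y \<and> b y \<le> b x"
      using p_lt_order[of x y] assms y p_less_b[of x] by auto
    then show ?thesis using y a_le_p[of y] by auto
  qed
  have "p y < b y" using p_less_b y by simp
  then have "\<exists>s\<in>{a x..<b x}. p y \<le> s \<and> s < b y" if "p y \<in> {a x..<b x}"
    using that by (intro bexI[of _ "p y"]) auto
  moreover have "\<exists>s\<in>{a x..<b x}. p y \<le> s \<and> s < b y" if "t \<in> {a x..<b x}"
    using that y by (intro bexI[of _ t]) auto
  ultimately show "t \<in> {a x..<b x} \<longleftrightarrow> p y \<in> {a x..<b x}" using 1 by argo
qed

lemma saturated_compl: "saturated B \<Longrightarrow> saturated (- B)"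
  unfolding saturated_def by blast

lemma saturated_atom:
  assumes "x \<in> V" shows "saturated {p x..<b x}"
  unfolding saturated_def
proof (intro ballI allI impI)
  fix y t assume y: "y \<in> V" "p y \<le> t" "t < b y"
  have py: "p y < b y" using p_less_b y by simp
  have "x = y" if "t \<in> {p x..<b x} \<or> p y \<in> {p x..<b x}"
    using that At_unique[OF assms y(1), of t] At_unique[OF assms y(1), of "p y"] y py by auto
  then show "t \<in> {p x..<b x} \<longleftrightarrow> p y \<in> {p x..<b x}" using y py by auto
qed

section \<open>The constructed tree and its measure\<close>

definition g :: "real \<Rightarrow> 'a + real" where
  "g t = (if t \<in> p ` V then Inl (inv_into V p t) else Inr t)"

lemma p_inj_on: "inj_on p V"
  using p_inj by (auto intro: inj_onI)

lemma g_p: "x \<in> V \<Longrightarrow> g (p x) = Inl x"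
  by (simp add: g_def inv_into_f_f[OF p_inj_on])

lemma g_inj: "inj g"
proof (rule injI)
  fix s t assume "g s = g t"
  then show "s = t"
    by (cases "s \<in> p ` V"; cases "t \<in> p ` V") (auto simp: g_def inv_into_f_f[OF p_inj_on])
qed

sublocale TT: transported_tree G GT.median g
proof
  show "inj_on g G" by (rule inj_on_subset[OF g_inj]) simp
qed (rule GT.algebraic_tree_median)

definition TS :: "('a + real) set" where "TS = g ` G"
abbreviation cS :: "'a + real \<Rightarrow> 'a + real \<Rightarrow> 'a + real \<Rightarrow> 'a + real" where "cS \<equiv> TT.cT"

lemma TS_tree: "algebraic_tree TS cS"
  unfolding TS_def by (rule TT.algebraic_tree_cT)

lemma TS_embedding: "tree_embedding V c TS cS Inl"
proof -
  have "tree_embedding V c TS cS (g \<circ> p)"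
    unfolding TS_def by (rule tree_embedding_comp[OF p_embedding TT.embedding_cT])
  then show ?thesis
    by (simp add: tree_embedding_def tree_hom_def image_def g_p inj_on_def c_closed)
qed

lemma TS_branch_points: "branch_points TS cS = Inl ` branch_points V c"
proof -
  have "branch_points V c \<subseteq> V" by (auto simp: branch_points_def)
  then show ?thesis unfolding TS_def TT.branch_points_cT GT_branch_points image_image
    by (intro image_cong) (auto simp: g_p)
qed

lemma TS_separable: obtains D where "separable_tree TS cS (Inl r) D"
proof -
  obtain D where D: "D \<subseteq> G" "countable D"
    "\<And>x y. x \<in> G \<Longrightarrow> y \<in> G \<Longrightarrow> x \<noteq> y \<Longrightarrow> \<exists>d\<in>D. d \<in> tree_interval G GT.median x y \<and> d \<noteq> y"
    by (rule GT_separable) blast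
  have "Inl r = g (p r)" by (simp add: g_p root_in)
  then have "Inl r \<in> TS" using p_in_G[OF root_in] by (simp add: TS_def)
  then have "separable_tree TS cS (Inl r) (g ` D)"
    using TS_tree D TT.separable_cT[OF D(1,3)]
    unfolding separable_tree_def separable_tree_axioms_def rooted_tree_def TS_def
    by (intro conjI allI impI) auto
  then show thesis by (rule that)
qed

lemma leG_borel: "{t. leG d t} \<in> sets borel"
proof -
  have "- {t. leG d t} = {d<..} \<union> (\<Union>v\<in>V. \<Union>A\<in>{A \<in> U v. d \<in> J v A}. - J v A)"
    by (auto simp: leG_def)
  moreover have "countable {A \<in> U v. d \<in> J v A}" for v
    by (rule countable_subset[OF _ countable_U]) auto
  then have "(\<Union>v\<in>V. \<Union>A\<in>{A \<in> U v. d \<in> J v A}. - J v A) \<in> sets borel"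
    using countable_V by (intro sets.countable_UN' image_subsetI borel_comp) (auto simp: J_def)
  ultimately have "- {t. leG d t} \<in> sets borel" by auto
  then show ?thesis using borel_comp by fastforce
qed

text \<open>Each type of component of \<open>G\<close> is the trace of a Borel set of reals, and
  traces pass to complements and countable unions. This makes \<open>g \<circ> kap\<close>
  measurable and brings every mass back to the line.\<close>

lemma TS_borel_trace:
  assumes "E \<in> component_borel TS cS"
  shows "\<exists>B\<in>sets borel. \<forall>t\<in>G. g t \<in> E \<longleftrightarrow> t \<in> B"
proof -
  obtain D where "separable_tree TS cS (Inl r) D" by (rule TS_separable)
  then interpret Q: separable_tree TS cS "Inl r" D .
  have g: "g t \<in> g ` B \<longleftrightarrow> t \<in> B" for t B using g_inj by (rule inj_image_mem_iff)
  have "E \<in> sigma_sets TS Q.base" using assms Q.component_borel_base by simp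
  then show ?thesis
  proof induction
    case (Basic E)
    then obtain x y where "x \<in> TS" "y \<in> TS" "x \<noteq> y" and E: "E = tree_component TS cS x y" by (rule Q.baseE)
    then obtain s t where st: "s \<in> G" "t \<in> G" "s \<noteq> t" "x = g s" "y = g t" by (auto simp: TS_def)
    have E': "E = g ` tree_component G GT.median s t"
      unfolding E TS_def st(4,5) by (rule TT.component_cT[OF st(1,2)])
    show ?case
    proof (rule GT_component_cases[OF st(1-3)])
      assume "tree_component G GT.median s t = {z \<in> G. \<not> leG s z}"
      then show ?thesis unfolding E' using leG_borel[of s]
        by (intro bexI[of _ "- {t. leG s t}"]) (auto simp: g borel_comp)
    next
      assume "tree_component G GT.median s t = {z \<in> G. leG s z \<and> z \<noteq> s}"
      then show ?thesis unfolding E' using leG_borel[of s]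
        by (intro bexI[of _ "{t. leG s t} - {s}"]) (auto simp: g)
    next
      fix x A assume "tree_component G GT.median s t = G \<inter> J x A"
      then show ?thesis unfolding E' by (intro bexI[of _ "J x A"]) (auto simp: g J_def)
    qed
  next
    case Empty
    then show ?case by (intro bexI[of _ "{}"]) auto
  next
    case (Compl E)
    then obtain B where "B \<in> sets borel" "\<forall>t\<in>G. g t \<in> E \<longleftrightarrow> t \<in> B" by blast
    then show ?case by (intro bexI[of _ "- B"]) (auto simp: TS_def borel_comp)
  next
    case (Union E)
    then have "\<forall>i. \<exists>B. B \<in> sets borel \<and> (\<forall>t\<in>G. g t \<in> E i \<longleftrightarrow> t \<in> B)" by blast
    from choice[OF this] obtain B where B: "\<And>i. B i \<in> sets borel" "\<And>i t. t \<in> G \<Longrightarrow> g t \<in> E i \<longleftrightarrow> t \<in> B i"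
      by auto
    have "(\<Union>i. B i) \<in> sets borel" using B(1) by (intro sets.countable_UN) auto
    moreover have "\<forall>t\<in>G. g t \<in> (\<Union>i. E i) \<longleftrightarrow> t \<in> (\<Union>i. B i)" using B(2) by simp
    ultimately show ?case by (rule bexI[rotated])
  qed
qed

definition bS :: "('a + real) measure" where "bS = sigma TS {U. openin (component_topology TS cS) U}"

lemma bS_props: "sets bS = component_borel TS cS" "space bS = TS"
proof -
  have "{U. openin (component_topology TS cS) U} \<subseteq> Pow TS"
    using openin_subset component_topspace[OF TS_tree] by fastforce
  then show "sets bS = component_borel TS cS" "space bS = TS"
    unfolding bS_def component_borel_def by (simp_all add: sets_measure_of space_measure_of)
qed

lemma g_kap_measurable: "g \<circ> kap \<in> measurable lam bS"
proof (rule measurableI)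
  show "(g \<circ> kap) x \<in> space bS" for x using kap_in_G by (simp add: bS_props TS_def)
  fix E assume "E \<in> sets bS"
  then obtain B where B: "B \<in> sets borel" "\<forall>t\<in>G. g t \<in> E \<longleftrightarrow> t \<in> B" 
    using TS_borel_trace[of E] unfolding bS_props by blast
  then have "(g \<circ> kap) -` E \<inter> space lam = kap -` B" using kap_in_G by auto
  then show "(g \<circ> kap) -` E \<inter> space lam \<in> sets lam" using measurable_sets[OF kap_borel B(1)] by simp
qed

definition MS :: "('a + real) measure" where "MS = distr lam bS (g \<circ> kap)"

lemma MS_props: "sets MS = component_borel TS cS" "space MS = TS" "finite_measure MS" "measure MS TS = Z"
proof -
  show "sets MS = component_borel TS cS" "space MS = TS" by (simp_all add: MS_def bS_props)
  show "finite_measure MS" unfolding MS_def by (rule lam.finite_measure_distr[OF g_kap_measurable])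
  have "TS \<in> sets bS" using sets.top[of bS] by (simp only: bS_props(2))
  then have "measure MS TS = measure lam ((g \<circ> kap) -` TS \<inter> space lam)"
    unfolding MS_def by (rule measure_distr[OF g_kap_measurable])
  also have "(g \<circ> kap) -` TS \<inter> space lam = UNIV" using kap_in_G by (auto simp: TS_def)
  finally show "measure MS TS = Z" using lam_UNIV by simp
qed

lemma measure_MS:
  assumes E: "E \<in> sets MS" and B: "B \<in> sets borel" "\<And>t. t \<in> G \<Longrightarrow> g t \<in> E \<longleftrightarrow> t \<in> B"
  shows "measure MS E = measure lam (kap -` B)"
proof -
  have "measure MS E = measure lam ((g \<circ> kap) -` E \<inter> space lam)"
    unfolding MS_def using E by (intro measure_distr g_kap_measurable) (simp add: MS_def)
  also have "(g \<circ> kap) -` E \<inter> space lam = kap -` B" using B kap_in_G by auto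
  finally show ?thesis .
qed

lemma MS_component:
  assumes "x \<in> V" "y \<in> V"
  shows "measure MS (tree_component TS cS (Inl x) (Inl y)) = \<phi> (S x y) x"
proof -
  obtain D where "separable_tree TS cS (Inl r) D" by (rule TS_separable)
  then interpret Q: separable_tree TS cS "Inl r" D .
  have comp: "tree_component TS cS (Inl x) (Inl y) = g ` tree_component G GT.median (p x) (p y)"
    using TT.component_cT[OF p_in_G[OF assms(1)] p_in_G[OF assms(2)]] assms by (simp add: TS_def g_p)
  have xT: "Inl z \<in> TS" if "z \<in> V" for z
    using p_in_G[OF that] g_p[OF that] unfolding TS_def by (metis imageI)
  have E: "tree_component TS cS (Inl x) (Inl y) \<in> sets MS"
  proof (cases "x = y")
    case True
    then show ?thesis using Q.component_borel_singleton[OF xT[OF assms(1)]] MS_props(1) by (simp add: tree_component_def)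
  next
    case False
    then show ?thesis using Q.component_borel_component[OF xT xT] assms MS_props(1) by simp
  qed
  have g: "g t \<in> g ` B \<longleftrightarrow> t \<in> B" for t B using g_inj by (rule inj_image_mem_iff)
  consider "x = y" | "lt x y" | "\<not> le x y" by (auto simp: lt_def)
  then show ?thesis
  proof cases
    case 1
    have cs: "tree_component G GT.median (p x) (p y) = {p x}" and Sx: "S x y = {x}"
      using 1 by (simp_all add: tree_component_def)
    \<comment> \<open>The set \<open>G\<close> meets the gap behind \<open>p x\<close> only in
      \<open>p x\<close>, so the point may be replaced by the whole gap, which is saturated.\<close>
    have "measure MS (tree_component TS cS (Inl x) (Inl y)) = measure lam (kap -` {p x..<b x})"
    proof (rule measure_MS[OF E])
      fix t assume t: "t \<in> G"
      have "\<not> (p x < t \<and> t < b x)" using G_gap[OF t assms(1)] by blast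
      then have "t \<in> {p x} \<longleftrightarrow> t \<in> {p x..<b x}" using p_less_b[OF assms(1)] by auto
      then show "g t \<in> tree_component TS cS (Inl x) (Inl y) \<longleftrightarrow> t \<in> {p x..<b x}"
        unfolding comp g cs .
    qed simp
    also have "\<dots> = b x - p x"
      using lam_saturated[OF _ saturated_atom[OF assms(1)]] lam_interval[of "p x" "b x"] p_bounds(1)[OF assms(1)]
        p_less_b[OF assms(1)] b_le_Z[OF assms(1)] by simp
    finally show ?thesis unfolding Sx by (simp add: b_def p_def m_def)
  next
    case 2
    have A: "S x y \<in> U x" using S_in_U assms 2 by simp
    have pJ: "p y \<in> J x (S x y)" using p_in_J[OF assms(2,1) A] component_mem[OF tree assms] by simp
    have "tree_component G GT.median (p x) (p y) = G \<inter> J x (S x y)"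
      by (rule GT_component_p_above[OF assms(1) A p_in_G[OF assms(2)] pJ])
    then have "measure MS (tree_component TS cS (Inl x) (Inl y)) = measure lam (kap -` J x (S x y))"
      by (intro measure_MS[OF E]) (auto simp: comp g J_def)
    also have "\<dots> = measure lam (J x (S x y))"
      by (rule lam_saturated[OF _ saturated_J[OF assms(1) A]]) (simp add: J_def)
    also have "\<dots> = hi x (S x y) - lo x (S x y)" unfolding J_def
      using a_le_lo[OF assms(1), of "S x y"] a_nonneg[of x] lo_le_hi[OF assms(1) A] hi_le_p[OF assms(1) A]
        p_bounds(2)[OF assms(1)] by (intro lam_interval) auto
    finally show ?thesis by (simp add: hi_def)
  next
    case 3
    then have xr: "x \<noteq> r" using assms by auto
    have "\<not> leG (p x) (p y)" using leG_p_p assms 3 by simp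
    then have eq: "tree_component G GT.median (p x) (p y) = {z \<in> G. \<not> leG (p x) z}"
      using GT_component_not_above p_in_G assms by simp
    \<comment> \<open>The component facing the root is the complement of the block of
      \<open>x\<close>; its mass is \<open>Z - m x\<close>.\<close>
    have "measure MS (tree_component TS cS (Inl x) (Inl y)) = measure lam (kap -` (- {a x..<b x}))"
    proof (rule measure_MS[OF E])
      fix t assume t: "t \<in> G"
      have "leG (p x) t \<longleftrightarrow> t \<in> {a x..<b x}"
      proof -
        have "\<not> (p x < t \<and> t < b x)" using G_gap[OF t assms(1)] by blast
        then have "t \<le> p x \<longleftrightarrow> t < b x" using p_less_b[OF assms(1)] by auto
        then show ?thesis using leG_p_iff[OF assms(1) t] by simp
      qed
      then show "g t \<in> tree_component TS cS (Inl x) (Inl y) \<longleftrightarrow> t \<in> - {a x..<b x}"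
        unfolding comp g eq using t by simp
    qed simp
    also have "\<dots> = measure lam (- {a x..<b x})"
      by (rule lam_saturated[OF _ saturated_compl[OF saturated_block[OF assms(1)]]]) simp
    also have "\<dots> = measure lam (space lam - {a x..<b x})" by (simp add: Compl_eq_Diff_UNIV)
    also have "\<dots> = Z - (b x - a x)"
      using lam.finite_measure_compl[of "{a x..<b x}"] lam_UNIV lam_interval[of "a x" "b x"] a_nonneg[of x]
        b_le_Z[OF assms(1)] a_le_p[OF assms(1)] p_less_b[OF assms(1)] by simp
    also have "\<dots> = \<phi> (S x r) x" using total_m[OF assms(1)] xr by (simp add: b_def)
    also have "S x r = S x y" using component_root[OF assms(1) xr] component_not_above[OF assms 3] by simp
    finally show ?thesis .
  qed
qed

text \<open>Over a position that belongs to no point of \<open>V\<close>, the map \<open>kap\<close>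
  has at most one preimage, and a single real is Lebesgue null.\<close>

lemma MS_atoms:
  assumes "z \<in> TS" "z \<notin> Inl ` V" shows "measure MS {z} = 0"
proof -
  obtain D where "separable_tree TS cS (Inl r) D" by (rule TS_separable)
  then interpret Q: separable_tree TS cS "Inl r" D .
  obtain t where t: "t \<in> G" "z = g t" using assms by (auto simp: TS_def)
  have tV: "t \<notin> p ` V" using assms t g_p by auto
  have "measure MS {z} = measure lam (kap -` {t})"
    using Q.component_borel_singleton[OF assms(1)] MS_props(1) g_inj t
    by (intro measure_MS) (auto simp: inj_eq)
  also have "\<dots> \<le> measure lam {t}"
  proof (rule lam.finite_measure_mono)
    show "kap -` {t} \<subseteq> {t}"
    proof
      fix s assume "s \<in> kap -` {t}"
      then have k: "kap s = t" by simp
      show "s \<in> {t}"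
      proof (cases "s \<in> At")
        case True
        then obtain x where "x \<in> V" "p x \<le> s" "s < b x" by (auto simp: At_def)
        then show ?thesis using kap_At k tV by auto
      next
        case False
        then show ?thesis using k tV root_in by (auto simp: kap_def split: if_splits)
      qed
    qed
  qed simp
  finally show ?thesis using lam_sing[of t] measure_nonneg[of MS "{z}"] by simp
qed

end

section \<open>Tightness\<close>

text \<open>The hypothesis concerns the countable family \<open>base\<close>, since that is what
  Lusin's theorem provides; \<open>component_refine\<close> reaches all other components.\<close>

lemma (in separable_tree) continuous_map_component:
  assumes top: "f ` topspace X \<subseteq> T"
    and open_base: "\<And>E. E \<in> base \<Longrightarrow> openin X {x \<in> topspace X. f x \<in> E}"
  shows "continuous_map X (component_topology T c) f"
  unfolding component_topology_def
proof (rule continuous_on_generated_topo)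
  show "f ` topspace X \<subseteq> \<Union>(insert T {tree_component T c x y |x y. x \<in> T \<and> y \<in> T \<and> x \<noteq> y})"
    using top by blast
  fix U assume U: "U \<in> insert T {tree_component T c x y |x y. x \<in> T \<and> y \<in> T \<and> x \<noteq> y}"
  show "openin X (f -` U \<inter> topspace X)"
  proof (cases "U = T")
    case True
    then have "f -` U \<inter> topspace X = topspace X" using top by auto
    then show ?thesis by simp
  next
    case False
    then obtain x y where xy: "x \<in> T" "y \<in> T" "x \<noteq> y" "U = tree_component T c x y" using U by auto
    have "f -` U \<inter> topspace X = (\<Union>E\<in>{E \<in> base. E \<subseteq> U}. {x \<in> topspace X. f x \<in> E})"
    proof (intro equalityI subsetI)
      fix z assume z: "z \<in> f -` U \<inter> topspace X"
      then have fz: "f z \<in> tree_component T c x y" using xy by simp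
      obtain d d' where "d \<in> D" "d' \<in> D" "d \<noteq> d'" "f z \<in> tree_component T c d d'"
          "tree_component T c d d' \<subseteq> tree_component T c x y"
        by (rule component_refine[OF xy(1-3) fz])
      moreover from this have "tree_component T c d d' \<in> base" unfolding base_def by auto
      ultimately show "z \<in> (\<Union>E\<in>{E \<in> base. E \<subseteq> U}. {x \<in> topspace X. f x \<in> E})"
        using z xy by (intro UN_I[of "tree_component T c d d'"]) auto
    qed auto
    moreover have "openin X (\<Union>E\<in>{E \<in> base. E \<subseteq> U}. {x \<in> topspace X. f x \<in> E})"
      by (rule openin_Union) (use open_base in auto)
    ultimately show ?thesis by simp
  qed
qed

section \<open>Measures of countable unions of chains and of disjoint families\<close>

context finite_measure begin

text \<open>A finite union of members of a chain is itself a member, so the partial unions of an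
  enumeration obey the bound, and it passes to the limit.\<close>

lemma measure_chain_Union_le:
  assumes I: "countable I" and X: "\<And>i. i \<in> I \<Longrightarrow> X i \<in> sets M" and le: "\<And>i. i \<in> I \<Longrightarrow> measure M (X i) \<le> s"
    and chain: "\<And>i j. i \<in> I \<Longrightarrow> j \<in> I \<Longrightarrow> X i \<subseteq> X j \<or> X j \<subseteq> X i" and s: "0 \<le> s"
  shows "measure M (\<Union>i\<in>I. X i) \<le> s"
proof (cases "I = {}")
  case False
  define e where "e = from_nat_into I"
  have e: "range e = I" unfolding e_def using False I by (rule range_from_nat_into)
  have eI: "e n \<in> I" for n using e by auto
  define Y where "Y = (\<lambda>n. \<Union>k\<le>n. X (e k))"
  have Y: "\<exists>k. Y n = X (e k)" for n
  proof (induction n)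
    case 0
    show ?case by (intro exI[of _ 0]) (simp add: Y_def)
  next
    case (Suc n)
    then obtain k where k: "Y n = X (e k)" by blast
    have "Y (Suc n) = Y n \<union> X (e (Suc n))" by (auto simp: Y_def le_Suc_eq)
    then have "Y (Suc n) = X (e k) \<or> Y (Suc n) = X (e (Suc n))"
      using chain[OF eI[of k] eI[of "Suc n"]] k by auto
    then show ?case by blast
  qed
  have Ys: "Y n \<in> sets M" "measure M (Y n) \<le> s" for n
  proof -
    obtain k where "Y n = X (e k)" using Y by blast
    then show "Y n \<in> sets M" "measure M (Y n) \<le> s" using X[OF eI] le[OF eI] by auto
  qed
  have "incseq Y" unfolding Y_def incseq_def by fastforce
  then have "(\<lambda>n. measure M (Y n)) \<longlonglongrightarrow> measure M (\<Union>n. Y n)"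
    using Ys by (intro finite_Lim_measure_incseq) auto
  moreover have "(\<Union>n. Y n) = (\<Union>i\<in>I. X i)" unfolding Y_def e[symmetric] by auto
  ultimately show ?thesis using Ys(2) by (intro LIMSEQ_le_const2[of "\<lambda>n. measure M (Y n)"]) auto
qed (use s in simp)

lemma measure_disjoint_Union_infsum:
  assumes I: "countable I" and X: "\<And>i. i \<in> I \<Longrightarrow> X i \<in> sets M" and disj: "disjoint_family_on X I"
    and sm: "(\<lambda>i. measure M (X i)) summable_on I"
  shows "measure M (\<Union>i\<in>I. X i) = infsum (\<lambda>i. measure M (X i)) I"
proof (rule antisym)
  have UI: "(\<Union>i\<in>I. X i) \<in> sets M" using I X by (intro sets.countable_UN') auto
  have fin: "measure M (\<Union>i\<in>F. X i) = (\<Sum>i\<in>F. measure M (X i))" if F: "finite F" "F \<subseteq> I" for F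
    using F X disj by (intro finite_measure_finite_Union) (auto intro: disjoint_family_on_mono)
  show "infsum (\<lambda>i. measure M (X i)) I \<le> measure M (\<Union>i\<in>I. X i)"
  proof (rule infsum_le_finite_sums[OF sm])
    fix F assume F: "finite F" "F \<subseteq> I"
    have "measure M (\<Union>i\<in>F. X i) \<le> measure M (\<Union>i\<in>I. X i)"
      by (rule finite_measure_mono[OF _ UI]) (use F in auto)
    then show "(\<Sum>i\<in>F. measure M (X i)) \<le> measure M (\<Union>i\<in>I. X i)" using fin[OF F] by simp
  qed
  show "measure M (\<Union>i\<in>I. X i) \<le> infsum (\<lambda>i. measure M (X i)) I"
  proof -
    \<comment> \<open>Enumerating the index set turns the unordered sum into a limit along an
      increasing sequence of finite unions.\<close>
    define J where "J = (\<lambda>n. {i \<in> I. to_nat_on I i < n})"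
    have J: "finite (J n)" "J n \<subseteq> I" for n
    proof -
      show "finite (J n)"
        by (rule inj_on_finite[of "to_nat_on I" _ "{..<n}"])
          (use inj_on_to_nat_on[OF I] in \<open>auto simp: J_def intro: inj_on_subset\<close>)
    qed (auto simp: J_def)
    define Y where "Y = (\<lambda>n. \<Union>i\<in>J n. X i)"
    have inc: "incseq Y" unfolding Y_def J_def incseq_def by fastforce
    have "range Y \<subseteq> sets M"
    proof (rule image_subsetI)
      fix n show "Y n \<in> sets M" unfolding Y_def using J[of n] X by (intro sets.finite_UN) auto
    qed
    then have "(\<lambda>n. measure M (Y n)) \<longlonglongrightarrow> measure M (\<Union>n. Y n)"
      using inc by (rule finite_Lim_measure_incseq)
    moreover have "(\<Union>n. Y n) = (\<Union>i\<in>I. X i)" unfolding Y_def J_def by auto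
    moreover have "measure M (Y n) \<le> infsum (\<lambda>i. measure M (X i)) I" for n
      unfolding Y_def fin[OF J] by (rule finite_sum_le_infsum[OF sm J]) simp
    ultimately show ?thesis by (intro LIMSEQ_le_const2[of "\<lambda>n. measure M (Y n)"]) auto
  qed
qed

end

lemma real_borel_sandwiched:
  assumes "finite_topological_measure M euclideanreal" "sets M = sets borel" "B \<in> sets borel"
  shows "finite_topological_measure.sandwiched M euclideanreal B"
proof -
  interpret finite_topological_measure M euclideanreal by fact
  have sp: "space M = UNIV" using space_top by simp
  have "B \<in> sigma_sets (space M) (range lessThan)"
    using assms(3) unfolding borel_Iio sp by (simp add: sets_measure_of)
  then show ?thesis
  proof (rule sandwiched_sigma_sets[rotated])
    fix S :: "real set" assume "S \<in> range lessThan"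
    then obtain a where S: "S = {..<a}" by auto
    have *: "S = \<Union>(range (\<lambda>n. {..a - 1 / real (Suc n)}))"
    proof (intro equalityI subsetI)
      fix t assume "t \<in> S"
      then have "0 < a - t" using S by simp
      then obtain n where "1 / real (Suc n) < a - t" using nat_approx_posE by metis
      then show "t \<in> \<Union>(range (\<lambda>n. {..a - 1 / real (Suc n)}))" by (intro UnionI[of "{..a - 1 / real (Suc n)}"]) auto
    next
      fix t assume "t \<in> \<Union>(range (\<lambda>n. {..a - 1 / real (Suc n)}))"
      then obtain n where "t \<le> a - 1 / real (Suc n)" by auto
      moreover have "1 / real (Suc n) > 0" by simp
      ultimately have "t < a" by linarith
      then show "t \<in> S" using S by simp
    qed
    have "openin euclideanreal S" using S by (simp add: open_openin[symmetric])
    then show "sandwiched S" unfolding * by (intro sandwiched_open) auto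
  qed
qed

context weighted_tree begin

text \<open>By Lusin's theorem \<open>g \<circ> kap\<close> is continuous on a closed set of nearly
  full measure. The part of this set in [0, Z] is compact, and so is its image, which is then closed
  by the Hausdorff property and hence measurable.\<close>

lemma MS_tight:
  assumes e: "e > 0"
  shows "\<exists>K\<in>sets MS. compactin (component_topology TS cS) K \<and> measure MS K > Z - e"
proof -
  obtain D where "separable_tree TS cS (Inl r) D" by (rule TS_separable)
  then interpret Q: separable_tree TS cS "Inl r" D .
  interpret FT: finite_topological_measure lam euclideanreal
    by unfold_locales (auto simp: open_openin[symmetric])
  let ?f = "g \<circ> kap"
  define \<E> where "\<E> = (\<lambda>E. ?f -` E) ` Q.base"
  have bT: "E \<in> sets bS" if "E \<in> Q.base" for E
    using that bS_props(1) Q.component_borel_base by (auto intro: sigma_sets.Basic)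
  have sw: "FT.sandwiched B" if B: "B \<in> \<E>" for B
  proof -
    obtain E where E: "E \<in> Q.base" "B = ?f -` E" using B by (auto simp: \<E>_def)
    have "?f -` E \<inter> space lam \<in> sets lam" using measurable_sets[OF g_kap_measurable bT[OF E(1)]] .
    then have "B \<in> sets borel" using E(2) by simp
    then show ?thesis by (intro real_borel_sandwiched FT.finite_topological_measure_axioms) simp_all
  qed
  have cE: "countable \<E>" unfolding \<E>_def using Q.countable_base by simp
  obtain C where C: "closedin euclideanreal C" "measure lam (space lam - C) < e"
    "\<And>E. E \<in> \<E> \<Longrightarrow> openin (subtopology euclideanreal C) (E \<inter> C)"
    "\<And>E. E \<in> \<E> \<Longrightarrow> openin (subtopology euclideanreal C) (C - E)"
    using FT.Lusin[of \<E> e] sw cE e by metis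
  have cont: "continuous_map (subtopology euclideanreal C) (component_topology TS cS) ?f"
  proof (rule Q.continuous_map_component)
    show "?f ` topspace (subtopology euclideanreal C) \<subseteq> TS" using kap_in_G by (auto simp: TS_def)
    fix E assume E: "E \<in> Q.base"
    have "{x \<in> topspace (subtopology euclideanreal C). ?f x \<in> E} = ?f -` E \<inter> C" by auto
    then show "openin (subtopology euclideanreal C) {x \<in> topspace (subtopology euclideanreal C). ?f x \<in> E}"
      using C(3)[of "?f -` E"] E by (simp add: \<E>_def)
  qed
  define K where "K = C \<inter> {0..Z}"
  have Ccl: "closed C" unfolding closed_closedin by (rule C(1))
  have Kc: "compact K" unfolding K_def by (intro closed_Int_compact Ccl compact_Icc)
  have "compactin (subtopology euclideanreal C) K"
    using Kc by (simp add: compactin_subtopology K_def)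
  then have fK: "compactin (component_topology TS cS) (?f ` K)"
    using cont by (rule image_compactin)
  have "closedin (component_topology TS cS) (?f ` K)"
    by (rule compactin_imp_closedin[OF component_Hausdorff[OF TS_tree] fK])
  then have op: "openin (component_topology TS cS) (TS - ?f ` K)" and sub: "?f ` K \<subseteq> TS"
    unfolding closedin_def component_topspace[OF TS_tree] by auto
  have "TS - ?f ` K \<in> sets MS"
    unfolding MS_props component_borel_def using op by (intro sigma_sets.Basic) simp
  then have "space MS - (TS - ?f ` K) \<in> sets MS" by (rule sets.compl_sets)
  moreover have "space MS - (TS - ?f ` K) = ?f ` K" using sub by (auto simp: MS_props)
  ultimately have fKm: "?f ` K \<in> sets MS" by simp
  have Kb: "K \<in> sets borel" using Kc by (intro borel_closed compact_imp_closed)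
  have "measure lam K \<le> measure lam (?f -` (?f ` K) \<inter> space lam)"
    by (rule lam.finite_measure_mono) (use measurable_sets[OF g_kap_measurable] fKm in \<open>auto simp: MS_def\<close>)
  also have "\<dots> = measure MS (?f ` K)"
    unfolding MS_def using fKm by (intro measure_distr[symmetric] g_kap_measurable) (simp add: MS_def)
  finally have 1: "measure lam K \<le> measure MS (?f ` K)" .
  have "measure lam (space lam - K) \<le> measure lam ((space lam - C) \<union> - {0..Z})"
    using borel_closed[OF Ccl] by (intro lam.finite_measure_mono) (auto simp: K_def)
  also have "\<dots> \<le> measure lam (space lam - C) + measure lam (- {0..Z})"
    using borel_closed[OF Ccl] by (intro measure_Un_le) auto
  also have "measure lam (- {0..Z}) = 0"
  proof -
    have "{0..<Z} \<inter> - {0..Z} = {}" by auto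
    then show ?thesis by (simp add: measure_def emeasure_lam)
  qed
  finally have "measure lam (space lam - K) < e" using C(2) by simp
  moreover have "measure lam (space lam - K) = Z - measure lam K"
    using lam.finite_measure_compl[of K] Kb lam_UNIV by simp
  ultimately show ?thesis using 1 fKm fK by (intro bexI[of _ "?f ` K"]) auto
qed

end

section \<open>The depth-first order of a realization\<close>

text \<open>The measure \<open>M'\<close> of total mass \<open>Z\<close> will be a given realizing
  measure plus the image of the added distribution, so every \<open>\<iota> x\<close> is an
  atom.\<close>

locale realization = weighted_tree V c r \<phi> Z + Q: separable_tree T' c' "\<iota> r" D + M: finite_measure M'
  for V :: "'a set" and c r \<phi> Z and T' :: "'b set" and c' \<iota> D and M' :: "'b measure" +
  assumes emb: "tree_embedding V c T' c' \<iota>"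
    and br: "branch_points T' c' = \<iota> ` branch_points V c"
    and sets_M: "sets M' = component_borel T' c'" and space_M: "space M' = T'"
    and mass: "measure M' T' = Z"
    and comp_mass: "\<And>x y. x \<in> V \<Longrightarrow> y \<in> V \<Longrightarrow> measure M' (tree_component T' c' (\<iota> x) (\<iota> y)) = \<phi> (tree_component V c x y) x"
    and no_atom: "\<And>z. z \<in> T' \<Longrightarrow> z \<notin> \<iota> ` V \<Longrightarrow> measure M' {z} = 0"
begin

lemma iota_in: "x \<in> V \<Longrightarrow> \<iota> x \<in> T'"
  using emb by (auto simp: tree_embedding_def tree_hom_def)

lemma iota_inj: "x \<in> V \<Longrightarrow> y \<in> V \<Longrightarrow> \<iota> x = \<iota> y \<longleftrightarrow> x = y"
  using emb by (auto simp: tree_embedding_def inj_on_eq_iff)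

lemma iota_c: "x \<in> V \<Longrightarrow> y \<in> V \<Longrightarrow> z \<in> V \<Longrightarrow> c' (\<iota> x) (\<iota> y) (\<iota> z) = \<iota> (c x y z)"
  using emb by (simp add: tree_embedding_def tree_hom_def)

lemma iota_meet: "x \<in> V \<Longrightarrow> y \<in> V \<Longrightarrow> Q.meet (\<iota> x) (\<iota> y) = \<iota> (meet x y)"
  by (simp add: Q.meet_def meet_def iota_c root_in)

lemma iota_le: "x \<in> V \<Longrightarrow> y \<in> V \<Longrightarrow> Q.le (\<iota> x) (\<iota> y) \<longleftrightarrow> le x y"
  by (simp add: Q.le_meet le_meet iota_meet iota_inj)

lemma iota_lt: "x \<in> V \<Longrightarrow> y \<in> V \<Longrightarrow> Q.lt (\<iota> x) (\<iota> y) \<longleftrightarrow> lt x y"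
  by (simp add: Q.lt_def lt_def iota_le iota_inj)

lemma sing_sets: "z \<in> T' \<Longrightarrow> {z} \<in> sets M'"
  using Q.component_borel_singleton sets_M by simp

lemma above_sets: "z \<in> T' \<Longrightarrow> {w \<in> T'. Q.le z w} \<in> sets M'"
  using Q.component_borel_above sets_M by simp

lemma lt_sets: 
  assumes "z \<in> T'" shows "{w \<in> T'. Q.lt z w} \<in> sets M'"
proof -
  have "{w \<in> T'. Q.lt z w} = {w \<in> T'. Q.le z w} - {z}" by (auto simp: Q.lt_def)
  then show ?thesis using above_sets[OF assms] sing_sets[OF assms] by simp
qed

lemma T_sets: "T' \<in> sets M'"
  using sets.top[of M'] by (simp only: space_M)

text \<open>The component of \<open>T'\<close> at \<open>\<iota> v\<close> that extends
  \<open>A\<close>; by \<open>C_eq\<close> the choice of the point of \<open>A\<close> is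
  immaterial.\<close>

definition C :: "'a \<Rightarrow> 'a set \<Rightarrow> 'b set" where
  "C v A = tree_component T' c' (\<iota> v) (\<iota> (SOME y. y \<in> A))"

lemma C_eq:
  assumes v: "v \<in> V" "A \<in> U v" and y: "y \<in> A"
  shows "C v A = tree_component T' c' (\<iota> v) (\<iota> y)"
proof -
  define y0 where "y0 = (SOME y. y \<in> A)"
  have y0: "y0 \<in> A" unfolding y0_def using y by (rule someI)
  note Y = U_memD[OF v y] and Y0 = U_memD[OF v y0]
  have "y \<in> S v y0" using y Y0(3) by simp
  then have "c v y0 y \<noteq> v" "v \<noteq> y0" "y \<noteq> v" using Y0 by (auto simp: tree_component_def lt_def)
  then have "\<iota> y \<in> tree_component T' c' (\<iota> v) (\<iota> y0)"
    using v Y Y0 by (simp add: tree_component_def iota_c iota_inj c_closed iota_in)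
  then have "tree_component T' c' (\<iota> v) (\<iota> y) = tree_component T' c' (\<iota> v) (\<iota> y0)"
    by (rule component_eq[OF Q.tree iota_in[OF v(1)] iota_in[OF Y0(1)]])
  then show ?thesis by (simp add: C_def y0_def)
qed

lemma C_props:
  assumes v: "v \<in> V" "A \<in> U v"
  shows "C v A \<in> sets M'" "measure M' (C v A) = \<phi> A v" "C v A \<subseteq> T'"
    "z \<in> C v A \<Longrightarrow> Q.lt (\<iota> v) z"
    "z \<in> C v A \<Longrightarrow> C v A = tree_component T' c' (\<iota> v) z"
proof -
  obtain y where y: "y \<in> A" by (rule U_nonempty[OF v])
  note Y = U_memD[OF v y] and eq = C_eq[OF v y]
  have ne: "\<iota> v \<noteq> \<iota> y" using Y v iota_inj by (auto simp: lt_def)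
  show "C v A \<in> sets M'"
    unfolding eq sets_M using Y v ne by (intro Q.component_borel_component iota_in)
  show "measure M' (C v A) = \<phi> A v" unfolding eq using comp_mass[of v y] Y v by simp
  show "C v A \<subseteq> T'" unfolding eq using Q.component_sub iota_in v Y by simp
  have lt: "Q.lt (\<iota> v) (\<iota> y)" using iota_lt v Y by simp
  show "Q.lt (\<iota> v) z" if "z \<in> C v A"
    using Q.mem_S_above(2)[OF iota_in[OF v(1)] iota_in[OF Y(1)] lt] that eq by simp
  show "C v A = tree_component T' c' (\<iota> v) z" if "z \<in> C v A"
    using component_eq[OF Q.tree iota_in[OF v(1)] iota_in[OF Y(1)], of z] that eq by simp
qed

lemma C_iota:
  assumes v: "v \<in> V" "A \<in> U v" and y: "y \<in> V" shows "\<iota> y \<in> C v A \<longleftrightarrow> y \<in> A"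
proof
  assume "y \<in> A"
  then show "\<iota> y \<in> C v A" using C_eq[OF v] component_mem[OF Q.tree iota_in[OF v(1)] iota_in[OF y]] by simp
next
  assume *: "\<iota> y \<in> C v A"
  obtain y0 where y0: "y0 \<in> A" by (rule U_nonempty[OF v])
  note Y0 = U_memD[OF v y0]
  have "c' (\<iota> v) (\<iota> y0) (\<iota> y) \<noteq> \<iota> v" "\<iota> y \<noteq> \<iota> v"
    using * Y0 iota_inj v unfolding C_eq[OF v y0] by (auto simp: tree_component_def lt_def split: if_splits)
  then have "c v y0 y \<noteq> v" "y \<noteq> v" using iota_c[of v y0 y] Y0 v y by auto
  then have "y \<in> S v y0" using Y0 y by (auto simp: tree_component_def lt_def)
  then show "y \<in> A" using Y0 by simp
qed

lemma C_unique:
  assumes v: "v \<in> V" and AB: "A \<in> U v" "B \<in> U v" and z: "z \<in> C v A" "z \<in> C v B" shows "A = B"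
proof -
  obtain y where y: "y \<in> A" by (rule U_nonempty[OF v AB(1)])
  have yV: "y \<in> V" using U_memD[OF v AB(1) y] by simp
  have "C v A = C v B" using C_props(5)[OF v AB(1) z(1)] C_props(5)[OF v AB(2) z(2)] by simp
  then have "y \<in> B" using C_iota[OF v AB(1) yV] C_iota[OF v AB(2) yV] y by simp
  then show ?thesis using U_disjoint[OF v AB y] by simp
qed

lemma C_mono:
  assumes v: "v \<in> V" "A \<in> U v" and w: "w \<in> T'" and z: "z \<in> T'" "Q.lt (\<iota> v) z" "Q.le z w"
  shows "z \<in> C v A \<longleftrightarrow> w \<in> C v A"
proof -
  have "w \<in> tree_component T' c' (\<iota> v) z" "tree_component T' c' (\<iota> v) w = tree_component T' c' (\<iota> v) z"
    using Q.S_mono[OF iota_in[OF v(1)] z(1) w z(2,3)] by auto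
  moreover have "z \<in> tree_component T' c' (\<iota> v) z" "w \<in> tree_component T' c' (\<iota> v) w"
    using component_mem[OF Q.tree] iota_in v z w by auto
  ultimately show ?thesis using C_props(5)[OF v] by blast
qed

lemma C_S:
  assumes "v \<in> V" "x \<in> V" "lt v x" "w \<in> T'" "Q.le (\<iota> x) w"
  shows "w \<in> C v (S v x)"
proof -
  have A: "S v x \<in> U v" using S_in_U assms by simp
  have "\<iota> x \<in> C v (S v x)" using C_iota[OF assms(1) A assms(2)] component_mem[OF tree assms(1,2)] by simp
  then show ?thesis using C_mono[OF assms(1) A assms(4) iota_in[OF assms(2)] _ assms(5)] iota_lt assms by simp
qed

text \<open>The meet of two incomparable points is either the root or a median of the root and the
  two points that differs from all three. In the latter case it is a branch point, and these come
  from \<open>V\<close>.\<close>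

lemma meet_in_V:
  assumes z: "z \<in> T'" "w \<in> T'" and n: "\<not> Q.le z w" "\<not> Q.le w z"
  obtains v where "v \<in> V" "Q.meet z w = \<iota> v"
proof (cases "Q.meet z w = \<iota> r")
  case True
  then show thesis using that root_in by blast
next
  case False
  let ?u = "Q.meet z w"
  have u: "?u \<in> T'" "?u \<noteq> z" "?u \<noteq> w" using z n Q.meet_comm[of z w] by (auto simp: Q.le_meet)
  then have "?u \<in> branch_points T' c'"
    unfolding branch_points_def Q.meet_def[symmetric] using z False Q.root_in
    by (intro CollectI conjI bexI[of _ "\<iota> r"] bexI[of _ z] bexI[of _ w]) (auto simp: Q.meet_def)
  then obtain v where "v \<in> branch_points V c" "?u = \<iota> v" unfolding br by blast
  then show thesis using that by (auto simp: branch_points_def)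
qed

text \<open>Discards the components above points of \<open>V\<close> that contain no point of
  \<open>V\<close>. The prescribed masses of the other components already exhaust the mass above the
  point (\<open>mass_cells\<close>, \<open>mass_lt\<close>), so only a null set is lost.\<close>

definition T0 :: "'b set" where
  "T0 = {z \<in> T'. \<forall>v\<in>V. Q.lt (\<iota> v) z \<longrightarrow> (\<exists>A\<in>U v. z \<in> C v A)}"

lemma T0_sub: "z \<in> T0 \<Longrightarrow> z \<in> T'" by (simp add: T0_def)

lemma T0_cell: "z \<in> T0 \<Longrightarrow> v \<in> V \<Longrightarrow> Q.lt (\<iota> v) z \<Longrightarrow> \<exists>A\<in>U v. z \<in> C v A"
  by (simp add: T0_def)

lemma iota_T0: "x \<in> V \<Longrightarrow> \<iota> x \<in> T0"
  unfolding T0_def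
proof (intro CollectI conjI ballI impI)
  assume x: "x \<in> V"
  then show "\<iota> x \<in> T'" by (rule iota_in)
  fix v assume v: "v \<in> V" "Q.lt (\<iota> v) (\<iota> x)"
  then have lt: "lt v x" using iota_lt x by simp
  then show "\<exists>A\<in>U v. \<iota> x \<in> C v A"
    using C_S[OF v(1) x lt iota_in[OF x] Q.le_refl[OF iota_in[OF x]]] S_in_U[OF x lt] by blast
qed

lemma T0_down:
  assumes "z \<in> T0" "d \<in> T'" "Q.le d z" shows "d \<in> T0"
  unfolding T0_def
proof (intro CollectI conjI ballI impI)
  fix v assume v: "v \<in> V" "Q.lt (\<iota> v) d"
  have zT: "z \<in> T'" using assms T0_sub by simp
  have "Q.lt (\<iota> v) z" using Q.lt_le_trans[OF iota_in[OF v(1)] assms(2) zT v(2) assms(3)] .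
  then obtain A where A: "A \<in> U v" "z \<in> C v A" using T0_cell[OF assms(1) v(1)] by blast
  then have "d \<in> C v A" using C_mono[OF v(1) A(1) zT assms(2) v(2) assms(3)] by simp
  then show "\<exists>A\<in>U v. d \<in> C v A" using A by blast
qed (rule assms)

section \<open>The exploration order on the points of the realization\<close>

definition left :: "'a \<Rightarrow> 'b \<Rightarrow> 'b \<Rightarrow> bool" where
  "left v w z \<longleftrightarrow> v \<in> V \<and> (\<exists>A\<in>U v. \<exists>B\<in>U v. w \<in> C v A \<and> z \<in> C v B \<and> idx A < idx B)"

text \<open>A point comes after its descendants: \<open>w\<close> precedes \<open>z\<close> if it is
  strictly above \<open>z\<close>, or if it branches off from the path to \<open>z\<close> into a
  component with a smaller index.\<close>

definition before :: "'b \<Rightarrow> 'b \<Rightarrow> bool" where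
  "before w z \<longleftrightarrow> Q.lt z w \<or> (\<exists>v. left v w z)"

lemma before_irrefl: "\<not> before z z"
proof
  assume "before z z"
  then obtain v where "left v z z" by (auto simp: before_def Q.lt_def)
  then show False using C_unique unfolding left_def by blast
qed

lemma before_total:
  assumes z: "z \<in> T0" "w \<in> T0" "z \<noteq> w" shows "before z w \<or> before w z"
proof (cases "Q.le z w \<or> Q.le w z")
  case True
  then show ?thesis using z by (auto simp: before_def Q.lt_def)
next
  case False
  have zT: "z \<in> T'" "w \<in> T'" using z T0_sub by auto
  obtain v where v: "v \<in> V" "Q.meet z w = \<iota> v" using meet_in_V[OF zT] False by blast
  have le: "Q.le (\<iota> v) z" "Q.le (\<iota> v) w" using zT v(2)[symmetric] by simp_all
  then have lt: "Q.lt (\<iota> v) z" "Q.lt (\<iota> v) w" using False by (auto simp: Q.lt_def)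
  obtain A where A: "A \<in> U v" "z \<in> C v A" using T0_cell[OF z(1) v(1) lt(1)] by blast
  obtain B where B: "B \<in> U v" "w \<in> C v B" using T0_cell[OF z(2) v(1) lt(2)] by blast
  have "A \<noteq> B"
  proof
    assume "A = B"
    then have "w \<in> tree_component T' c' (\<iota> v) z" using C_props(5)[OF v(1) A] B by simp
    then show False using Q.component_above[OF iota_in[OF v(1)] zT(1) lt(1)] v(2) by simp
  qed
  then have "idx A \<noteq> idx B" using idx_inj[OF v(1) A(1) B(1)] by blast
  then have "left v z w \<or> left v w z" unfolding left_def using v A B by (meson linorder_neqE_nat)
  then show ?thesis by (auto simp: before_def)
qed

lemma before_trans:
  assumes w: "w \<in> T'" and z: "z \<in> T0" and y: "y \<in> T0" and wz: "before w z" and zy: "before z y"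
  shows "before w y"
proof -
  have zT: "z \<in> T'" and yT: "y \<in> T'" using z y T0_sub by auto
  consider "Q.lt z w" "Q.lt y z" | v where "Q.lt z w" "left v z y" | v where "left v w z" "Q.lt y z"
    | u v where "left v w z" "left u z y" using wz zy by (auto simp: before_def)
  then show ?thesis
  proof cases
    case 1
    then show ?thesis using Q.lt_trans[OF yT zT w] by (simp add: before_def)
  next
    case (2 v)
    then obtain A B where v: "v \<in> V" "A \<in> U v" "B \<in> U v" "z \<in> C v A" "y \<in> C v B" "idx A < idx B"
      unfolding left_def by blast
    then have "w \<in> C v A"
      using C_mono[OF v(1,2) w zT C_props(4)[OF v(1,2,4)]] 2 by (simp add: Q.lt_def)
    then have "left v w y" unfolding left_def using v by blast
    then show ?thesis by (auto simp: before_def)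
  next
    case (3 v)
    then obtain A B where v: "v \<in> V" "A \<in> U v" "B \<in> U v" "w \<in> C v A" "z \<in> C v B" "idx A < idx B"
      unfolding left_def by blast
    have vz: "Q.lt (\<iota> v) z" and vw: "Q.lt (\<iota> v) w" using C_props(4) v by auto
    have yz: "Q.le y z" using 3 by (simp add: Q.lt_def)
    show ?thesis
    proof (cases "Q.le y (\<iota> v)")
      case True
      then have "Q.lt y w" using Q.le_lt_trans[OF yT iota_in[OF v(1)] w _ vw] by simp
      then show ?thesis by (simp add: before_def)
    next
      case False
      then have "Q.le (\<iota> v) y"
        using Q.le_linear[OF yT iota_in[OF v(1)] zT yz] vz by (auto simp: Q.lt_def)
      then have lt: "Q.lt (\<iota> v) y" using False Q.le_refl[OF yT] by (auto simp: Q.lt_def)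
      have "y \<in> C v B" using C_mono[OF v(1,3) zT yT lt yz] v by simp
      then have "left v w y" unfolding left_def using v by blast
      then show ?thesis by (auto simp: before_def)
    qed
  next
    case (4 u v)
    then obtain A B where v: "v \<in> V" "A \<in> U v" "B \<in> U v" "w \<in> C v A" "z \<in> C v B" "idx A < idx B"
      unfolding left_def by blast
    from 4 obtain E E' where u: "u \<in> V" "E \<in> U u" "E' \<in> U u" "z \<in> C u E" "y \<in> C u E'" "idx E < idx E'"
      unfolding left_def by blast
    have vz: "Q.lt (\<iota> v) z" and vw: "Q.lt (\<iota> v) w" using C_props(4) v by auto
    have uz: "Q.lt (\<iota> u) z" and uy: "Q.lt (\<iota> u) y" using C_props(4) u by auto
    \<comment> \<open>Both branching points are below \<open>z\<close>, hence comparable, and the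
      lower one decides how \<open>w\<close> and \<open>y\<close> are ordered.\<close>
    have "Q.le (\<iota> v) (\<iota> u) \<or> Q.le (\<iota> u) (\<iota> v)"
      using Q.le_linear[OF iota_in[OF v(1)] iota_in[OF u(1)] zT] vz uz by (simp add: Q.lt_def)
    then consider "u = v" | "lt v u" | "lt u v" using iota_le v u by (auto simp: lt_def)
    then show ?thesis
    proof cases
      case 1
      then have "B = E" using C_unique[OF v(1,3) _ v(5)] u by simp
      then have "left v w y" unfolding left_def using v u 1 by (meson less_trans)
      then show ?thesis by (auto simp: before_def)
    next
      case 2
      have "z \<in> C v (S v u)" "y \<in> C v (S v u)"
        using C_S[OF v(1) u(1) 2 zT] C_S[OF v(1) u(1) 2 yT] uz uy by (simp_all add: Q.lt_def)
      then have "y \<in> C v B" using C_unique[OF v(1) S_in_U[OF u(1) 2] v(3)] v by blast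
      then have "left v w y" unfolding left_def using v by blast
      then show ?thesis by (auto simp: before_def)
    next
      case 3
      have "z \<in> C u (S u v)" "w \<in> C u (S u v)"
        using C_S[OF u(1) v(1) 3 zT] C_S[OF u(1) v(1) 3 w] vz vw by (simp_all add: Q.lt_def)
      then have "w \<in> C u E" using C_unique[OF u(1) S_in_U[OF v(1) 3] u(2)] u by blast
      then have "left u w y" unfolding left_def using u by blast
      then show ?thesis by (auto simp: before_def)
    qed
  qed
qed

text \<open>Separability of the tree gives order density for \<open>before\<close>. Between a point
  and its descendant it applies directly; after a branching, take a point of \<open>D\<close> on the
  path from the branching point to the earlier of the two.\<close>

lemma before_between:
  assumes z: "z \<in> T0" "z' \<in> T0" "before z z'"
  obtains d where "d \<in> D" "d \<in> T0" "d = z \<or> before z d" "d = z' \<or> before d z'"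
proof -
  have zT: "z \<in> T'" "z' \<in> T'" using z T0_sub by auto
  consider "Q.lt z' z" | v where "left v z z'" using z by (auto simp: before_def)
  then show thesis
  proof cases
    case 1
    then have le: "Q.le z' z" "z' \<noteq> z" by (auto simp: Q.lt_def)
    obtain d where d: "d \<in> D" "d \<in> tree_interval T' c' z' z" using Q.D_sep[OF zT(2,1) le(2)] by blast
    then have "d \<in> T'" "Q.le z' d" "Q.le d z" using Q.interval_le(1)[OF zT(2,1) le(1)] by auto
    then show thesis using that[OF d(1) T0_down[OF z(1)]] by (auto simp: before_def Q.lt_def)
  next
    case (2 v)
    then obtain A B where v: "v \<in> V" "A \<in> U v" "B \<in> U v" "z \<in> C v A" "z' \<in> C v B" "idx A < idx B"
      unfolding left_def by blast
    have vz: "Q.le (\<iota> v) z" "\<iota> v \<noteq> z" using C_props(4)[OF v(1,2,4)] by (auto simp: Q.lt_def)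
    obtain d where d: "d \<in> D" "d \<in> tree_interval T' c' z (\<iota> v)" "d \<noteq> \<iota> v"
      using Q.D_sep[OF zT(1) iota_in[OF v(1)]] vz by blast
    then have dT: "d \<in> T'" "Q.le (\<iota> v) d" "Q.le d z"
      using Q.interval_le(2)[OF iota_in[OF v(1)] zT(1) vz(1)] by auto
    then have "Q.lt (\<iota> v) d" using d by (auto simp: Q.lt_def)
    then have "d \<in> C v A" using C_mono[OF v(1,2) zT(1) dT(1) _ dT(3)] v by simp
    then have "left v d z'" unfolding left_def using v by blast
    then show thesis using that[OF d(1) T0_down[OF z(1) dT(1,3)]] dT by (auto simp: before_def Q.lt_def)
  qed
qed

section \<open>The distribution function of the exploration order\<close>

definition B :: "'b \<Rightarrow> 'b set" where "B z = {w \<in> T'. before w z}"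
definition F :: "'b \<Rightarrow> real" where "F z = measure M' (B z)"

lemma B_sets:
  assumes "z \<in> T'" shows "B z \<in> sets M'"
proof -
  have eq: "B z = {w \<in> T'. Q.lt z w} \<union> (\<Union>v\<in>V. \<Union>A\<in>{A \<in> U v. \<exists>E\<in>U v. z \<in> C v E \<and> idx A < idx E}. C v A)"
    (is "_ = _ \<union> ?R")
  proof (intro equalityI subsetI)
    fix w assume "w \<in> B z"
    then show "w \<in> {w \<in> T'. Q.lt z w} \<union> ?R" by (auto simp: B_def before_def left_def)
  next
    fix w assume w: "w \<in> {w \<in> T'. Q.lt z w} \<union> ?R"
    then show "w \<in> B z"
    proof
      assume "w \<in> ?R"
      then obtain v A E where "v \<in> V" "A \<in> U v" "E \<in> U v" "w \<in> C v A" "z \<in> C v E" "idx A < idx E" by auto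
      moreover from this have "left v w z" unfolding left_def by blast
      ultimately show ?thesis using C_props(3) unfolding B_def before_def by blast
    qed (simp add: B_def before_def)
  qed
  have "countable {A \<in> U v. \<exists>E\<in>U v. z \<in> C v E \<and> idx A < idx E}" for v
    by (rule countable_subset[OF _ countable_U]) auto
  then have "?R \<in> sets M'"
    using countable_V C_props(1) by (intro sets.countable_UN' image_subsetI) auto
  then show ?thesis unfolding eq using lt_sets[OF assms] by auto
qed

lemma B_mono:
  assumes "w \<in> T0" "z \<in> T0" "before w z"
  shows "insert w (B w) \<subseteq> B z" "w \<notin> B w" "F w + measure M' {w} \<le> F z"
proof -
  have wT: "w \<in> T'" and zT: "z \<in> T'" using assms T0_sub by auto
  show sub: "insert w (B w) \<subseteq> B z"
    using assms wT before_trans[OF _ assms(1,2) _ assms(3)] by (auto simp: B_def)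
  show n: "w \<notin> B w" using before_irrefl by (simp add: B_def)
  have "measure M' (B w \<union> {w}) = measure M' (B w) + measure M' {w}"
    using n B_sets[OF wT] sing_sets[OF wT] by (intro M.finite_measure_Union) auto
  moreover have "measure M' (B w \<union> {w}) \<le> measure M' (B z)"
    using sub B_sets[OF zT] by (intro M.finite_measure_mono) auto
  ultimately show "F w + measure M' {w} \<le> F z" by (simp add: F_def)
qed

lemma mass_above:
  assumes "x \<in> V" shows "measure M' {w \<in> T'. Q.le (\<iota> x) w} = m x"
proof (cases "x = r")
  case True
  then have "{w \<in> T'. Q.le (\<iota> x) w} = T'" using Q.root_le by auto
  then show ?thesis using True mass m_root by simp
next
  case False
  then have ne: "\<iota> x \<noteq> \<iota> r" using iota_inj assms root_in by simp
  have eq: "{w \<in> T'. Q.le (\<iota> x) w} = space M' - tree_component T' c' (\<iota> x) (\<iota> r)"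
    unfolding space_M Q.component_root[OF iota_in[OF assms] ne] by auto
  have "tree_component T' c' (\<iota> x) (\<iota> r) \<in> sets M'"
    unfolding sets_M using ne assms by (intro Q.component_borel_component iota_in Q.root_in) auto
  then have "measure M' {w \<in> T'. Q.le (\<iota> x) w} = Z - \<phi> (S x r) x"
    unfolding eq using M.finite_measure_compl space_M mass comp_mass[OF assms root_in] by simp
  then show ?thesis using total_m[OF assms] False by simp
qed

lemma mass_iota: "x \<in> V \<Longrightarrow> measure M' {\<iota> x} = \<phi> {x} x"
  using comp_mass[of x x] by (simp add: tree_component_def)

lemma mass_lt:
  assumes "x \<in> V" shows "measure M' {w \<in> T'. Q.lt (\<iota> x) w} = sz x"
proof -
  have "{w \<in> T'. Q.lt (\<iota> x) w} = {w \<in> T'. Q.le (\<iota> x) w} - {\<iota> x}" by (auto simp: Q.lt_def)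
  then have "measure M' {w \<in> T'. Q.lt (\<iota> x) w} = m x - \<phi> {x} x"
    using M.finite_measure_Diff[OF above_sets[OF iota_in[OF assms]] sing_sets[OF iota_in[OF assms]]]
      iota_in[OF assms] mass_above[OF assms] mass_iota[OF assms] by simp
  then show ?thesis by (simp add: m_def)
qed

lemma C_disjoint: "v \<in> V \<Longrightarrow> disjoint_family_on (C v) (U v)"
  unfolding disjoint_family_on_def using C_unique by blast

lemma mass_cells:
  assumes "v \<in> V" shows "measure M' (\<Union>A\<in>U v. C v A) = sz v"
proof -
  have "measure M' (\<Union>A\<in>U v. C v A) = infsum (\<lambda>A. measure M' (C v A)) (U v)"
  proof (rule M.measure_disjoint_Union_infsum[OF countable_U _ C_disjoint[OF assms]])
    show "(\<lambda>A. measure M' (C v A)) summable_on U v"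
      using U_summable[OF assms] C_props(2)[OF assms] by (simp cong: summable_on_cong)
  qed (use C_props(1) assms in auto)
  also have "\<dots> = sz v" unfolding sz_def using C_props(2)[OF assms] by (intro infsum_cong) auto
  finally show ?thesis .
qed

lemma T0_eq: "T' - T0 = (\<Union>v\<in>V. {w \<in> T'. Q.lt (\<iota> v) w} - (\<Union>A\<in>U v. C v A))"
  by (auto simp: T0_def)

lemma T0_null: "T0 \<in> sets M'" "measure M' T0 = Z"
proof -
  have null: "{w \<in> T'. Q.lt (\<iota> v) w} - (\<Union>A\<in>U v. C v A) \<in> null_sets M'" if v: "v \<in> V" for v
  proof -
    have s: "(\<Union>A\<in>U v. C v A) \<in> sets M'"
      using countable_U C_props(1)[OF v] by (intro sets.countable_UN') auto
    have "(\<Union>A\<in>U v. C v A) \<subseteq> {w \<in> T'. Q.lt (\<iota> v) w}" using C_props(3,4)[OF v] by blast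
    then have "measure M' ({w \<in> T'. Q.lt (\<iota> v) w} - (\<Union>A\<in>U v. C v A)) = 0"
      using M.finite_measure_Diff[OF lt_sets[OF iota_in[OF v]] s] mass_lt[OF v] mass_cells[OF v] by simp
    then show ?thesis using s lt_sets[OF iota_in[OF v]] by (auto simp: null_sets_def M.emeasure_eq_measure)
  qed
  then have n: "T' - T0 \<in> null_sets M'"
    unfolding T0_eq using countable_V by (intro null_sets_UN') auto
  have T0: "T0 = T' - (T' - T0)" by (auto simp: T0_def)
  show "T0 \<in> sets M'" by (subst T0) (use n T_sets in auto)
  then have "measure M' (T' - T0) = Z - measure M' T0"
    using M.finite_measure_Diff[OF T_sets, of T0] mass by (simp add: T0_def Collect_mono subset_iff)
  moreover have "measure M' (T' - T0) = 0" using n by (auto simp: measure_def)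
  ultimately show "measure M' T0 = Z" by simp
qed

text \<open>\<open>BL v\<close> is the part of the tree branching off to the left of the path from the root to \<open>v\<close>.\<close>

definition Lv :: "'a \<Rightarrow> 'a \<Rightarrow> 'b set" where
  "Lv x u = (\<Union>E\<in>{E \<in> U u. idx E < idx (S u x)}. C u E)"
definition BL :: "'a \<Rightarrow> 'b set" where "BL x = (\<Union>u\<in>anc x. Lv x u)"

lemma mass_initial_cells:
  assumes "u \<in> V"
  shows "(\<Union>E\<in>{E \<in> U u. idx E < n}. C u E) \<in> sets M'"
    and "measure M' (\<Union>E\<in>{E \<in> U u. idx E < n}. C u E) = psum u n"
proof -
  show "(\<Union>E\<in>{E \<in> U u. idx E < n}. C u E) \<in> sets M'"
    using finite_idx_less[OF assms] C_props(1)[OF assms] by (intro sets.finite_UN) auto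
  have "measure M' (\<Union>E\<in>{E \<in> U u. idx E < n}. C u E) = (\<Sum>E\<in>{E \<in> U u. idx E < n}. measure M' (C u E))"
    using finite_idx_less[OF assms] C_props(1)[OF assms] disjoint_family_on_mono[OF _ C_disjoint[OF assms]]
    by (intro M.finite_measure_finite_Union) auto
  also have "\<dots> = psum u n" unfolding psum_def using C_props(2)[OF assms] by (intro sum.cong) auto
  finally show "measure M' (\<Union>E\<in>{E \<in> U u. idx E < n}. C u E) = psum u n" .
qed

lemma Lv_not_above:
  assumes x: "x \<in> V" and u: "u \<in> anc x" and w: "w \<in> Lv x u" and y: "y \<in> V" "lt u y" "le y x"
  shows "\<not> Q.le (\<iota> y) w"
proof
  assume le: "Q.le (\<iota> y) w"
  obtain E where E: "E \<in> U u" "idx E < idx (S u x)" "w \<in> C u E" using w by (auto simp: Lv_def)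
  have uV: "u \<in> V" using u by (simp add: anc_def)
  have wT: "w \<in> T'" using C_props(3)[OF uV E(1)] E by auto
  have "S u y = S u x" using S_mono(2)[OF uV y(1) x y(2,3)] by simp
  moreover have "w \<in> C u (S u y)" by (rule C_S[OF uV y(1,2) wT le])
  ultimately have "E = S u x" using C_unique[OF uV E(1) S_in_U[OF y(1,2)] E(3)] by simp
  then show False using E by simp
qed

text \<open>The layers \<open>Lv x u\<close> of different ancestors are disjoint by
  \<open>Lv_not_above\<close>, and their masses are the summands of \<open>a x\<close>.\<close>

lemma mass_BL:
  assumes x: "x \<in> V" shows "BL x \<in> sets M'" "measure M' (BL x) = a x"
proof -
  have sets: "Lv x u \<in> sets M'" "measure M' (Lv x u) = pre u (S u x)" if "u \<in> anc x" for u
    unfolding Lv_def pre_def using mass_initial_cells[of u "idx (S u x)"] that by (auto simp: anc_def)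
  show "BL x \<in> sets M'" unfolding BL_def using countable_anc sets(1) by (intro sets.countable_UN') auto
  have "disjoint_family_on (Lv x) (anc x)"
    unfolding disjoint_family_on_def
  proof (intro ballI impI)
    have *: "Lv x u \<inter> Lv x v = {}" if uv: "u \<in> anc x" "v \<in> anc x" "lt u v" for u v
    proof (rule ccontr)
      assume "Lv x u \<inter> Lv x v \<noteq> {}"
      then obtain w where w: "w \<in> Lv x u" "w \<in> Lv x v" by auto
      have v: "v \<in> V" "le v x" using uv by (auto simp: anc_def lt_def)
      obtain E where "E \<in> U v" "w \<in> C v E" using w by (auto simp: Lv_def)
      then have "Q.le (\<iota> v) w" using C_props(4)[OF v(1)] by (auto simp: Q.lt_def)
      then show False using Lv_not_above[OF x uv(1) w(1) v(1) uv(3) v(2)] by simp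
    qed
    fix u v assume uv: "u \<in> anc x" "v \<in> anc x" "u \<noteq> v"
    then have "lt u v \<or> lt v u" using le_linear[of u v x] x by (auto simp: anc_def lt_def)
    then show "Lv x u \<inter> Lv x v = {}" using *[of u v] *[of v u] uv by auto
  qed
  then have "measure M' (BL x) = infsum (\<lambda>u. measure M' (Lv x u)) (anc x)"
    unfolding BL_def
  proof (intro M.measure_disjoint_Union_infsum countable_anc sets(1))
    show "(\<lambda>u. measure M' (Lv x u)) summable_on anc x"
      using a_summable[OF x order_refl] sets(2) by (simp cong: summable_on_cong)
  qed
  also have "\<dots> = a x" unfolding a_def using sets(2) by (intro infsum_cong) auto
  finally show "measure M' (BL x) = a x" .
qed

lemma BL_not_above:
  assumes "x \<in> V" "w \<in> BL x" shows "\<not> Q.le (\<iota> x) w"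
proof -
  obtain u where "u \<in> anc x" "w \<in> Lv x u" using assms by (auto simp: BL_def)
  then show ?thesis using Lv_not_above[of x u w x] assms by (auto simp: anc_def)
qed

text \<open>The branching point \<open>u\<close> and \<open>x\<close> both lie below
  \<open>z\<close>. A branching below \<open>x\<close> puts \<open>w\<close> into
  \<open>BL x\<close>; one above \<open>x\<close> leaves \<open>w\<close> in the same component at
  \<open>x\<close> as \<open>z\<close>.\<close>

lemma left_split:
  assumes x: "x \<in> V" and z: "z \<in> T'" "Q.le (\<iota> x) z" and l: "left u w z"
  shows "w \<in> BL x \<or> u = x \<or> (lt x u \<and> Q.lt (\<iota> x) w \<and> (\<forall>A\<in>U x. z \<in> C x A \<longrightarrow> w \<in> C x A))"
proof -
  obtain A E where u: "u \<in> V" "A \<in> U u" "E \<in> U u" "w \<in> C u A" "z \<in> C u E" "idx A < idx E"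
    using l unfolding left_def by blast
  have uz: "Q.lt (\<iota> u) z" and uw: "Q.lt (\<iota> u) w" using C_props(4) u by auto
  have wT: "w \<in> T'" using C_props(3)[OF u(1,2)] u(4) by auto
  have "Q.le (\<iota> u) (\<iota> x) \<or> Q.le (\<iota> x) (\<iota> u)"
    using Q.le_linear[OF iota_in[OF u(1)] iota_in[OF x] z(1)] uz z by (simp add: Q.lt_def)
  then consider "u = x" | "lt u x" | "lt x u" using iota_le u x by (auto simp: lt_def)
  then show ?thesis
  proof cases
    case 2
    have "z \<in> C u (S u x)" by (rule C_S[OF u(1) x 2 z])
    then have "E = S u x" using C_unique[OF u(1,3) S_in_U[OF x 2] u(5)] by simp
    then have "w \<in> Lv x u" using u by (auto simp: Lv_def)
    then show ?thesis using 2 u by (auto simp: BL_def anc_def)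
  next
    case 3
    have xu: "Q.lt (\<iota> x) (\<iota> u)" using iota_lt 3 x u by simp
    have "Q.lt (\<iota> x) w" using Q.lt_trans[OF iota_in[OF x] iota_in[OF u(1)] wT xu uw] .
    moreover have "w \<in> C x A'" if A': "A' \<in> U x" "z \<in> C x A'" for A'
    proof -
      have "\<iota> u \<in> C x A'" using C_mono[OF x A'(1) z(1) iota_in[OF u(1)] xu] uz A' by (simp add: Q.lt_def)
      then show ?thesis using C_mono[OF x A'(1) wT iota_in[OF u(1)] xu] uw by (simp add: Q.lt_def)
    qed
    ultimately show ?thesis using 3 by blast
  qed simp
qed

lemma BL_left:
  assumes x: "x \<in> V" and z: "z \<in> T'" "Q.le (\<iota> x) z" and w: "w \<in> BL x"
  shows "w \<in> B z"
proof -
  obtain u E where u: "u \<in> V" "lt u x" "E \<in> U u" "idx E < idx (S u x)" "w \<in> C u E"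
    using w by (auto simp: BL_def Lv_def anc_def)
  have "z \<in> C u (S u x)" by (rule C_S[OF u(1) x u(2) z])
  then have "left u w z" unfolding left_def using u S_in_U[OF x u(2)] by blast
  then show ?thesis using C_props(3)[OF u(1,3)] u(5) by (auto simp: B_def before_def)
qed

text \<open>What precedes \<open>\<iota> x\<close> is \<open>BL x\<close>, of mass
  \<open>a x\<close>, together with the descendants, of mass \<open>sz x\<close>. In every
  realization the points of \<open>V\<close> thus get the positions computed from the prescribed
  masses.\<close>

lemma F_iota:
  assumes x: "x \<in> V" shows "F (\<iota> x) = p x"
proof -
  have "B (\<iota> x) = BL x \<union> {w \<in> T'. Q.lt (\<iota> x) w}"
  proof (intro equalityI subsetI)
    fix w assume "w \<in> B (\<iota> x)"
    then have wT: "w \<in> T'" and "Q.lt (\<iota> x) w \<or> (\<exists>u. left u w (\<iota> x))" by (auto simp: B_def before_def)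
    then show "w \<in> BL x \<union> {w \<in> T'. Q.lt (\<iota> x) w}"
    proof (elim disjE exE)
      fix u assume l: "left u w (\<iota> x)"
      have "u \<noteq> x"
      proof
        assume "u = x"
        then have "\<exists>E\<in>U x. \<iota> x \<in> C x E" using l unfolding left_def by blast
        then show False using C_props(4)[OF x] by (auto simp: Q.lt_def)
      qed
      then show ?thesis
        using left_split[OF x iota_in[OF x] Q.le_refl[OF iota_in[OF x]] l] wT by auto
    qed simp
  next
    fix w assume "w \<in> BL x \<union> {w \<in> T'. Q.lt (\<iota> x) w}"
    then show "w \<in> B (\<iota> x)"
      using BL_left[OF x iota_in[OF x] Q.le_refl[OF iota_in[OF x]]] by (auto simp: B_def before_def)
  qed
  moreover have "BL x \<inter> {w \<in> T'. Q.lt (\<iota> x) w} = {}" using BL_not_above[OF x] by (auto simp: Q.lt_def)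
  ultimately show ?thesis
    unfolding F_def p_def using mass_BL[OF x] mass_lt[OF x] lt_sets[OF iota_in[OF x]]
    by (simp add: M.finite_measure_Union)
qed

text \<open>Everything in \<open>BL v\<close> and in the earlier components at \<open>v\<close>
  precedes \<open>z\<close>, and whatever precedes \<open>z\<close> lies there or in
  \<open>C v A\<close>.\<close>

lemma F_cell:
  assumes v: "v \<in> V" "A \<in> U v" and z: "z \<in> C v A"
  shows "lo v A \<le> F z" "F z + measure M' {z} \<le> hi v A"
proof -
  have zT: "z \<in> T'" using C_props(3)[OF v] z by auto
  have vz: "Q.le (\<iota> v) z" using C_props(4)[OF v z] by (simp add: Q.lt_def)
  define W where "W = BL v \<union> (\<Union>E\<in>{E \<in> U v. idx E < idx A}. C v E)"
  have dis: "BL v \<inter> (\<Union>E\<in>{E \<in> U v. idx E < idx A}. C v E) = {}"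
    using BL_not_above[OF v(1)] C_props(4)[OF v(1)] by (auto simp: Q.lt_def)
  have W: "W \<in> sets M'" "measure M' W = lo v A"
    unfolding W_def lo_def pre_def using mass_BL[OF v(1)] mass_initial_cells[OF v(1), of "idx A"] dis
    by (auto simp: M.finite_measure_Union)
  have sub: "W \<subseteq> B z"
  proof
    fix w assume "w \<in> W"
    then consider "w \<in> BL v" | E where "E \<in> U v" "idx E < idx A" "w \<in> C v E" by (auto simp: W_def)
    then show "w \<in> B z"
    proof cases
      case 1
      then show ?thesis using BL_left[OF v(1) zT vz] by simp
    next
      case (2 E)
      then have "left v w z" unfolding left_def using v z by blast
      then show ?thesis using C_props(3)[OF v(1) 2(1)] 2 by (auto simp: B_def before_def)
    qed
  qed
  then show "lo v A \<le> F z"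
    unfolding F_def W(2)[symmetric] by (intro M.finite_measure_mono B_sets[OF zT])
  have sup: "B z \<union> {z} \<subseteq> W \<union> C v A"
  proof
    fix w assume "w \<in> B z \<union> {z}"
    then have wT: "w \<in> T'" and "w = z \<or> Q.lt z w \<or> (\<exists>u. left u w z)" using zT by (auto simp: B_def before_def)
    then show "w \<in> W \<union> C v A"
    proof (elim disjE exE)
      assume "Q.lt z w"
      then show ?thesis
        using C_mono[OF v wT zT C_props(4)[OF v z]] z by (simp add: Q.lt_def)
    next
      fix u assume l: "left u w z"
      then consider "w \<in> BL v" | "u = v" | "w \<in> C v A" using left_split[OF v(1) zT vz l] v z by blast
      then show ?thesis
      proof cases
        case 2
        then obtain E E' where E: "E \<in> U v" "E' \<in> U v" "w \<in> C v E" "z \<in> C v E'" "idx E < idx E'"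
          using l unfolding left_def by blast
        then have "E' = A" using C_unique[OF v(1) E(2) v(2) E(4) z] by simp
        then show ?thesis using E by (auto simp: W_def)
      qed (simp_all add: W_def)
    qed (use z in simp)
  qed
  have "measure M' (B z \<union> {z}) = F z + measure M' {z}"
    unfolding F_def using B_sets[OF zT] sing_sets[OF zT] before_irrefl
    by (intro M.finite_measure_Union) (auto simp: B_def)
  moreover have "measure M' (B z \<union> {z}) \<le> measure M' (W \<union> C v A)"
    using sup W C_props(1)[OF v] by (intro M.finite_measure_mono) auto
  moreover have "measure M' (W \<union> C v A) \<le> measure M' W + measure M' (C v A)"
    using W C_props(1)[OF v] by (intro measure_Un_le)
  ultimately show "F z + measure M' {z} \<le> hi v A"
    using W(2) C_props(2)[OF v] by (simp add: hi_def)
qed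

end

section \<open>The position map of a realization\<close>

lemma countable_at_most_one:
  assumes "\<And>x y. x \<in> X \<Longrightarrow> y \<in> X \<Longrightarrow> x = y" shows "countable X"
proof (cases "X = {}")
  case False
  then obtain x where "x \<in> X" by auto
  then have "X \<subseteq> {x}" using assms by auto
  then show ?thesis by (rule countable_subset) simp
qed simp

context realization begin

lemma F_nonneg: "0 \<le> F z" by (simp add: F_def)

lemma F_le_Z: "F z \<le> Z"
  using M.bounded_measure[of "B z"] mass space_M by (simp add: F_def)

lemma F_mono: "w \<in> T0 \<Longrightarrow> z \<in> T0 \<Longrightarrow> before w z \<Longrightarrow> F w \<le> F z"
  using B_mono(3)[of w z] measure_nonneg[of M' "{w}"] by linarith

lemma not_in_B:
  assumes "z \<in> T0" "e \<in> T0" shows "z \<notin> B e \<longleftrightarrow> z = e \<or> before e z"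
proof -
  have "z \<in> B e \<longleftrightarrow> before z e" using assms T0_sub by (simp add: B_def)
  moreover have "\<not> (before z e \<and> before e z)"
    using before_trans[OF T0_sub[OF assms(1)] assms(2,1)] before_irrefl by blast
  ultimately show ?thesis using before_total[OF assms] before_irrefl by blast
qed

text \<open>A point of \<open>L\<close> that is not last has a later point in \<open>L\<close>, and
  \<open>before_between\<close> puts a point of \<open>D\<close> between the two, ends allowed. Only
  a last element, of which there is at most one, has to be added to \<open>D\<close>. Hence every
  initial segment is measurable.\<close>

lemma initial_cover:
  assumes L: "L \<subseteq> T0" and down: "\<And>z w. z \<in> L \<Longrightarrow> w \<in> T0 \<Longrightarrow> before w z \<Longrightarrow> w \<in> L"
  obtains E where "countable E" "E \<subseteq> L" "L = (\<Union>e\<in>E. insert e (B e) \<inter> T0)"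
proof
  define E where "E = (D \<inter> L) \<union> {e \<in> L. \<forall>z\<in>L. z = e \<or> before z e}"
  have "countable {e \<in> L. \<forall>z\<in>L. z = e \<or> before z e}"
  proof (rule countable_at_most_one, rule ccontr)
    fix e e' assume e: "e \<in> {e \<in> L. \<forall>z\<in>L. z = e \<or> before z e}" "e' \<in> {e \<in> L. \<forall>z\<in>L. z = e \<or> before z e}" and "e \<noteq> e'"
    then have "before e e'" "before e' e" "e \<in> T0" "e' \<in> T0" using L by auto
    then show False using before_trans[of e e' e] before_irrefl T0_sub by blast
  qed
  then show "countable E" unfolding E_def using Q.D_countable by (simp add: countable_Int1)
  show EL: "E \<subseteq> L" by (auto simp: E_def)
  show "L = (\<Union>e\<in>E. insert e (B e) \<inter> T0)"
  proof (intro equalityI subsetI)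
    fix z assume z: "z \<in> L"
    then have zT0: "z \<in> T0" using L by auto
    show "z \<in> (\<Union>e\<in>E. insert e (B e) \<inter> T0)"
    proof (cases "\<forall>w\<in>L. w = z \<or> before w z")
      case True
      then have "z \<in> E" using z by (simp add: E_def)
      then show ?thesis using zT0 by auto
    next
      case False
      then obtain w where w: "w \<in> L" "w \<noteq> z" "\<not> before w z" by blast
      have wT0: "w \<in> T0" using w L by auto
      then have bz: "before z w" using before_total[OF zT0 wT0] w by auto
      obtain d where d: "d \<in> D" "d \<in> T0" "d = z \<or> before z d" "d = w \<or> before d w"
        by (rule before_between[OF zT0 wT0 bz])
      have "d \<in> L" using d down[OF w(1)] w(1) by auto
      then have "d \<in> E" using d by (simp add: E_def)
      moreover have "z \<in> insert d (B d) \<inter> T0" using d zT0 T0_sub by (auto simp: B_def)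
      ultimately show ?thesis by blast
    qed
  next
    fix z assume "z \<in> (\<Union>e\<in>E. insert e (B e) \<inter> T0)"
    then obtain e where "e \<in> L" "z \<in> T0" "z = e \<or> before z e" using EL by (auto simp: B_def)
    then show "z \<in> L" using down by blast
  qed
qed

lemma final_cover:
  assumes L: "L \<subseteq> T0" and up: "\<And>z w. z \<in> L \<Longrightarrow> w \<in> T0 \<Longrightarrow> before z w \<Longrightarrow> w \<in> L"
  obtains E where "countable E" "E \<subseteq> L" "L = (\<Union>e\<in>E. T0 - B e)"
proof
  define E where "E = (D \<inter> L) \<union> {e \<in> L. \<forall>z\<in>L. z = e \<or> before e z}"
  have "countable {e \<in> L. \<forall>z\<in>L. z = e \<or> before e z}"
  proof (rule countable_at_most_one, rule ccontr)
    fix e e' assume e: "e \<in> {e \<in> L. \<forall>z\<in>L. z = e \<or> before e z}" "e' \<in> {e \<in> L. \<forall>z\<in>L. z = e \<or> before e z}" and "e \<noteq> e'"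
    then have "before e e'" "before e' e" "e \<in> T0" "e' \<in> T0" using L by auto
    then show False using before_trans[of e e' e] before_irrefl T0_sub by blast
  qed
  then show "countable E" unfolding E_def using Q.D_countable by (simp add: countable_Int1)
  show EL: "E \<subseteq> L" by (auto simp: E_def)
  show "L = (\<Union>e\<in>E. T0 - B e)"
  proof (intro equalityI subsetI)
    fix z assume z: "z \<in> L"
    then have zT0: "z \<in> T0" using L by auto
    show "z \<in> (\<Union>e\<in>E. T0 - B e)"
    proof (cases "\<forall>w\<in>L. w = z \<or> before z w")
      case True
      then have "z \<in> E" using z by (simp add: E_def)
      then show ?thesis using zT0 not_in_B[OF zT0 zT0] by auto
    next
      case False
      then obtain w where w: "w \<in> L" "w \<noteq> z" "\<not> before z w" by blast
      have wT0: "w \<in> T0" using w L by auto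
      then have bz: "before w z" using before_total[OF zT0 wT0] w by auto
      obtain d where d: "d \<in> D" "d \<in> T0" "d = w \<or> before w d" "d = z \<or> before d z"
        by (rule before_between[OF wT0 zT0 bz])
      have "d \<in> L" using d up[OF w(1)] w(1) by auto
      then have "d \<in> E" using d by (simp add: E_def)
      moreover have "z \<in> T0 - B d" using d zT0 not_in_B[OF zT0 d(2)] by auto
      ultimately show ?thesis by blast
    qed
  next
    fix z assume "z \<in> (\<Union>e\<in>E. T0 - B e)"
    then obtain e where e: "e \<in> L" "z \<in> T0" "z \<notin> B e" using EL by auto
    then have "z = e \<or> before e z" using not_in_B[OF e(2)] L by blast
    then show "z \<in> L" using up e by blast
  qed
qed

lemma piece_sets: "e \<in> T0 \<Longrightarrow> insert e (B e) \<inter> T0 \<in> sets M'" "e \<in> T0 \<Longrightarrow> T0 - B e \<in> sets M'"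
proof -
  assume e: "e \<in> T0"
  have "{e} \<union> B e \<in> sets M'" using B_sets[OF T0_sub[OF e]] sing_sets[OF T0_sub[OF e]] by (rule sets.Un[rotated])
  then show "insert e (B e) \<inter> T0 \<in> sets M'" using T0_null by simp
  show "T0 - B e \<in> sets M'" using B_sets[OF T0_sub[OF e]] T0_null by simp
qed

lemma initial_sets:
  assumes "L \<subseteq> T0" "\<And>z w. z \<in> L \<Longrightarrow> w \<in> T0 \<Longrightarrow> before w z \<Longrightarrow> w \<in> L"
  shows "L \<in> sets M'"
proof -
  obtain E where E: "countable E" "E \<subseteq> L" "L = (\<Union>e\<in>E. insert e (B e) \<inter> T0)"
    by (rule initial_cover[OF assms]) auto
  have "insert e (B e) \<inter> T0 \<in> sets M'" if "e \<in> E" for e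
    using piece_sets(1) that E(2) assms(1) by blast
  then have "(\<Union>e\<in>E. insert e (B e) \<inter> T0) \<in> sets M'"
    by (intro sets.countable_UN' E(1) image_subsetI)
  then show ?thesis using E(3) by simp
qed

lemma F_less_sets: "{z \<in> T0. F z < s} \<in> sets M'"
proof (rule initial_sets)
  fix z w assume "z \<in> {z \<in> T0. F z < s}" "w \<in> T0" "before w z"
  then show "w \<in> {z \<in> T0. F z < s}" using F_mono[of w z] by auto
qed auto

lemma F_le_sets: "{z \<in> T0. F z \<le> s} \<in> sets M'"
proof (rule initial_sets)
  fix z w assume "z \<in> {z \<in> T0. F z \<le> s}" "w \<in> T0" "before w z"
  then show "w \<in> {z \<in> T0. F z \<le> s}" using F_mono[of w z] by auto
qed auto

lemma measure_T0:
  assumes "X \<in> sets M'" shows "measure M' (T0 \<inter> X) = measure M' X"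
proof -
  have "measure M' (T' - T0) = 0"
    using M.finite_measure_compl[OF T0_null(1)] T0_null(2) mass space_M by simp
  moreover have "measure M' (X - T0) \<le> measure M' (T' - T0)"
    using assms T0_null T_sets sets.sets_into_space[OF assms] space_M
    by (intro M.finite_measure_mono) auto
  ultimately have "measure M' (X - T0) = 0" using measure_nonneg[of M' "X - T0"] by simp
  moreover have "measure M' (X - T0) = measure M' X - measure M' (X \<inter> T0)"
    using M.finite_measure_Diff'[OF assms T0_null(1)] .
  ultimately show ?thesis by (simp add: Int_commute)
qed

section \<open>A subset of full measure on which positions are injective\<close>

definition R :: "real set" where "R = F ` (D \<inter> T0) \<union> p ` V \<union> (\<Union>v\<in>V. hi v ` U v)"

lemma countable_R: "countable R"
  unfolding R_def using Q.D_countable countable_V countable_U by (simp add: countable_Int1)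

text \<open>Each excluded family of values serves a purpose: the values on \<open>D\<close>
  injectivity, the positions of \<open>V\<close> strict inequalities at atoms, and the right ends
  \<open>hi\<close> the half-open form of the intervals.\<close>

definition AA :: "'b set" where "AA = \<iota> ` V \<union> {z \<in> T0. F z \<notin> R}"

lemma AA_T0: "z \<in> AA \<Longrightarrow> z \<in> T0"
  using iota_T0 by (auto simp: AA_def)

lemma AA_T: "z \<in> AA \<Longrightarrow> z \<in> T'"
  using AA_T0 T0_sub by blast

lemma iota_sets: "\<iota> ` V \<in> sets M'"
proof -
  have "(\<Union>x\<in>V. {\<iota> x}) \<in> sets M'"
    by (intro sets.countable_UN' countable_V image_subsetI sing_sets iota_in)
  moreover have "(\<Union>x\<in>V. {\<iota> x}) = \<iota> ` V" by auto
  ultimately show ?thesis by simp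
qed

text \<open>Members \<open>e\<close> and \<open>e'\<close> of the two covers satisfy
  \<open>F e \<le> s \<le> F e'\<close>. If \<open>e'\<close> precedes or equals \<open>e\<close>,
  the points from \<open>e'\<close> up to but excluding \<open>e\<close> then have mass zero, and
  \<open>e\<close> itself is null unless it comes from \<open>V\<close>. Countably many such pieces
  cover the level set off \<open>V\<close>.\<close>

lemma level_null: "{z \<in> T0. F z = s} - \<iota> ` V \<in> null_sets M'"
proof -
  define L where "L = {z \<in> T0. F z \<le> s}"
  define L' where "L' = {z \<in> T0. s \<le> F z}"
  obtain E where E: "countable E" "E \<subseteq> L" "L = (\<Union>e\<in>E. insert e (B e) \<inter> T0)"
  proof (rule initial_cover[of L])
    fix z w assume "z \<in> L" "w \<in> T0" "before w z"
    then show "w \<in> L" unfolding L_def using F_mono[of w z] by auto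
  qed (auto simp: L_def)
  obtain E' where E': "countable E'" "E' \<subseteq> L'" "L' = (\<Union>e\<in>E'. T0 - B e)"
  proof (rule final_cover[of L'])
    fix z w assume "z \<in> L'" "w \<in> T0" "before z w"
    then show "w \<in> L'" unfolding L'_def using F_mono[of z w] by auto
  qed (auto simp: L'_def)
  define N where "N = (\<lambda>e e'. if e' = e \<or> before e' e then (B e - B e') \<union> ({e} - \<iota> ` V) else {})"
  have N: "N e e' \<in> null_sets M'" if ee: "e \<in> E" "e' \<in> E'" for e e'
  proof (cases "e' = e \<or> before e' e")
    case True
    have e: "e \<in> T0" "F e \<le> s" and e': "e' \<in> T0" "s \<le> F e'" using ee E E' unfolding L_def L'_def by auto
    have sub: "B e' \<subseteq> B e" using True B_mono(1)[OF e'(1) e(1)] by auto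
    then have "F e' \<le> F e" unfolding F_def using B_sets[OF T0_sub[OF e(1)]] by (intro M.finite_measure_mono)
    then have "measure M' (B e - B e') = 0"
      using M.finite_measure_Diff[OF B_sets[OF T0_sub[OF e(1)]] B_sets[OF T0_sub[OF e'(1)]] sub] e e'
      by (simp add: F_def)
    then have 1: "B e - B e' \<in> null_sets M'"
      using B_sets[OF T0_sub[OF e(1)]] B_sets[OF T0_sub[OF e'(1)]] by (auto simp: null_sets_def M.emeasure_eq_measure)
    have 2: "{e} - \<iota> ` V \<in> null_sets M'"
    proof (cases "e \<in> \<iota> ` V")
      case False
      then have "{e} - \<iota> ` V = {e}" by auto
      moreover have "{e} \<in> null_sets M'"
        using no_atom[OF T0_sub[OF e(1)] False] sing_sets[OF T0_sub[OF e(1)]]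
        by (auto simp: null_sets_def M.emeasure_eq_measure)
      ultimately show ?thesis by simp
    qed simp
    show ?thesis using True null_sets.Un[OF 1 2] by (simp only: N_def if_True)
  qed (simp add: N_def)
  have "{z \<in> T0. F z = s} - \<iota> ` V \<subseteq> (\<Union>e\<in>E. \<Union>e'\<in>E'. N e e')"
  proof
    fix z assume z: "z \<in> {z \<in> T0. F z = s} - \<iota> ` V"
    then have "z \<in> L" "z \<in> L'" by (auto simp: L_def L'_def)
    then obtain e e' where e: "e \<in> E" "z \<in> insert e (B e)" and e': "e' \<in> E'" "z \<notin> B e'" using E(3) E'(3) by blast
    have T0: "z \<in> T0" "e \<in> T0" "e' \<in> T0" using z e e' E(2) E'(2) by (auto simp: L_def L'_def)
    have ze: "z = e \<or> before z e" using e by (auto simp: B_def)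
    have ze': "z = e' \<or> before e' z" using not_in_B[OF T0(1,3)] e' by simp
    have "e' = e \<or> before e' e" using ze ze' before_trans[OF T0_sub[OF T0(3)] T0(1,2)] by auto
    moreover have "z \<in> (B e - B e') \<union> ({e} - \<iota> ` V)" using e e' z by auto
    ultimately have "z \<in> N e e'" by (simp add: N_def)
    then show "z \<in> (\<Union>e\<in>E. \<Union>e'\<in>E'. N e e')" using e e' by blast
  qed
  moreover have "(\<Union>e\<in>E. \<Union>e'\<in>E'. N e e') \<in> null_sets M'"
    using E(1) E'(1) N by (intro null_sets_UN') auto
  moreover have "{z \<in> T0. F z = s} - \<iota> ` V \<in> sets M'"
  proof -
    have "{z \<in> T0. F z = s} = {z \<in> T0. F z \<le> s} - {z \<in> T0. F z < s}" by auto
    then show ?thesis using F_le_sets[of s] F_less_sets[of s] iota_sets by simp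
  qed
  ultimately show ?thesis using null_sets_subset by blast
qed

lemma AA_null: "T0 - AA \<in> null_sets M'"
proof -
  have "T0 - AA = (\<Union>s\<in>R. {z \<in> T0. F z = s} - \<iota> ` V)" by (auto simp: AA_def)
  moreover have "(\<Union>s\<in>R. {z \<in> T0. F z = s} - \<iota> ` V) \<in> null_sets M'"
    by (intro null_sets_UN' countable_R level_null)
  ultimately show ?thesis by (simp only:)
qed

lemma AA_sets: "AA \<in> sets M'"
proof -
  have "AA = T0 - (T0 - AA)" using AA_T0 by auto
  moreover have "T0 - (T0 - AA) \<in> sets M'" using AA_null T0_null by auto
  ultimately show ?thesis by simp
qed

lemma measure_AA:
  assumes "X \<in> sets M'" shows "measure M' (AA \<inter> X) = measure M' X"
proof -
  have sub: "AA \<subseteq> T0" using AA_T0 by auto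
  have "measure M' ((T0 \<inter> X) - (T0 - AA)) = measure M' (T0 \<inter> X)"
    by (rule measure_Diff_null_set) (use AA_null assms T0_null in auto)
  moreover have "(T0 \<inter> X) - (T0 - AA) = AA \<inter> X" using sub by auto
  ultimately show ?thesis using measure_T0[OF assms] by simp
qed

lemma AA_mass: "measure M' AA = Z"
  using measure_AA[OF T_sets] mass AA_T by (metis Int_absorb2 subsetI)

text \<open>Each covering piece of the initial segment has mass \<open>F e\<close> plus the mass of
  \<open>e\<close>; this stays at most \<open>s\<close> even at an atom, because \<open>s\<close> is
  not inside its gap. The dual estimate for the complementary final segment gives the other
  inequality.\<close>

lemma F_dist_no_gap:
  assumes s: "0 \<le> s" "s \<le> Z" and gap: "\<And>x. x \<in> V \<Longrightarrow> \<not> (p x < s \<and> s < b x)"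
  shows "measure M' {z \<in> T0. F z < s} = s"
proof (rule antisym)
  let ?L = "{z \<in> T0. F z < s}" and ?L' = "{z \<in> T0. s \<le> F z}"
  obtain E where E: "countable E" "E \<subseteq> ?L" "?L = (\<Union>e\<in>E. insert e (B e) \<inter> T0)"
  proof (rule initial_cover[of ?L])
    fix z w assume "z \<in> ?L" "w \<in> T0" "before w z"
    then show "w \<in> ?L" using F_mono[of w z] by auto
  qed auto
  have "measure M' (\<Union>e\<in>E. insert e (B e) \<inter> T0) \<le> s"
  proof (rule M.measure_chain_Union_le[OF E(1) _ _ _ s(1)])
    fix e assume "e \<in> E"
    then have e: "e \<in> T0" "F e < s" using E by auto
    show "insert e (B e) \<inter> T0 \<in> sets M'" using piece_sets e by simp
    have eB: "{e} \<union> B e \<in> sets M'" using B_sets[OF T0_sub[OF e(1)]] sing_sets[OF T0_sub[OF e(1)]] by (rule sets.Un[rotated])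
    have "measure M' (insert e (B e) \<inter> T0) \<le> measure M' ({e} \<union> B e)"
      using eB by (intro M.finite_measure_mono) auto
    also have "\<dots> \<le> measure M' {e} + measure M' (B e)"
      using B_sets[OF T0_sub[OF e(1)]] sing_sets[OF T0_sub[OF e(1)]] by (intro measure_Un_le)
    also have "\<dots> \<le> s"
    proof (cases "e \<in> \<iota> ` V")
      case True
      then obtain x where x: "x \<in> V" "e = \<iota> x" by auto
      then have "p x < s" using e F_iota by simp
      then have "b x \<le> s" using gap[OF x(1)] by simp
      then show ?thesis using x F_iota[OF x(1)] mass_iota[OF x(1)] by (simp add: F_def b_def p_def m_def)
    next
      case False
      then show ?thesis using no_atom[OF T0_sub[OF e(1)] False] e by (simp add: F_def)
    qed
    finally show "measure M' (insert e (B e) \<inter> T0) \<le> s" .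
  next
    fix e e' assume "e \<in> E" "e' \<in> E"
    then have "e \<in> T0" "e' \<in> T0" using E by auto
    then show "insert e (B e) \<inter> T0 \<subseteq> insert e' (B e') \<inter> T0 \<or> insert e' (B e') \<inter> T0 \<subseteq> insert e (B e) \<inter> T0"
      using before_total[of e e'] B_mono(1)[of e e'] B_mono(1)[of e' e] by blast
  qed
  then show "measure M' ?L \<le> s" using E(3) by simp
  obtain E' where E': "countable E'" "E' \<subseteq> ?L'" "?L' = (\<Union>e\<in>E'. T0 - B e)"
  proof (rule final_cover[of ?L'])
    fix z w assume "z \<in> ?L'" "w \<in> T0" "before z w"
    then show "w \<in> ?L'" using F_mono[of z w] by auto
  qed auto
  have Zs: "0 \<le> Z - s" using s by simp
  have "measure M' (\<Union>e\<in>E'. T0 - B e) \<le> Z - s"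
  proof (rule M.measure_chain_Union_le[OF E'(1) _ _ _ Zs])
    fix e assume "e \<in> E'"
    then have e: "e \<in> T0" "s \<le> F e" using E' by auto
    show "T0 - B e \<in> sets M'" using piece_sets e by simp
    have "measure M' (T0 - B e) = Z - F e"
      using M.finite_measure_Diff'[OF T0_null(1) B_sets[OF T0_sub[OF e(1)]]] T0_null(2)
        measure_T0[OF B_sets[OF T0_sub[OF e(1)]]] by (simp add: F_def)
    then show "measure M' (T0 - B e) \<le> Z - s" using e by simp
  next
    fix e e' assume "e \<in> E'" "e' \<in> E'"
    then have "e \<in> T0" "e' \<in> T0" using E' by auto
    then show "T0 - B e \<subseteq> T0 - B e' \<or> T0 - B e' \<subseteq> T0 - B e"
      using before_total[of e e'] B_mono(1)[of e e'] B_mono(1)[of e' e] by blast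
  qed
  then have "measure M' ?L' \<le> Z - s" using E'(3) by simp
  moreover have "measure M' (T0 - ?L) = Z - measure M' ?L"
    using M.finite_measure_Diff[OF T0_null(1) F_less_sets[of s]] T0_null(2) by auto
  moreover have "T0 - ?L = ?L'" by auto
  ultimately show "s \<le> measure M' ?L" by simp
qed

text \<open>For points before \<open>\<iota> x\<close> the inequality is strict: if \<open>z\<close>
  comes from \<open>V\<close>, its atom makes it so, and otherwise \<open>p x\<close> is an excluded
  value.\<close>

lemma F_AA_gap:
  assumes "z \<in> AA" "x \<in> V" "z \<noteq> \<iota> x" shows "F z < p x \<or> b x \<le> F z" "before z (\<iota> x) \<Longrightarrow> F z < p x"
    "before (\<iota> x) z \<Longrightarrow> b x \<le> F z"
proof -
  have z: "z \<in> T0" and x: "\<iota> x \<in> T0" using AA_T0 iota_T0 assms by auto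
  show 1: "b x \<le> F z" if "before (\<iota> x) z"
    using B_mono(3)[OF x z that] F_iota[OF assms(2)] mass_iota[OF assms(2)] by (simp add: b_def p_def m_def)
  show 2: "F z < p x" if bz: "before z (\<iota> x)"
  proof -
    have le: "F z + measure M' {z} \<le> p x" using B_mono(3)[OF z x bz] F_iota[OF assms(2)] by simp
    show ?thesis
    proof (cases "z \<in> \<iota> ` V")
      case True
      then obtain y where y: "y \<in> V" "z = \<iota> y" by auto
      then have "0 < measure M' {z}" using mass_iota atom_pos by simp
      then show ?thesis using le by simp
    next
      case False
      then have "F z \<notin> R" using assms(1) by (auto simp: AA_def)
      then have "F z \<noteq> p x" using assms(2) by (auto simp: R_def)
      then show ?thesis using le measure_nonneg[of M' "{z}"] by linarith
    qed
  qed
  show "F z < p x \<or> b x \<le> F z" using 1 2 before_total[OF z x assms(3)] by blast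
qed

lemma F_AA_not_gap: "z \<in> AA \<Longrightarrow> x \<in> V \<Longrightarrow> \<not> (p x < F z \<and> F z < b x)"
  using F_AA_gap(1)[of z x] F_iota[of x] by (cases "z = \<iota> x") auto

lemma F_AA_J:
  assumes z: "z \<in> AA" and v: "v \<in> V" "A \<in> U v" "z \<in> C v A" shows "F z \<in> J v A"
proof (cases "z \<in> \<iota> ` V")
  case True
  then obtain y where y: "y \<in> V" "z = \<iota> y" by auto
  then have "y \<in> A" using C_iota[OF v(1,2) y(1)] v by simp
  then show ?thesis using p_in_J[OF y(1) v(1,2)] F_iota y by simp
next
  case False
  then have "F z \<notin> R" using z by (auto simp: AA_def)
  then have "F z \<noteq> hi v A" using v by (auto simp: R_def)
  moreover have "lo v A \<le> F z" "F z \<le> hi v A"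
    using F_cell[OF v] measure_nonneg[of M' "{z}"] by linarith+
  ultimately show ?thesis by (simp add: J_mem)
qed

lemma F_AA_J_iff:
  assumes z: "z \<in> AA" and v: "v \<in> V" "A \<in> U v" shows "F z \<in> J v A \<longleftrightarrow> z \<in> C v A"
proof
  assume FJ: "F z \<in> J v A"
  note Fv = J_sub[OF v FJ]
  have zT0: "z \<in> T0" using AA_T0 z by simp
  have "z \<noteq> \<iota> v" using Fv F_iota[OF v(1)] by auto
  moreover have "\<not> before (\<iota> v) z"
    using F_AA_gap(3)[OF z v(1)] Fv p_less_b[OF v(1)] \<open>z \<noteq> \<iota> v\<close> by force
  ultimately have "before z (\<iota> v)" using before_total[OF zT0 iota_T0[OF v(1)]] by blast
  then consider "Q.lt (\<iota> v) z" | u where "left u z (\<iota> v)" by (auto simp: before_def)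
  then show "z \<in> C v A"
  proof cases
    case 1
    then obtain E where E: "E \<in> U v" "z \<in> C v E" using T0_cell[OF zT0 v(1)] by blast
    then have "F z \<in> J v E" using F_AA_J z v by simp
    then show ?thesis using J_unique[OF v E(1) FJ] E by simp
  next
    \<comment> \<open>A branching to the left of the path to \<open>v\<close> would put the value
      into an interval that ends before the block of \<open>v\<close> begins.\<close>
    case (2 u)
    then obtain E E' where u: "u \<in> V" "E \<in> U u" "E' \<in> U u" "z \<in> C u E" "\<iota> v \<in> C u E'" "idx E < idx E'"
      unfolding left_def by blast
    have "F z < hi u E" using F_AA_J[OF z u(1,2,4)] by (simp add: J_mem)
    moreover have "hi u E \<le> lo u E'" using hi_le_lo u by simp
    moreover have "v \<in> E'" using C_iota[OF u(1,3) v(1)] u(5) by simp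
    then have "lt u v" "S u v = E'" using U_memD[OF u(1,3)] by auto
    then have "lo u E' \<le> a v" using cell_nested(1)[OF u(1) v(1)] by auto
    ultimately show ?thesis using Fv by simp
  qed
qed (use F_AA_J assms in blast)

lemma F_in_G:
  assumes z: "z \<in> AA" shows "F z \<in> G"
proof (cases "z \<in> \<iota> ` V")
  case True
  then show ?thesis using F_iota p_in_G by auto
next
  case False
  have zT0: "z \<in> T0" using AA_T0 z by simp
  have nR: "F z \<notin> R" using z False by (auto simp: AA_def)
  have gap: "\<not> (p x \<le> F z \<and> F z < b x)" if x: "x \<in> V" for x
    using F_AA_gap(1)[OF z x] False x by force
  have "z \<noteq> \<iota> r" using False root_in by auto
  \<comment> \<open>Nothing follows the root in the exploration order.\<close>
  moreover have "\<not> before (\<iota> r) z"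
  proof
    assume "before (\<iota> r) z"
    then consider "Q.lt z (\<iota> r)" | v A where "v \<in> V" "A \<in> U v" "\<iota> r \<in> C v A"
      unfolding before_def left_def by blast
    then obtain y where "y \<in> T'" "Q.lt y (\<iota> r)" using C_props(4) iota_in T0_sub[OF zT0] by metis
    then show False using Q.lt_not_le[OF _ Q.root_in] Q.root_le by blast
  qed
  ultimately have "before z (\<iota> r)" using before_total[OF zT0 iota_T0[OF root_in]] by blast
  then have "F z < Z" using F_AA_gap(2)[OF z root_in \<open>z \<noteq> \<iota> r\<close>] p_bounds(2)[OF root_in] by simp
  moreover have "leftcov (F z)" unfolding leftcov_def
  proof (intro ballI impI)
    fix x assume x: "x \<in> V" "F z < a x"
    have zx: "z \<noteq> \<iota> x" using False x by auto
    have "\<not> before (\<iota> x) z" using F_AA_gap(3)[OF z x(1) zx] x a_le_p[OF x(1)] p_less_b[OF x(1)] by force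
    then have "before z (\<iota> x)" using before_total[OF zT0 iota_T0[OF x(1)] zx] by blast
    then consider "Q.lt (\<iota> x) z" | u where "left u z (\<iota> x)" by (auto simp: before_def)
    then show "\<exists>v\<in>V. \<exists>A\<in>U v. lt v x \<and> F z \<in> J v A \<and> x \<notin> A"
    proof cases
      case 1
      then obtain E where E: "E \<in> U x" "z \<in> C x E" using T0_cell[OF zT0 x(1)] by blast
      then have "a x \<le> F z" using F_cell(1)[OF x(1) E] a_le_lo[OF x(1), of E] by simp
      then show ?thesis using x by simp
    next
      case (2 u)
      then obtain E E' where u: "u \<in> V" "E \<in> U u" "E' \<in> U u" "z \<in> C u E" "\<iota> x \<in> C u E'" "idx E < idx E'"
        unfolding left_def by blast
      have xE': "x \<in> E'" using C_iota[OF u(1,3) x(1)] u(5) by simp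
      then have "lt u x" using U_memD[OF u(1,3)] by auto
      moreover have "x \<notin> E" using U_disjoint[OF u(1,2,3) _ xE'] u(6) by auto
      moreover have "F z \<in> J u E" by (rule F_AA_J[OF z u(1,2,4)])
      ultimately show ?thesis using u by blast
    qed
  qed
  ultimately show ?thesis using gap F_nonneg[of z] by (simp add: G_def)
qed

lemma F_le_iff:
  assumes z: "z \<in> AA" and w: "w \<in> AA" shows "leG (F z) (F w) \<longleftrightarrow> Q.le z w"
proof
  have T0: "z \<in> T0" "w \<in> T0" using AA_T0 z w by auto
  note T = T0_sub[OF T0(1)] T0_sub[OF T0(2)]
  {
    assume le: "Q.le z w"
    show "leG (F z) (F w)"
    proof (cases "z = w")
      case False
      then have "before w z" using le by (auto simp: before_def Q.lt_def)
      then have "F w \<le> F z" using F_mono T0 by simp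
      moreover have "F w \<in> J v A" if v: "v \<in> V" "A \<in> U v" "F z \<in> J v A" for v A
      proof -
        have "z \<in> C v A" using F_AA_J_iff[OF z v(1,2)] v by simp
        then have "w \<in> C v A" using C_mono[OF v(1,2) T(2,1) _ le] C_props(4)[OF v(1,2)] by blast
        then show ?thesis using F_AA_J_iff[OF w v(1,2)] by simp
      qed
      ultimately show ?thesis by (simp add: leG_def)
    qed (simp add: leG_refl)
  }
  assume le: "leG (F z) (F w)"
  show "Q.le z w"
  proof (rule ccontr)
    assume n: "\<not> Q.le z w"
    then have ne: "z \<noteq> w" using T by auto
    have "\<not> before z w"
    proof
      assume bz: "before z w"
      have "F z + measure M' {z} \<le> F w" by (rule B_mono(3)[OF T0 bz])
      moreover have "F w \<le> F z" using le by (simp add: leG_def)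
      ultimately have eq: "F z = F w" "measure M' {z} \<le> 0" using measure_nonneg[of M' "{z}"] by linarith+
      \<comment> \<open>Since \<open>F\<close> does not increase from \<open>z\<close> to
        \<open>w\<close>, it takes the same value at \<open>d\<close>. On \<open>AA\<close> values
        attained on \<open>D\<close> are excluded except at points of \<open>V\<close>, and those
        are atoms, across which \<open>F\<close> does increase.\<close>
      obtain d where d: "d \<in> D" "d \<in> T0" "d = z \<or> before z d" "d = w \<or> before d w"
        by (rule before_between[OF T0 bz])
      have "F z \<le> F d" "F d \<le> F w" using d F_mono[OF T0(1) d(2)] F_mono[OF d(2) T0(2)] by auto
      then have "F z = F d" using eq by simp
      then have "F z \<in> R" using d by (auto simp: R_def)
      then obtain x where "x \<in> V" "z = \<iota> x" using z by (auto simp: AA_def)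
      then show False using eq(2) mass_iota atom_pos[of x] by simp
    qed
    then have "before w z" using before_total[OF T0 ne] by blast
    then obtain v where "left v w z" using n by (auto simp: before_def Q.lt_def)
    then obtain A E where v: "v \<in> V" "A \<in> U v" "E \<in> U v" "w \<in> C v A" "z \<in> C v E" "idx A < idx E"
      unfolding left_def by blast
    have "F z \<in> J v E" using F_AA_J[OF z v(1,3,5)] .
    then have "F w \<in> J v E" using le v unfolding leG_def by blast
    then have "w \<in> C v E" using F_AA_J_iff[OF w v(1,3)] by simp
    then show False using C_unique[OF v(1,2,3,4)] v(6) by simp
  qed
qed

lemma F_inj: "z \<in> AA \<Longrightarrow> w \<in> AA \<Longrightarrow> F z = F w \<Longrightarrow> z = w"
  using F_le_iff[of z w] F_le_iff[of w z] leG_refl[of "F w"] Q.le_antisym[OF AA_T AA_T] by simp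

lemma meet_AA:
  assumes z: "z \<in> T'" "w \<in> T'" shows "Q.meet z w \<in> {z, w} \<union> \<iota> ` V"
proof (cases "Q.le z w \<or> Q.le w z")
  case True
  then show ?thesis using z Q.meet_comm[of z w] by (auto simp: Q.le_meet)
next
  case False
  then show ?thesis using meet_in_V[OF z] by auto
qed

text \<open>Medians are pairwise meets, and a meet is one of the two points or comes from
  \<open>V\<close>. So points outside the image of \<open>V\<close> may be discarded freely.\<close>

lemma subtree_AA:
  assumes "\<iota> ` V \<subseteq> A" "A \<subseteq> T'" shows "subtree T' c' A"
  unfolding subtree_def
proof (intro conjI ballI)
  show "A \<noteq> {}" using assms root_in by auto
  have m: "Q.meet x y \<in> A" if "x \<in> A" "y \<in> A" for x y
  proof -
    have "x \<in> T'" "y \<in> T'" using that assms by auto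
    then show ?thesis using meet_AA[of x y] that assms by auto
  qed
  fix x y z assume xyz: "x \<in> A" "y \<in> A" "z \<in> A"
  then have "x \<in> T'" "y \<in> T'" "z \<in> T'" using assms by auto
  from Q.c_meet[OF this] show "c' x y z \<in> A" using m xyz by simp
qed (rule assms)

text \<open>If the positions branch at \<open>v\<close>, then \<open>z\<close> and \<open>w\<close>
  lie in different components at \<open>\<iota> v\<close>, which is therefore their meet; comparable
  positions are settled by \<open>F_le_iff\<close>.\<close>

lemma F_meet:
  assumes z: "z \<in> AA" and w: "w \<in> AA" shows "F (Q.meet z w) = meetG (F z) (F w)"
proof (rule meetG_cases[OF F_in_G[OF z] F_in_G[OF w]])
  note T = AA_T[OF z] AA_T[OF w]
  assume "leG (F w) (F z)" "meetG (F z) (F w) = F w"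
  then show ?thesis using F_le_iff[OF w z] Q.meet_comm[OF T] by (simp add: Q.le_meet)
next
  assume "leG (F z) (F w)" "meetG (F z) (F w) = F z"
  then show ?thesis using F_le_iff[OF z w] by (simp add: Q.le_meet)
next
  note T = AA_T[OF z] AA_T[OF w]
  fix v assume v: "split_at v (F z) (F w)" "meetG (F z) (F w) = p v"
  then obtain A E where v': "v \<in> V" "A \<in> U v" "E \<in> U v" "A \<noteq> E" "F z \<in> J v A" "F w \<in> J v E"
    unfolding split_at_def by blast
  have zA: "z \<in> C v A" and wE: "w \<in> C v E" using F_AA_J_iff z w v' by auto
  have "w \<notin> C v A" using C_unique[OF v'(1,2,3) _ wE] v'(4) by blast
  then have "w \<notin> tree_component T' c' (\<iota> v) z" using C_props(5)[OF v'(1,2) zA] by simp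
  then have "Q.meet z w = \<iota> v"
    using Q.component_above[OF iota_in[OF v'(1)] T(1) C_props(4)[OF v'(1,2) zA]]
      C_props(4)[OF v'(1,3) wE] T by (auto simp: Q.lt_def)
  then show ?thesis using v(2) F_iota[OF v'(1)] by simp
qed

definition f :: "'b \<Rightarrow> 'a + real" where "f z = g (F z)"

lemma f_iota: "x \<in> V \<Longrightarrow> f (\<iota> x) = Inl x"
  by (simp add: f_def F_iota g_p)

lemma f_embedding: "tree_embedding AA c' TS cS f"
  unfolding tree_embedding_def tree_hom_def
proof (intro conjI ballI)
  show "f ` AA \<subseteq> TS" using F_in_G by (auto simp: f_def TS_def)
  show "inj_on f AA" using F_inj g_inj by (auto intro!: inj_onI simp: f_def inj_eq)
  fix x y z assume xyz: "x \<in> AA" "y \<in> AA" "z \<in> AA"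
  have "Q.meet u w \<in> AA" if "u \<in> AA" "w \<in> AA" for u w
    using meet_AA[OF AA_T AA_T, OF that] that by (auto simp: AA_def)
  then have m: "Q.meet x y \<in> AA" "Q.meet x z \<in> AA" "Q.meet y z \<in> AA" using xyz by auto
  have eq: "u = w \<longleftrightarrow> F u = F w" if "u \<in> AA" "w \<in> AA" for u w using F_inj that by auto
  have "F (c' x y z) = GT.median (F x) (F y) (F z)"
    using xyz AA_T unfolding GT.median_def F_meet[OF xyz(1,2), symmetric] F_meet[OF xyz(1,3), symmetric]
      F_meet[OF xyz(2,3), symmetric] eq[OF m(1,2), symmetric] eq[OF m(1,3), symmetric]
    by (simp add: Q.c_meet)
  then show "f (c' x y z) = cS (f x) (f y) (f z)"
    using TT.cT_g[OF F_in_G[OF xyz(1)] F_in_G[OF xyz(2)] F_in_G[OF xyz(3)]] by (simp add: f_def)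
qed

end

section \<open>Transport of the measure\<close>

context weighted_tree begin

lemma lam_lessThan: 
  assumes "0 \<le> s" "s \<le> Z" and gap: "\<And>x. x \<in> V \<Longrightarrow> \<not> (p x < s \<and> s < b x)"
  shows "measure lam (kap -` {..<s}) = s"
proof -
  have "saturated {..<s}" unfolding saturated_def
  proof (intro ballI allI impI)
    fix y t assume "y \<in> V" "p y \<le> t" "t < b y"
    then show "t \<in> {..<s} \<longleftrightarrow> p y \<in> {..<s}" using gap[of y] by auto
  qed
  then have "measure lam (kap -` {..<s}) = measure lam {..<s}" by (intro lam_saturated) simp
  moreover have "{0..<Z} \<inter> {..<s} = {0..<s}" using assms by auto
  ultimately show ?thesis using assms(1) by (simp add: measure_def emeasure_lam)
qed

lemma b_not_gap:
  assumes "x \<in> V" "y \<in> V" shows "\<not> (p y < b x \<and> b x < b y)"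
proof
  assume *: "p y < b x \<and> b x < b y"
  have "p x < b x" by (rule p_less_b[OF assms(1)])
  then have "p x < b y" using * by linarith
  have "x = y"
    by (rule At_unique[OF assms, of "max (p x) (p y)"]) (use * \<open>p x < b x\<close> \<open>p x < b y\<close> p_less_b[OF assms(2)] in auto)
  then show False using * by simp
qed

end

context realization begin

lemma F_dist:
  "measure M' {z \<in> AA. F z < s} = measure lam (kap -` {..<s})"
proof -
  have AAT0: "measure M' {z \<in> AA. F z < s} = measure M' {z \<in> T0. F z < s}" for s
  proof -
    have "{z \<in> AA. F z < s} = AA \<inter> {z \<in> T0. F z < s}" using AA_T0 by auto
    then show ?thesis using measure_AA[OF F_less_sets[of s]] by simp
  qed
  have main: "measure M' {z \<in> AA. F z < s} = measure lam (kap -` {..<s})"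
    if "0 \<le> s" "s \<le> Z" "\<And>x. x \<in> V \<Longrightarrow> \<not> (p x < s \<and> s < b x)" for s
    unfolding AAT0 using F_dist_no_gap[OF that] lam_lessThan[OF that] by simp
  consider "s < 0" | "Z < s" | "0 \<le> s" "s \<le> Z" "\<And>x. x \<in> V \<Longrightarrow> \<not> (p x < s \<and> s < b x)"
    | x where "x \<in> V" "p x < s" "s < b x" by fastforce
  then show ?thesis
  proof cases
    case 1
    have "\<not> F z < s" for z using 1 F_nonneg[of z] by simp
    then have "{z \<in> AA. F z < s} = {}" by blast
    moreover have "\<not> kap t < s" for t using 1 G_bounds(1)[OF kap_in_G[of t]] by simp
    then have "kap -` {..<s} = {}" by auto
    ultimately show ?thesis by (simp only: measure_empty)
  next
    case 2
    have "{z \<in> AA. F z < s} = AA" using 2 F_le_Z by (auto intro: le_less_trans)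
    moreover have "kap t < s" for t using 2 G_bounds(2)[OF kap_in_G[of t]] by simp
    then have "kap -` {..<s} = UNIV" by auto
    ultimately show ?thesis using AA_mass lam_UNIV by simp
  next
    case 3
    then show ?thesis by (rule main)
  next
    \<comment> \<open>Neither \<open>F\<close> on \<open>AA\<close> nor \<open>kap\<close> takes a
      value strictly inside a gap, so \<open>s\<close> may be moved to the end \<open>b x\<close>,
      which lies inside no gap.\<close>
    case (4 x)
    have 1: "{z \<in> AA. F z < s} = {z \<in> AA. F z < b x}"
      using F_AA_not_gap[OF _ 4(1)] 4 by force
    have "kap t < s \<longleftrightarrow> kap t < b x" for t
      using G_gap[OF kap_in_G 4(1), of t] 4 by force
    then have 2: "kap -` {..<s} = kap -` {..<b x}" by auto
    have "0 \<le> b x" using 4 p_bounds(1)[OF 4(1)] by simp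
    then show ?thesis unfolding 1 2 using b_le_Z[OF 4(1)] b_not_gap[OF 4(1)] by (intro main) auto
  qed
qed

lemma F_measurable: "F \<in> borel_measurable (restrict_space M' AA)"
  unfolding borel_measurable_iff_less
proof
  fix s
  have "{z \<in> AA. F z < s} = AA \<inter> {z \<in> T0. F z < s}" using AA_T0 by auto
  then have "{z \<in> AA. F z < s} \<in> sets M'" using F_less_sets[of s] AA_sets by simp
  moreover have "space (restrict_space M' AA) = AA"
    using AA_T space_M by (auto simp: space_restrict_space)
  ultimately show "{w \<in> space (restrict_space M' AA). F w < s} \<in> sets (restrict_space M' AA)"
    using AA_sets by (auto simp: sets_restrict_space)
qed

text \<open>Half-lines form an intersection-stable generator of the Borel sets, so equal
  distribution functions give equal laws.\<close>

lemma F_law: "distr (restrict_space M' AA) borel F = distr lam borel kap"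
proof -
  have AAs: "AA \<inter> space M' \<in> sets M'" using AA_sets by simp
  have sp: "space (restrict_space M' AA) = AA"
    using AA_T space_M by (auto simp: space_restrict_space)
  have eq: "emeasure (distr (restrict_space M' AA) borel F) X = emeasure (distr lam borel kap) X"
    if X: "X \<in> range lessThan" for X :: "real set"
  proof -
    obtain s where s: "X = {..<s}" using X by auto
    have "emeasure (distr (restrict_space M' AA) borel F) X = emeasure (restrict_space M' AA) (F -` X \<inter> AA)"
      using emeasure_distr[OF F_measurable, of X] s sp by simp
    also have "\<dots> = emeasure M' (F -` X \<inter> AA)"
      by (rule emeasure_restrict_space[OF AAs]) simp
    also have "F -` X \<inter> AA = {z \<in> AA. F z < s}" using s by auto
    also have "emeasure M' \<dots> = emeasure lam (kap -` X)"
      using F_dist[of s] s by (simp add: M.emeasure_eq_measure lam.emeasure_eq_measure)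
    also have "\<dots> = emeasure (distr lam borel kap) X"
      using s by (subst emeasure_distr) auto
    finally show ?thesis .
  qed
  have b: "sets borel = sigma_sets UNIV (range lessThan :: real set set)"
    by (subst borel_Iio) (simp add: sets_measure_of)
  show ?thesis
  proof (rule measure_eqI_generator_eq[where E="range lessThan" and \<Omega>=UNIV and A="\<lambda>n. {..<real n}"])
    show "Int_stable (range lessThan :: real set set)"
    proof (rule Int_stableI)
      fix a b :: "real set" assume "a \<in> range lessThan" "b \<in> range lessThan"
      then obtain s t where "a = {..<s}" "b = {..<t}" by auto
      then have "a \<inter> b = {..<min s t}" by auto
      then show "a \<inter> b \<in> range lessThan" by simp
    qed
    show "(\<Union>i. {..<real i}) = UNIV" using reals_Archimedean2 by auto
    fix n :: nat
    interpret D: finite_measure "distr lam borel kap" by (rule lam.finite_measure_distr) simp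
    show "emeasure (distr (restrict_space M' AA) borel F) {..<real n} \<noteq> \<infinity>"
      using eq[of "{..<real n}"] D.emeasure_finite by auto
  qed (use eq b in auto)
qed

text \<open>Both masses are read off from one and the same Borel set of reals, supplied by
  \<open>TS_borel_trace\<close>.\<close>

lemma f_preserves:
  assumes E: "E \<in> component_borel TS cS"
  shows "{z \<in> AA. f z \<in> E} \<in> sets M'" "measure M' {z \<in> AA. f z \<in> E} = measure MS E"
proof -
  obtain X where X: "X \<in> sets borel" "\<forall>t\<in>G. g t \<in> E \<longleftrightarrow> t \<in> X" using TS_borel_trace[OF E] by blast
  have sp: "space (restrict_space M' AA) = AA"
    using AA_T space_M by (auto simp: space_restrict_space)
  have AAs: "AA \<inter> space M' \<in> sets M'" using AA_sets by simp
  have eq: "{z \<in> AA. f z \<in> E} = F -` X \<inter> AA" using X(2) F_in_G by (auto simp: f_def)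
  have "F -` X \<inter> AA \<in> sets (restrict_space M' AA)" using measurable_sets[OF F_measurable X(1)] sp by simp
  then show "{z \<in> AA. f z \<in> E} \<in> sets M'" unfolding eq sets_restrict_space_iff[OF AAs] by simp
  have "measure M' (F -` X \<inter> AA) = measure (restrict_space M' AA) (F -` X \<inter> AA)"
    by (rule measure_restrict_space[OF AAs, symmetric]) simp
  also have "\<dots> = measure (distr (restrict_space M' AA) borel F) X"
    using measure_distr[OF F_measurable X(1)] sp by simp
  also have "\<dots> = measure lam (kap -` X)"
    unfolding F_law using measure_distr[of kap lam borel X] X(1) by simp
  also have "\<dots> = measure MS E"
    using E X by (intro measure_MS[symmetric]) (auto simp: MS_props)
  finally show "measure M' {z \<in> AA. f z \<in> E} = measure MS E" unfolding eq .
qed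

section \<open>Measurable images under tightness\<close>

lemma topological: "finite_topological_measure M' (component_topology T' c')"
proof
  show "space M' = topspace (component_topology T' c')" using space_M component_topspace[OF Q.tree] by simp
  show "U \<in> sets M'" if "openin (component_topology T' c') U" for U
    unfolding sets_M component_borel_def using that by (intro sigma_sets.Basic) simp
qed

text \<open>The generating components are open and, by \<open>component_fsigma\<close>, countable
  unions of closed sets.\<close>

lemma all_sandwiched:
  assumes "X \<in> sets M'"
  shows "finite_topological_measure.sandwiched M' (component_topology T' c') X"
proof -
  interpret FT: finite_topological_measure M' "component_topology T' c'" by (rule topological)
  have "X \<in> sigma_sets (space M') Q.base" using assms sets_M Q.component_borel_base space_M by simp
  then show ?thesis
  proof (rule FT.sandwiched_sigma_sets[rotated])
    fix E assume "E \<in> Q.base"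
    then obtain d d' where d: "d \<in> T'" "d' \<in> T'" "d \<noteq> d'" "E = tree_component T' c' d d'" by (rule Q.baseE)
    define \<C> where "\<C> = (\<lambda>e. T' - tree_component T' c' e d) ` (D \<inter> E)"
    have E: "E = \<Union>\<C>" unfolding \<C>_def d(4) by (rule Q.component_fsigma[OF d(1-3)])
    have "closedin (component_topology T' c') C" if "C \<in> \<C>" for C
    proof -
      obtain e where e: "e \<in> D" "e \<in> E" "C = T' - tree_component T' c' e d" using \<open>C \<in> \<C>\<close> by (auto simp: \<C>_def)
      then have "e \<in> T'" "e \<noteq> d" using Q.D_sub d by (auto simp: tree_component_def split: if_splits)
      then have "openin (component_topology T' c') (tree_component T' c' e d)" by (intro component_openin d)
      then have "closedin (component_topology T' c') (topspace (component_topology T' c') - tree_component T' c' e d)"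
        by (intro closedin_diff closedin_topspace)
      then show ?thesis using e(3) component_topspace[OF Q.tree] by simp
    qed
    moreover have "openin (component_topology T' c') (\<Union>\<C>)"
      unfolding E[symmetric] d(4) by (rule component_openin[OF d(1-3)])
    moreover have "countable \<C>" unfolding \<C>_def using Q.D_countable by (simp add: countable_Int1)
    ultimately show "FT.sandwiched E" unfolding E by (intro FT.sandwiched_open)
  qed
qed

text \<open>Lusin's theorem is applied to \<open>AA\<close> together with the preimages of a
  subbase. Since \<open>AA\<close> belongs to the family, \<open>C \<inter> AA\<close> is closed, so
  \<open>P\<close> is compact, \<open>f\<close> is continuous on it, and the image is compact, thus
  closed and measurable. The image of \<open>V\<close> is joined because the compact set need not
  carry the atoms added to the measure.\<close>

lemma compact_piece:
  assumes e: "e > 0" and K: "compactin (component_topology T' c') K" "K \<in> sets M'" "measure M' (K \<union> \<iota> ` V) > Z - e"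
  obtains P where "P \<subseteq> AA" "P \<in> sets M'" "measure M' (P \<union> \<iota> ` V) > Z - 2 * e" "f ` P \<in> sets MS"
proof -
  let ?X = "component_topology T' c'"
  interpret FT: finite_topological_measure M' ?X by (rule topological)
  obtain DS where "separable_tree TS cS (Inl r) DS" by (rule TS_separable)
  then interpret W: separable_tree TS cS "Inl r" DS .
  define \<E> where "\<E> = insert AA ((\<lambda>E. {z \<in> AA. f z \<in> E}) ` W.base)"
  have bT: "E \<in> component_borel TS cS" if "E \<in> W.base" for E
    using that W.component_borel_base by (auto intro: sigma_sets.Basic)
  have sw: "FT.sandwiched X" if "X \<in> \<E>" for X
    using that all_sandwiched AA_sets f_preserves(1) bT by (auto simp: \<E>_def)
  have cE: "countable \<E>" unfolding \<E>_def using W.countable_base by simp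
  obtain C where C: "closedin ?X C" "measure M' (space M' - C) < e"
    "\<And>E. E \<in> \<E> \<Longrightarrow> openin (subtopology ?X C) (E \<inter> C)"
    "\<And>E. E \<in> \<E> \<Longrightarrow> openin (subtopology ?X C) (C - E)"
    using FT.Lusin[of \<E> e] sw cE e by metis
  have CT: "C \<subseteq> T'" using closedin_subset[OF C(1)] component_topspace[OF Q.tree] by simp
  have "openin (subtopology ?X C) (C - AA)" using C(4)[of AA] by (simp add: \<E>_def)
  then have "closedin (subtopology ?X C) (topspace (subtopology ?X C) - (C - AA))"
    by (intro closedin_diff closedin_topspace)
  moreover have "topspace (subtopology ?X C) - (C - AA) = C \<inter> AA"
    using CT component_topspace[OF Q.tree] by auto
  ultimately have cl: "closedin ?X (C \<inter> AA)" using closedin_trans_full[OF _ C(1)] by simp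
  define P where "P = K \<inter> (C \<inter> AA)"
  have Pc: "compactin ?X P" unfolding P_def by (rule compact_Int_closedin[OF K(1) cl])
  have Pc': "compactin (subtopology ?X (C \<inter> AA)) P" unfolding compactin_subtopology by (rule conjI[OF Pc]) (auto simp: P_def)
  have top: "topspace (subtopology ?X (C \<inter> AA)) = C \<inter> AA" using CT component_topspace[OF Q.tree] by auto
  have cont: "continuous_map (subtopology ?X (C \<inter> AA)) (component_topology TS cS) f"
  proof (rule W.continuous_map_component)
    show "f ` topspace (subtopology ?X (C \<inter> AA)) \<subseteq> TS"
      unfolding top using f_embedding by (auto simp: tree_embedding_def tree_hom_def)
    fix E assume "E \<in> W.base"
    then have "openin (subtopology ?X C) ({z \<in> AA. f z \<in> E} \<inter> C)" using C(3) by (simp add: \<E>_def)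
    then obtain O' where O': "openin ?X O'" "{z \<in> AA. f z \<in> E} \<inter> C = O' \<inter> C"
      unfolding openin_subtopology by blast
    have "{x \<in> topspace (subtopology ?X (C \<inter> AA)). f x \<in> E} = O' \<inter> (C \<inter> AA)"
      unfolding top using O'(2) by blast
    then show "openin (subtopology ?X (C \<inter> AA)) {x \<in> topspace (subtopology ?X (C \<inter> AA)). f x \<in> E}"
      using O'(1) by (simp add: openin_subtopology_Int)
  qed
  have fP: "compactin (component_topology TS cS) (f ` P)" by (rule image_compactin[OF Pc' cont])
  have fPcl: "closedin (component_topology TS cS) (f ` P)"
    by (rule compactin_imp_closedin[OF component_Hausdorff[OF TS_tree] fP])
  interpret FS: finite_topological_measure MS "component_topology TS cS"
  proof (intro finite_topological_measure.intro finite_topological_measure_axioms.intro)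
    show "finite_measure MS" by (rule MS_props)
    show "space MS = topspace (component_topology TS cS)" using MS_props component_topspace[OF TS_tree] by simp
    show "U \<in> sets MS" if "openin (component_topology TS cS) U" for U
      unfolding MS_props component_borel_def using that by (intro sigma_sets.Basic) simp
  qed
  have fPm: "f ` P \<in> sets MS" by (rule FS.closed_in_sets[OF fPcl])
  have Cs: "C \<in> sets M'" by (rule FT.closed_in_sets[OF C(1)])
  have Ps: "P \<in> sets M'" unfolding P_def using K(2) Cs AA_sets by simp
  have iAA: "\<iota> ` V \<subseteq> AA" by (auto simp: AA_def)
  have KC: "K \<inter> C \<union> \<iota> ` V \<in> sets M'" using K(2) Cs iota_sets by (intro sets.Un sets.Int)
  have "P \<union> \<iota> ` V = AA \<inter> (K \<inter> C \<union> \<iota> ` V)" using iAA by (auto simp: P_def)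
  then have 1: "measure M' (P \<union> \<iota> ` V) = measure M' (K \<inter> C \<union> \<iota> ` V)" using measure_AA[OF KC] by simp
  have "measure M' (K \<union> \<iota> ` V) \<le> measure M' ((K \<inter> C \<union> \<iota> ` V) \<union> (space M' - C))"
    using KC Cs sets.sets_into_space[OF K(2)] by (intro M.finite_measure_mono) auto
  also have "\<dots> \<le> measure M' (K \<inter> C \<union> \<iota> ` V) + measure M' (space M' - C)"
    using KC Cs by (intro measure_Un_le) auto
  finally have 2: "measure M' (P \<union> \<iota> ` V) > Z - 2 * e" using 1 C(2) K(3) by simp
  have "P \<subseteq> AA" by (auto simp: P_def)
  then show thesis using Ps 2 fPm by (rule that)
qed

lemma tight_image:
  assumes tight: "\<And>e. e > 0 \<Longrightarrow> \<exists>K\<in>sets M'. compactin (component_topology T' c') K \<and> measure M' (K \<union> \<iota> ` V) > Z - e"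
  obtains A where "A \<subseteq> AA" "\<iota> ` V \<subseteq> A" "A \<in> sets M'" "measure M' A = Z" "f ` A \<in> sets MS"
proof -
  have "\<exists>P. P \<subseteq> AA \<and> P \<in> sets M' \<and> measure M' (P \<union> \<iota> ` V) > Z - 2 * (1 / real (Suc n)) \<and> f ` P \<in> sets MS" for n
  proof -
    have e: "1 / real (Suc n) > 0" by simp
    obtain K where K: "K \<in> sets M'" "compactin (component_topology T' c') K" "measure M' (K \<union> \<iota> ` V) > Z - 1 / real (Suc n)"
      using tight[OF e] by blast
    show ?thesis by (rule compact_piece[OF e K(2,1,3)]) blast
  qed
  then have "\<forall>n. \<exists>P. P \<subseteq> AA \<and> P \<in> sets M' \<and> measure M' (P \<union> \<iota> ` V) > Z - 2 * (1 / real (Suc n)) \<and> f ` P \<in> sets MS" by simp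
  from choice[OF this] obtain P where P: "\<And>n. P n \<subseteq> AA" "\<And>n. P n \<in> sets M'"
      "\<And>n. measure M' (P n \<union> \<iota> ` V) > Z - 2 * (1 / real (Suc n))" "\<And>n. f ` P n \<in> sets MS" by auto
  \<comment> \<open>The image of the first part is countable and that of each \<open>P n\<close> is
    measurable, so the image of \<open>A\<close> is measurable; the mass bounds for
    \<open>P n\<close> make \<open>A\<close> full.\<close>
  define A where "A = \<iota> ` V \<union> (\<Union>n. P n)"
  have iAA: "\<iota> ` V \<subseteq> AA" by (auto simp: AA_def)
  have As: "A \<in> sets M'" unfolding A_def using P(2) iota_sets by (intro sets.Un sets.countable_UN) auto
  have "Z \<le> measure M' A"
  proof (rule LIMSEQ_le_const2)
    have "(\<lambda>n. Z - 2 * inverse (real (Suc n))) \<longlonglongrightarrow> Z - 2 * 0"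
      by (intro tendsto_intros LIMSEQ_inverse_real_of_nat)
    then show "(\<lambda>n. Z - 2 * (1 / real (Suc n))) \<longlonglongrightarrow> Z" by (simp add: inverse_eq_divide)
    have "measure M' (P n \<union> \<iota> ` V) \<le> measure M' A" for n
      using As by (intro M.finite_measure_mono) (auto simp: A_def)
    then show "\<exists>N. \<forall>n\<ge>N. Z - 2 * (1 / real (Suc n)) \<le> measure M' A"
      using P(3) by (meson less_imp_le order_trans)
  qed
  moreover have "measure M' A \<le> Z"
    using M.bounded_measure[of A] mass space_M by simp
  moreover have "f ` A \<in> sets MS"
  proof -
    obtain DS where "separable_tree TS cS (Inl r) DS" by (rule TS_separable)
    then interpret W: separable_tree TS cS "Inl r" DS .
    have "f ` A = (\<Union>x\<in>V. {Inl x}) \<union> (\<Union>n. f ` P n)"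
    proof -
      have "f ` \<iota> ` V = (\<Union>x\<in>V. {Inl x})" using f_iota by (force simp: image_image)
      then show ?thesis unfolding A_def by (simp only: image_Un image_UN)
    qed
    moreover have "{Inl x} \<in> sets MS" if "x \<in> V" for x
    proof -
      have "Inl x \<in> TS" using TS_embedding that by (auto simp: tree_embedding_def tree_hom_def)
      then show ?thesis using W.component_borel_singleton MS_props(1) by simp
    qed
    ultimately show ?thesis
      using P(4) countable_V by (auto intro!: sets.Un sets.countable_UN' sets.countable_UN)
  qed
  ultimately show thesis using that[of A] As P(1) iAA by (auto simp: A_def)
qed

end

section \<open>Existence and uniqueness\<close>

definition add_measure :: "'a measure \<Rightarrow> 'a measure \<Rightarrow> 'a measure" where
  "add_measure M N = measure_of (space M) (sets M) (\<lambda>A. emeasure M A + emeasure N A)"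

lemma space_add_measure [simp]: "space (add_measure M N) = space M"
  and sets_add_measure [simp]: "sets (add_measure M N) = sets M"
  by (auto simp: add_measure_def)

lemma emeasure_add_measure:
  assumes "sets M = sets N" "A \<in> sets M"
  shows "emeasure (add_measure M N) A = emeasure M A + emeasure N A"
  unfolding add_measure_def
proof (rule emeasure_measure_of_sigma)
  show "sigma_algebra (space M) (sets M)" ..
  show "positive (sets M) (\<lambda>A. emeasure M A + emeasure N A)" by (simp add: positive_def)
  show "countably_additive (sets M) (\<lambda>A. emeasure M A + emeasure N A)"
  proof (rule countably_additiveI)
    fix A :: "nat \<Rightarrow> _" assume A: "range A \<subseteq> sets M" "disjoint_family A"
    have "(\<Sum>i. emeasure M (A i) + emeasure N (A i)) = (\<Sum>i. emeasure M (A i)) + (\<Sum>i. emeasure N (A i))"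
      by (rule suminf_add[symmetric]) auto
    also have "\<dots> = emeasure M (\<Union>i. A i) + emeasure N (\<Union>i. A i)"
      using A assms(1) by (simp add: suminf_emeasure)
    finally show "(\<Sum>i. emeasure M (A i) + emeasure N (A i)) = emeasure M (\<Union> (range A)) + emeasure N (\<Union> (range A))" .
  qed
qed (rule assms)

lemma measure_add_measure:
  assumes "finite_measure M" "finite_measure N" "sets M = sets N" "A \<in> sets M"
  shows "measure (add_measure M N) A = measure M A + measure N A" "finite_measure (add_measure M N)"
proof -
  interpret M: finite_measure M by fact
  interpret N: finite_measure N by fact
  show "measure (add_measure M N) A = measure M A + measure N A"
    unfolding measure_def emeasure_add_measure[OF assms(3,4)]
    by (intro enn2real_plus) (simp_all add: less_top[symmetric])
  show "finite_measure (add_measure M N)"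
  proof (rule finite_measureI)
    have "emeasure (add_measure M N) (space M) = emeasure M (space M) + emeasure N (space M)"
      by (rule emeasure_add_measure[OF assms(3) sets.top])
    also have "\<dots> = ennreal (measure M (space M) + measure N (space M))"
      by (simp add: M.emeasure_eq_measure N.emeasure_eq_measure)
    finally show "emeasure (add_measure M N) (space (add_measure M N)) \<noteq> \<infinity>" by simp
  qed
qed

section \<open>Perturbation by a distribution of full support\<close>

locale prescribed_tree = rooted_tree V c r for V :: "'a set" and c r +
  fixes \<psi> :: "'a set \<Rightarrow> 'a \<Rightarrow> real"
  assumes countable_carrier: "countable V"
    and psi_nonneg: "\<And>x A. x \<in> V \<Longrightarrow> A \<in> tree_component V c x ` V \<Longrightarrow> \<psi> A x \<ge> 0"
    and psi_total: "\<And>x. x \<in> V \<Longrightarrow> ((\<lambda>A. \<psi> A x) has_sum 1) (tree_component V c x ` V)"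
    and psi_compat: "\<And>x y. x \<in> V \<Longrightarrow> y \<in> V \<Longrightarrow> x \<noteq> y \<Longrightarrow> psi_pt V c \<psi> x y + psi_pt V c \<psi> y x \<ge> 1"
begin

text \<open>Adding a fully supported distribution on \<open>V\<close> makes every point of \<open>V\<close> an atom, so that all
  points of \<open>V\<close> get different positions on the line.\<close>

definition q :: "'a pmf" where "q = map_pmf (from_nat_into V) (geometric_pmf (1/2))"

lemma set_q: "set_pmf q = V"
proof -
  have "V \<noteq> {}" using root_in by auto
  then show ?thesis using countable_carrier by (simp add: q_def set_pmf_geometric range_from_nat_into)
qed

lemma q_V: "measure (measure_pmf q) V = 1"
proof -
  have "measure (measure_pmf q) (set_pmf q) = 1"
    by (rule measure_pmf.prob_eq_1[THEN iffD2]) (auto simp: AE_measure_pmf_iff)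
  then show ?thesis by (simp only: set_q)
qed

lemma q_pos: "x \<in> V \<Longrightarrow> 0 < measure (measure_pmf q) {x}"
  using set_q by (simp add: measure_pmf_single pmf_positive)

definition phi :: "'a set \<Rightarrow> 'a \<Rightarrow> real" where "phi A x = \<psi> A x + measure (measure_pmf q) A"

lemma psi_self_nonneg: "x \<in> V \<Longrightarrow> 0 \<le> \<psi> {x} x"
  using psi_nonneg[of x "S x x"] component_self[of x] by (metis imageI)

lemma q_total:
  assumes x: "x \<in> V" shows "((\<lambda>A. measure (measure_pmf q) A) has_sum 1) (S x ` V)"
proof -
  have disj: "disjoint_family_on (\<lambda>A. A) (S x ` V)"
    unfolding disjoint_family_on_def
  proof (intro ballI impI)
    fix A B assume AB: "A \<in> S x ` V" "B \<in> S x ` V" "A \<noteq> B"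
    then obtain y z where yz: "y \<in> V" "z \<in> V" "A = S x y" "B = S x z" by blast
    show "A \<inter> B = {}"
    proof (rule ccontr)
      assume "A \<inter> B \<noteq> {}"
      then obtain w where "w \<in> S x y" "w \<in> S x z" using yz by auto
      then have "S x y = S x z" using component_eq[OF tree x yz(1)] component_eq[OF tree x yz(2)] by metis
      then show False using AB yz by simp
    qed
  qed
  have sm: "(\<lambda>A. measure (measure_pmf q) A) summable_on S x ` V"
  proof (rule nonneg_bdd_above_summable_on)
    show "bdd_above (sum (measure (measure_pmf q)) ` {F. F \<subseteq> S x ` V \<and> finite F})"
    proof (rule bdd_aboveI2[of _ _ 1])
      fix F assume "F \<in> {F. F \<subseteq> S x ` V \<and> finite F}"
      then have F: "F \<subseteq> S x ` V" "finite F" by auto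
      have "sum (measure (measure_pmf q)) F = measure (measure_pmf q) (\<Union>A\<in>F. A)"
        using F disjoint_family_on_mono[OF F(1) disj]
        by (intro measure_pmf.finite_measure_finite_Union[symmetric]) auto
      then show "sum (measure (measure_pmf q)) F \<le> 1" by simp
    qed
  qed simp
  have "measure (measure_pmf q) (\<Union>A\<in>S x ` V. A) = infsum (\<lambda>A. measure (measure_pmf q) A) (S x ` V)"
    using countable_carrier by (intro measure_pmf.measure_disjoint_Union_infsum disj sm) auto
  moreover have "(\<Union>A\<in>S x ` V. A) = V"
    using component_sub[OF x] component_mem[OF tree x] by blast
  ultimately have "infsum (\<lambda>A. measure (measure_pmf q) A) (S x ` V) = 1" using q_V by simp
  then show ?thesis using has_sum_infsum[OF sm] by simp
qed

text \<open>The total 2 is 1 from \<open>\<psi>\<close> plus 1 from \<open>q\<close>. The added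
  distribution satisfies its own compatibility inequality, because two components facing each other
  cover \<open>V\<close>.\<close>

sublocale W: weighted_tree V c r phi 2
proof
  show "countable V" by (rule countable_carrier)
  fix x assume x: "x \<in> V"
  show "0 < phi {x} x" using q_pos[OF x] psi_self_nonneg[OF x] by (simp add: phi_def)
  show "((\<lambda>A. phi A x) has_sum 2) (S x ` V)"
    unfolding phi_def using has_sum_add[OF psi_total[OF x] q_total[OF x]] by simp
  fix y assume y: "y \<in> V"
  show "0 \<le> phi (S x y) x" using psi_nonneg[OF x, of "S x y"] y by (simp add: phi_def)
  assume ne: "x \<noteq> y"
  \<comment> \<open>The median \<open>c x y w\<close> cannot equal both \<open>x\<close> and
    \<open>y\<close>, so \<open>w\<close> is on the far side of at least one of them.\<close>
  have "V \<subseteq> S x y \<union> S y x"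
  proof
    fix w assume w: "w \<in> V"
    show "w \<in> S x y \<union> S y x"
      using ne w c_swap12[OF x y w] c_diag[OF x y] c_diag[OF y x] c_swap12[OF x y] c_swap23[OF x y] x y
      by (auto simp: tree_component_def)
  qed
  then have "1 \<le> measure (measure_pmf q) (S x y \<union> S y x)"
    unfolding q_V[symmetric] by (intro measure_pmf.finite_measure_mono) auto
  also have "\<dots> \<le> measure (measure_pmf q) (S x y) + measure (measure_pmf q) (S y x)"
    by (intro measure_Un_le) auto
  finally show "2 \<le> phi (S x y) x + phi (S y x) y"
    using psi_compat[OF x y ne] by (simp add: phi_def psi_pt_def)
qed

text \<open>The image of \<open>q\<close> in a realization. The value \<open>\<iota> r\<close> off
  \<open>V\<close> only keeps the map inside the space; \<open>q\<close> has no mass there.\<close>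

definition spread :: "('a \<Rightarrow> 'b) \<Rightarrow> 'b measure \<Rightarrow> 'b measure" where
  "spread \<iota> M = distr (measure_pmf q) M (\<lambda>x. if x \<in> V then \<iota> x else \<iota> r)"

lemma spread_props:
  assumes "\<iota> ` V \<subseteq> space M"
  shows "sets (spread \<iota> M) = sets M" "finite_measure (spread \<iota> M)"
    "E \<in> sets M \<Longrightarrow> measure (spread \<iota> M) E = measure (measure_pmf q) {x \<in> V. \<iota> x \<in> E}"
proof -
  let ?j = "\<lambda>x. if x \<in> V then \<iota> x else \<iota> r"
  have m: "?j \<in> measurable (measure_pmf q) M"
    by (rule measurableI) (use assms root_in in auto)
  show "sets (spread \<iota> M) = sets M" by (simp add: spread_def)
  show "finite_measure (spread \<iota> M)"
    unfolding spread_def by (rule measure_pmf.finite_measure_distr[OF m])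
  assume "E \<in> sets M"
  then have "measure (spread \<iota> M) E = measure (measure_pmf q) (?j -` E)"
    unfolding spread_def using measure_distr[OF m] by simp
  also have "\<dots> = measure (measure_pmf q) (?j -` E \<inter> set_pmf q)"
    by (rule measure_Int_set_pmf[symmetric])
  also have "?j -` E \<inter> set_pmf q = {x \<in> V. \<iota> x \<in> E}" unfolding set_q by auto
  finally show "measure (spread \<iota> M) E = measure (measure_pmf q) {x \<in> V. \<iota> x \<in> E}" .
qed

lemma iota_component:
  assumes "tree_embedding V c T' c' \<iota>" "x \<in> V" "y \<in> V"
  shows "{z \<in> V. \<iota> z \<in> tree_component T' c' (\<iota> x) (\<iota> y)} = S x y"
proof -
  have inj: "\<iota> u = \<iota> w \<longleftrightarrow> u = w" if "u \<in> V" "w \<in> V" for u w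
    using assms(1) that by (auto simp: tree_embedding_def inj_on_eq_iff)
  have hom: "c' (\<iota> x) (\<iota> y) (\<iota> z) = \<iota> (c x y z)" "\<iota> z \<in> T'" if "z \<in> V" for z
    using assms that by (auto simp: tree_embedding_def tree_hom_def)
  show ?thesis using assms(2,3) by (auto simp: tree_component_def inj hom c_closed)
qed

text \<open>Components of \<open>T'\<close> between points of \<open>V\<close> have the components
  of \<open>V\<close> as traces, so adding the image of \<open>q\<close> raises the mass of each by
  exactly what \<open>phi\<close> prescribes.\<close>

lemma realization_of_realizes:
  assumes R: "realizes V c \<psi> \<iota> T' c' \<mu>"
  obtains D where "realization V c r phi 2 T' c' \<iota> D (add_measure \<mu> (spread \<iota> \<mu>))"
proof -
  have amt: "algebraic_tree T' c'" "order_separable T' c'" "space \<mu> = T'" "sets \<mu> = component_borel T' c'"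
      "prob_space \<mu>"
    and emb: "tree_embedding V c T' c' \<iota>" and br: "branch_points T' c' = \<iota> ` branch_points V c"
    and mass: "\<And>x y. x \<in> V \<Longrightarrow> y \<in> V \<Longrightarrow> measure \<mu> (tree_component T' c' (\<iota> x) (\<iota> y)) = \<psi> (S x y) x"
    and at: "atoms \<mu> \<subseteq> \<iota> ` V"
    using R by (auto simp: realizes_def algebraic_measure_tree_def psi_pt_def)
  interpret P: prob_space \<mu> by (rule amt)
  have iT: "\<iota> ` V \<subseteq> T'" using emb by (auto simp: tree_embedding_def tree_hom_def)
  then have isp: "\<iota> ` V \<subseteq> space \<mu>" using amt by simp
  note sp = spread_props[OF isp]
  have add: "measure (add_measure \<mu> (spread \<iota> \<mu>)) E = measure \<mu> E + measure (measure_pmf q) {x \<in> V. \<iota> x \<in> E}"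
    if "E \<in> sets \<mu>" for E
    using measure_add_measure(1)[OF P.finite_measure_axioms sp(2) sp(1)[symmetric] that] sp(3)[OF that] by simp
  obtain D where D: "D \<subseteq> T'" "countable D"
    "\<And>x y. x \<in> T' \<Longrightarrow> y \<in> T' \<Longrightarrow> x \<noteq> y \<Longrightarrow> \<exists>d\<in>D. d \<in> tree_interval T' c' x y \<and> d \<noteq> y"
    using amt(2) unfolding order_separable_iff by blast
  interpret Q: separable_tree T' c' "\<iota> r" D
  proof (intro separable_tree.intro separable_tree_axioms.intro rooted_tree.intro)
    show "\<iota> r \<in> T'" using iT root_in by blast
  qed (fact amt(1) D)+
  have sing: "{z} \<in> sets \<mu>" if "z \<in> T'" for z using Q.component_borel_singleton[OF that] amt(4) by simp
  have "realization V c r phi 2 T' c' \<iota> D (add_measure \<mu> (spread \<iota> \<mu>))"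
  proof (intro realization.intro realization_axioms.intro)
    show "weighted_tree V c r phi 2" by (rule W.weighted_tree_axioms)
    show "separable_tree T' c' (\<iota> r) D" by (rule Q.separable_tree_axioms)
    show "finite_measure (add_measure \<mu> (spread \<iota> \<mu>))"
      by (rule measure_add_measure(2)[OF P.finite_measure_axioms sp(2) sp(1)[symmetric] sets.empty_sets])
    show "tree_embedding V c T' c' \<iota>" "branch_points T' c' = \<iota> ` branch_points V c" by fact+
    show "sets (add_measure \<mu> (spread \<iota> \<mu>)) = component_borel T' c'"
      "space (add_measure \<mu> (spread \<iota> \<mu>)) = T'" using amt by simp_all
    have "T' \<in> sets \<mu>" using sets.top[of \<mu>] amt by simp
    moreover have "{x \<in> V. \<iota> x \<in> T'} = V" using iT by auto
    ultimately show "measure (add_measure \<mu> (spread \<iota> \<mu>)) T' = 2"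
      using add[of T'] P.prob_space amt q_V by simp
    show "measure (add_measure \<mu> (spread \<iota> \<mu>)) (tree_component T' c' (\<iota> x) (\<iota> y)) = phi (S x y) x"
      if "x \<in> V" "y \<in> V" for x y
    proof -
      have xy: "\<iota> x \<in> T'" "\<iota> y \<in> T'" using iT that by blast+
      have "tree_component T' c' (\<iota> x) (\<iota> y) \<in> sets \<mu>"
      proof (cases "\<iota> x = \<iota> y")
        case True
        then show ?thesis using sing xy by (simp add: tree_component_def)
      qed (use Q.component_borel_component[OF xy] amt in simp)
      then show ?thesis using add iota_component[OF emb that] mass[OF that] by (simp add: phi_def)
    qed
    show "measure (add_measure \<mu> (spread \<iota> \<mu>)) {z} = 0" if z: "z \<in> T'" "z \<notin> \<iota> ` V" for z
    proof -
      have e: "{x \<in> V. \<iota> x \<in> {z}} = {}" using z by auto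
      have "\<not> measure \<mu> {z} > 0" using at z amt by (auto simp: atoms_def)
      then have "measure \<mu> {z} = 0" using measure_nonneg[of \<mu> "{z}"] by linarith
      then show ?thesis unfolding add[OF sing[OF z(1)]] e by simp
    qed
  qed
  then show thesis by (rule that)
qed

section \<open>Existence: subtracting the perturbation\<close>

abbreviation "NS \<equiv> spread Inl W.MS"
definition MU :: "('a + real) measure" where "MU = diff_measure W.MS NS"

lemma Inl_TS: "Inl ` V \<subseteq> W.TS"
  using W.TS_embedding by (auto simp: tree_embedding_def tree_hom_def)

lemma NS_props:
  shows "sets NS = sets W.MS" "finite_measure NS"
    "E \<in> sets W.MS \<Longrightarrow> measure NS E = measure (measure_pmf q) {x \<in> V. Inl x \<in> E}"
  using spread_props[of Inl W.MS] Inl_TS W.MS_props(2) by simp_all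

lemma MS_sing:
  assumes "x \<in> V" shows "{Inl x} \<in> sets W.MS" "measure W.MS {Inl x} = phi {x} x"
proof -
  obtain D where "separable_tree W.TS W.cS (Inl r) D" by (rule W.TS_separable)
  then interpret Q: separable_tree W.TS W.cS "Inl r" D .
  show "{Inl x} \<in> sets W.MS" using Q.component_borel_singleton Inl_TS assms W.MS_props(1) by auto
  show "measure W.MS {Inl x} = phi {x} x"
    using W.MS_component[OF assms assms] by (simp add: tree_component_def)
qed

text \<open>The added measure is carried by the countable image of \<open>V\<close>, and at each of
  its points the atom \<open>phi {x} x\<close> is at least the added mass. This makes the
  subtraction legitimate.\<close>

lemma NS_le_MS:
  assumes E: "E \<in> sets W.MS" shows "measure NS E \<le> measure W.MS E"
proof -
  interpret FM: finite_measure W.MS by (rule W.MS_props)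
  define I where "I = {x \<in> V. Inl x \<in> E}"
  have cI: "countable I" unfolding I_def using countable_carrier by (rule countable_subset[rotated]) auto
  have phi_pos: "0 \<le> phi {x} x" "measure (measure_pmf q) {x} \<le> phi {x} x" if "x \<in> V" for x
    using psi_self_nonneg[OF that] by (simp_all add: phi_def)
  have UI: "(\<Union>x\<in>I. {Inl x}) \<in> sets W.MS"
    using cI MS_sing(1) by (intro sets.countable_UN') (auto simp: I_def)
  have finM: "(\<Sum>x\<in>F. phi {x} x) \<le> measure W.MS E" if F: "finite F" "F \<subseteq> I" for F
  proof -
    have "(\<Sum>x\<in>F. phi {x} x) = (\<Sum>x\<in>F. measure W.MS {Inl x})"
      using F MS_sing(2) by (intro sum.cong) (auto simp: I_def)
    also have "\<dots> = measure W.MS (\<Union>x\<in>F. {Inl x})"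
      using F MS_sing(1) by (intro FM.finite_measure_finite_Union[symmetric]) (auto simp: I_def disjoint_family_on_def)
    also have "\<dots> \<le> measure W.MS E" using F E by (intro FM.finite_measure_mono) (auto simp: I_def)
    finally show ?thesis .
  qed
  have sm: "(\<lambda>x. measure (measure_pmf q) {x}) summable_on I"
  proof (rule nonneg_bdd_above_summable_on)
    show "bdd_above (sum (\<lambda>x. measure (measure_pmf q) {x}) ` {F. F \<subseteq> I \<and> finite F})"
    proof (rule bdd_aboveI2[of _ _ "measure W.MS E"])
      fix F assume F: "F \<in> {F. F \<subseteq> I \<and> finite F}"
      then have "(\<Sum>x\<in>F. measure (measure_pmf q) {x}) \<le> (\<Sum>x\<in>F. phi {x} x)"
        using phi_pos by (intro sum_mono) (auto simp: I_def)
      then show "(\<Sum>x\<in>F. measure (measure_pmf q) {x}) \<le> measure W.MS E" using finM[of F] F by simp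
    qed
  qed simp
  have "measure NS E = measure (measure_pmf q) (\<Union>x\<in>I. {x})"
    using NS_props(3)[OF E] by (simp add: I_def)
  also have "\<dots> = infsum (\<lambda>x. measure (measure_pmf q) {x}) I"
    using cI sm by (intro measure_pmf.measure_disjoint_Union_infsum) (auto simp: disjoint_family_on_def)
  also have "\<dots> \<le> measure W.MS E"
  proof (rule infsum_le_finite_sums[OF sm])
    fix F assume F: "finite F" "F \<subseteq> I"
    then have "(\<Sum>x\<in>F. measure (measure_pmf q) {x}) \<le> (\<Sum>x\<in>F. phi {x} x)"
      using phi_pos by (intro sum_mono) (auto simp: I_def)
    then show "(\<Sum>x\<in>F. measure (measure_pmf q) {x}) \<le> measure W.MS E" using finM[OF F] by simp
  qed
  finally show ?thesis .
qed

lemma MU_props: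
  shows "space MU = W.TS" "sets MU = sets W.MS" "prob_space MU"
    "E \<in> sets W.MS \<Longrightarrow> measure MU E = measure W.MS E - measure (measure_pmf q) {x \<in> V. Inl x \<in> E}"
proof -
  interpret FM: finite_measure W.MS by (rule W.MS_props)
  interpret FN: finite_measure NS by (rule NS_props)
  show sp: "space MU = W.TS" and "sets MU = sets W.MS" by (simp_all add: MU_def W.MS_props)
  have em: "emeasure MU E = ennreal (measure W.MS E - measure NS E)" if E: "E \<in> sets W.MS" for E
  proof -
    have "emeasure MU E = emeasure W.MS E - emeasure NS E"
      unfolding MU_def
      by (rule emeasure_diff_measure[OF FM.finite_measure_axioms FN.finite_measure_axioms _ _ E])
        (use NS_props(1) NS_le_MS in \<open>auto simp: FM.emeasure_eq_measure FN.emeasure_eq_measure\<close>)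
    also have "\<dots> = ennreal (measure W.MS E - measure NS E)"
      by (simp add: FM.emeasure_eq_measure FN.emeasure_eq_measure ennreal_minus)
    finally show ?thesis .
  qed
  show "measure MU E = measure W.MS E - measure (measure_pmf q) {x \<in> V. Inl x \<in> E}" if E: "E \<in> sets W.MS"
    using em[OF E] NS_le_MS[OF E] NS_props(3)[OF E] by (simp add: measure_def)
  have T: "W.TS \<in> sets W.MS" using sets.top[of W.MS] by (simp only: W.MS_props(2))
  have "{x \<in> V. Inl x \<in> W.TS} = V" using Inl_TS by auto
  then have "measure NS W.TS = 1" using NS_props(3)[OF T] q_V by simp
  then have "emeasure MU (space MU) = 1" unfolding sp using em[OF T] W.MS_props(4) by simp
  then show "prob_space MU" by (rule prob_spaceI)
qed

lemma MU_realizes: "realizes V c \<psi> Inl W.TS W.cS MU"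
  unfolding realizes_def algebraic_measure_tree_def
proof (intro conjI ballI)
  obtain D where "separable_tree W.TS W.cS (Inl r) D" by (rule W.TS_separable)
  then interpret Q: separable_tree W.TS W.cS "Inl r" D .
  show "algebraic_tree W.TS W.cS" by (rule W.TS_tree)
  show "order_separable W.TS W.cS"
    unfolding order_separable_iff using Q.D_sub Q.D_countable Q.D_sep by (intro exI[of _ D] conjI ballI impI)
  show "space MU = W.TS" "sets MU = component_borel W.TS W.cS" "prob_space MU"
    using MU_props W.MS_props(1) by auto
  show "tree_embedding V c W.TS W.cS Inl" by (rule W.TS_embedding)
  show "branch_points W.TS W.cS = Inl ` branch_points V c" by (rule W.TS_branch_points)
  show "measure MU (tree_component W.TS W.cS (Inl x) (Inl y)) = psi_pt V c \<psi> y x" if xy: "x \<in> V" "y \<in> V" for x y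
  proof -
    have "tree_component W.TS W.cS (Inl x) (Inl y) \<in> sets W.MS"
    proof (cases "x = y")
      case True
      then show ?thesis using MS_sing xy by (simp add: tree_component_def)
    next
      case False
      then show ?thesis unfolding W.MS_props using Inl_TS xy by (intro Q.component_borel_component) auto
    qed
    then show ?thesis
      using MU_props(4) W.MS_component[OF xy] iota_component[OF W.TS_embedding xy] by (simp add: phi_def psi_pt_def)
  qed
  show "atoms MU \<subseteq> Inl ` V"
  proof
    fix z assume z: "z \<in> atoms MU"
    then have zT: "z \<in> W.TS" "measure MU {z} > 0" using MU_props(1) by (auto simp: atoms_def)
    show "z \<in> Inl ` V"
    proof (rule ccontr)
      assume n: "z \<notin> Inl ` V"
      have e: "{x \<in> V. Inl x \<in> {z}} = {}" using n by auto
      have "{z} \<in> sets W.MS" unfolding W.MS_props(1) by (rule Q.component_borel_singleton[OF zT(1)])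
      from MU_props(4)[OF this] have "measure MU {z} = 0" unfolding e W.MS_atoms[OF zT(1) n] by simp
      then show False using zT by simp
    qed
  qed
qed

text \<open>A set of mass more than 2 - e loses at most 1 by the subtraction.\<close>

lemma MU_tight: "tight_amt W.TS W.cS MU"
  unfolding tight_amt_def
proof (intro allI impI)
  interpret FM: finite_measure W.MS by (rule W.MS_props)
  interpret PU: prob_space MU by (rule MU_props)
  fix e :: real assume "e > 0"
  then obtain K where K: "K \<in> sets W.MS" "compactin (component_topology W.TS W.cS) K" "measure W.MS K > 2 - e"
    using W.MS_tight by blast
  have "measure (measure_pmf q) {x \<in> V. Inl x \<in> K} \<le> 1" by simp
  then have "measure MU K > 1 - e" using MU_props(4)[OF K(1)] K(3) by linarith
  then show "\<exists>K\<in>sets MU. compactin (component_topology W.TS W.cS) K \<and> measure MU K > 1 - e"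
    using K MU_props(2) by auto
qed

section \<open>Comparison of an arbitrary realization with the constructed one\<close>

lemma uniqueness:
  assumes R: "realizes V c \<psi> \<iota> T' c' \<mu>"
  shows "amt_embeds T' c' \<mu> W.TS W.cS MU"
    and "tight_amt T' c' \<mu> \<Longrightarrow> amt_equivalent T' c' \<mu> W.TS W.cS MU"
proof -
  let ?M = "add_measure \<mu> (spread \<iota> \<mu>)"
  obtain D where "realization V c r phi 2 T' c' \<iota> D ?M" by (rule realization_of_realizes[OF R])
  then interpret X: realization V c r phi 2 T' c' \<iota> D ?M .
  interpret PU: prob_space MU by (rule MU_props)
  have sp: "space \<mu> = T'" and sets: "sets \<mu> = component_borel T' c'" and "prob_space \<mu>"
    using R by (auto simp: realizes_def algebraic_measure_tree_def)
  then interpret P: prob_space \<mu> by simp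
  have iT: "\<iota> ` V \<subseteq> space \<mu>" using X.iota_in sp by auto
  note spr = spread_props[OF iT]
  have add: "measure ?M E = measure \<mu> E + measure (measure_pmf q) {x \<in> V. \<iota> x \<in> E}" if "E \<in> sets \<mu>" for E
    using measure_add_measure(1)[OF P.finite_measure_axioms spr(2) spr(1)[symmetric] that] spr(3)[OF that] by simp
  have full: "measure \<mu> A = 1" if A: "A \<in> sets \<mu>" "\<iota> ` V \<subseteq> A" "measure ?M A = 2" for A
  proof -
    have "{x \<in> V. \<iota> x \<in> A} = V" using A by auto
    then show ?thesis using add[OF A(1)] A(3) q_V by simp
  qed
  have iAA: "\<iota> ` V \<subseteq> X.AA" by (auto simp: X.AA_def)
  have AAT: "X.AA \<subseteq> T'" using X.AA_T by auto
  have AAs: "X.AA \<in> sets \<mu>" using X.AA_sets by simp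
  have law: "{z \<in> X.AA. X.f z \<in> E} \<in> sets \<mu>" "measure \<mu> {z \<in> X.AA. X.f z \<in> E} = measure MU E"
    if E: "E \<in> sets MU" for E
  proof -
    have E': "E \<in> sets W.MS" using E MU_props by simp
    then have EB: "E \<in> component_borel W.TS W.cS" using W.MS_props by simp
    note fp = X.f_preserves[OF EB]
    show s: "{z \<in> X.AA. X.f z \<in> E} \<in> sets \<mu>" using fp(1) by simp
    \<comment> \<open>Since \<open>f\<close> sends \<open>\<iota> x\<close> to \<open>Inl x\<close>,
      the added masses on both sides coincide and cancel.\<close>
    have "{x \<in> V. \<iota> x \<in> {z \<in> X.AA. X.f z \<in> E}} = {x \<in> V. Inl x \<in> E}"
      using iAA X.f_iota by auto
    then show "measure \<mu> {z \<in> X.AA. X.f z \<in> E} = measure MU E"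
      using add[OF s] fp(2) MU_props(4)[OF E'] by simp
  qed
  have fT: "X.f ` X.AA \<subseteq> W.TS" and finj: "inj_on X.f X.AA"
    and fhom: "\<And>x y z. x \<in> X.AA \<Longrightarrow> y \<in> X.AA \<Longrightarrow> z \<in> X.AA \<Longrightarrow> X.f (c' x y z) = W.cS (X.f x) (X.f y) (X.f z)"
    using X.f_embedding by (auto simp: tree_embedding_def tree_hom_def)
  have mp: "measure_preserving_map (restrict_space \<mu> A) N X.f"
    if A: "A \<in> sets \<mu>" "A \<subseteq> X.AA" and N: "X.f ` A \<subseteq> space N"
      and law': "\<And>E. E \<in> sets N \<Longrightarrow> {z \<in> A. X.f z \<in> E} \<in> sets \<mu>"
        "\<And>E. E \<in> sets N \<Longrightarrow> emeasure \<mu> {z \<in> A. X.f z \<in> E} = emeasure N E" for A N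
  proof -
    have As: "A \<inter> space \<mu> \<in> sets \<mu>" using A by simp
    have spA: "space (restrict_space \<mu> A) = A" using A AAT sp by (auto simp: space_restrict_space)
    have pre: "X.f -` E \<inter> A = {z \<in> A. X.f z \<in> E}" for E by auto
    have m: "X.f \<in> measurable (restrict_space \<mu> A) N"
    proof (rule measurableI)
      show "X.f x \<in> space N" if "x \<in> space (restrict_space \<mu> A)" for x using that N spA by auto
      show "X.f -` E \<inter> space (restrict_space \<mu> A) \<in> sets (restrict_space \<mu> A)" if "E \<in> sets N" for E
        unfolding spA pre sets_restrict_space_iff[OF As] using law'(1)[OF that] by auto
    qed
    have "distr (restrict_space \<mu> A) N X.f = N"
    proof (rule measure_eqI)
      fix E assume "E \<in> sets (distr (restrict_space \<mu> A) N X.f)"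
      then have E: "E \<in> sets N" by simp
      have "emeasure (distr (restrict_space \<mu> A) N X.f) E = emeasure (restrict_space \<mu> A) {z \<in> A. X.f z \<in> E}"
        using emeasure_distr[OF m E] by (simp add: spA pre)
      also have "\<dots> = emeasure \<mu> {z \<in> A. X.f z \<in> E}"
        by (rule emeasure_restrict_space[OF As]) auto
      finally show "emeasure (distr (restrict_space \<mu> A) N X.f) E = emeasure N E" using law'(2)[OF E] by simp
    qed simp
    then show ?thesis using m by (simp add: measure_preserving_map_def)
  qed
  show "amt_embeds T' c' \<mu> W.TS W.cS MU"
    unfolding amt_embeds_def
  proof (intro exI conjI)
    show "subtree T' c' X.AA" by (rule X.subtree_AA[OF iAA AAT])
    show "measure \<mu> X.AA = 1" by (rule full[OF AAs iAA X.AA_mass])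
    show "tree_embedding X.AA c' W.TS W.cS X.f" by (rule X.f_embedding)
    show "measure_preserving_map (restrict_space \<mu> X.AA) MU X.f"
      by (rule mp) (use AAs fT law MU_props(1) in \<open>auto simp: P.emeasure_eq_measure PU.emeasure_eq_measure\<close>)
  qed
  assume tight: "tight_amt T' c' \<mu>"
  \<comment> \<open>The given tightness concerns \<open>\<mu>\<close> alone. The added mass 1 sits
    on the image of \<open>V\<close>, so joining this set to \<open>K\<close> recovers all of
    it.\<close>
  have "\<exists>K\<in>sets ?M. compactin (component_topology T' c') K \<and> measure ?M (K \<union> \<iota> ` V) > 2 - e" if "e > 0" for e
  proof -
    obtain K where K: "K \<in> sets \<mu>" "compactin (component_topology T' c') K" "measure \<mu> K > 1 - e"
      using tight \<open>e > 0\<close> unfolding tight_amt_def by blast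
    have KV: "K \<union> \<iota> ` V \<in> sets \<mu>" using K(1) X.iota_sets by auto
    have "{x \<in> V. \<iota> x \<in> K \<union> \<iota> ` V} = V" by auto
    then have "measure ?M (K \<union> \<iota> ` V) = measure \<mu> (K \<union> \<iota> ` V) + 1" using add[OF KV] q_V by simp
    moreover have "measure \<mu> K \<le> measure \<mu> (K \<union> \<iota> ` V)" using KV by (intro P.finite_measure_mono) auto
    ultimately show ?thesis using K by (intro bexI[of _ K]) auto
  qed
  then obtain A where A: "A \<subseteq> X.AA" "\<iota> ` V \<subseteq> A" "A \<in> sets ?M" "measure ?M A = 2" "X.f ` A \<in> sets W.MS"
    by (rule X.tight_image) auto
  have As: "A \<in> sets \<mu>" using A by simp
  have fAs: "X.f ` A \<in> sets MU" using A MU_props by simp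
  have subA: "subtree T' c' A" using X.subtree_AA[OF A(2)] A(1) AAT by auto
  \<comment> \<open>By injectivity on \<open>AA\<close>, preimages of subsets of the image of
    \<open>A\<close> contain nothing from the rest of \<open>AA\<close>.\<close>
  have pre: "{z \<in> X.AA. X.f z \<in> E} = {z \<in> A. X.f z \<in> E}" if "E \<subseteq> X.f ` A" for E
    using that A(1) finj by (auto dest: inj_onD)
  have fA1: "measure MU (X.f ` A) = 1"
  proof -
    have "{z \<in> A. X.f z \<in> X.f ` A} = A" by auto
    then show ?thesis using law(2)[OF fAs] pre[OF order_refl] full[OF As A(2,4)] by simp
  qed
  show "amt_equivalent T' c' \<mu> W.TS W.cS MU"
    unfolding amt_equivalent_def
  proof (intro exI conjI)
    show "subtree T' c' A" by fact
    show "measure \<mu> A = 1" by (rule full[OF As A(2,4)])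
    show "measure MU (X.f ` A) = 1" by fact
    show "subtree W.TS W.cS (X.f ` A)"
      unfolding subtree_def
    proof (intro conjI ballI)
      show "X.f ` A \<noteq> {}" using A(2) root_in by auto
      show "X.f ` A \<subseteq> W.TS" using A(1) fT by auto
      fix u v w assume "u \<in> X.f ` A" "v \<in> X.f ` A" "w \<in> X.f ` A"
      then obtain x y z where xyz: "x \<in> A" "y \<in> A" "z \<in> A" and uvw: "u = X.f x" "v = X.f y" "w = X.f z" by blast
      have "c' x y z \<in> A" using subA xyz by (simp add: subtree_def)
      moreover have "X.f (c' x y z) = W.cS u v w" unfolding uvw using xyz A(1) by (intro fhom) auto
      ultimately show "W.cS u v w \<in> X.f ` A" by (metis imageI)
    qed
    show "tree_isomorphism A c' (X.f ` A) W.cS X.f"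
      unfolding tree_isomorphism_def tree_hom_def bij_betw_def
      using A(1) fhom inj_on_subset[OF finj A(1)] by (auto simp: subset_iff)
    have fAs': "X.f ` A \<inter> space MU \<in> sets MU" using fAs by simp
    show "measure_preserving_map (restrict_space \<mu> A) (restrict_space MU (X.f ` A)) X.f"
    proof (rule mp[OF As A(1)])
      show "X.f ` A \<subseteq> space (restrict_space MU (X.f ` A))"
        using A(1) fT MU_props(1) by (auto simp: space_restrict_space)
      fix E assume "E \<in> sets (restrict_space MU (X.f ` A))"
      then have E: "E \<subseteq> X.f ` A" "E \<in> sets MU" using sets_restrict_space_iff[OF fAs'] by auto
      show "{z \<in> A. X.f z \<in> E} \<in> sets \<mu>" using law(1)[OF E(2)] pre[OF E(1)] by simp
      show "emeasure \<mu> {z \<in> A. X.f z \<in> E} = emeasure (restrict_space MU (X.f ` A)) E"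
        using law(2)[OF E(2)] pre[OF E(1)] emeasure_restrict_space[OF fAs' E(1)]
        by (simp add: P.emeasure_eq_measure PU.emeasure_eq_measure)
    qed
  qed
qed

end

theorem proposition3p13:
  fixes V :: "'a set"
    and cV :: "'a \<Rightarrow> 'a \<Rightarrow> 'a \<Rightarrow> 'a"
    and \<psi> :: "'a set \<Rightarrow> 'a \<Rightarrow> real"
  assumes "algebraic_tree V cV"
    and "countable V"
    and "\<And>x A. x \<in> V \<Longrightarrow> A \<in> tree_component V cV x ` V \<Longrightarrow> \<psi> A x \<ge> 0"
    and "\<And>x. x \<in> V \<Longrightarrow> ((\<lambda>A. \<psi> A x) has_sum 1) (tree_component V cV x ` V)"
    and "\<And>x y. x \<in> V \<Longrightarrow> y \<in> V \<Longrightarrow> x \<noteq> y \<Longrightarrow>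
           psi_pt V cV \<psi> x y + psi_pt V cV \<psi> y x \<ge> 1"
  shows "\<exists>(T :: ('a + real) set) c \<mu>.
           realizes V cV \<psi> Inl T c \<mu> \<and> tight_amt T c \<mu> \<and>
           (\<forall>\<iota> (T' :: 'b set) c' \<mu>'. realizes V cV \<psi> \<iota> T' c' \<mu>' \<longrightarrow>
              amt_embeds T' c' \<mu>' T c \<mu> \<and>
              (tight_amt T' c' \<mu>' \<longrightarrow> amt_equivalent T' c' \<mu>' T c \<mu>))"
proof -
  \<comment> \<open>The root is an arbitrary choice: it steers the construction and does not occur
    in the conclusion.\<close>
  obtain r where "r \<in> V" using assms(1) by (auto simp: algebraic_tree_def)
  then interpret prescribed_tree V cV r \<psi>
    using assms by unfold_locales
  show ?thesis
    by (intro exI[of _ W.TS] exI[of _ W.cS] exI[of _ MU] conjI allI impI MU_realizes MU_tight)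
      (simp_all add: uniqueness)
qed

end
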